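(* Let $G$ be a non-standard finite group and let $S\subseteq G\times G$ be an internal relation defined over a countable rich subset $M$ of $G$. If $S$ is dense and almost surely $k$-stable for some $k\ge 1$, then for every $g$ in $G^{00}_M$ which is dense over $M$, the internal set \[\Lambda_\Box(S)_g= \left\{ (x,y)\in G\times G : (x,y),\ (x\cdot g, y),\ (x, y\cdot g) \text{ and } (x\cdot g, y\cdot g) \text{ all lie in } S \right\} \] has positive density.
   Context: Non-standard finite groups. A non-standard finite group is an ultraproduct $G=\prod_{n\to\mathfrak U}G_n$ of finite groups with $|G_n|<|G_{n+1}|$ for all $n\in\mathbb N$, where $\mathfrak U$ is a non-principal ultrafilter on $\mathbb N$. A Cartesian power $G^k$ is identified with $\prod_{n\to\mathfrak U}G_n^k$ and is again a non-standard finite group. A subset $X\subseteq G^k$ is internal if $X=\prod_{n\to\mathfrak U}X_n$ for some $X_n\subseteq G_n^k$, i.e. $X$ is the set of classes of sequences $(g_n)$ with $g_n\in X_n$ for $\mathfrak U$-almost all $n$. Its density (Loeb measure) is $\mu_{G^k}(X)=\lim_{n\to\mathfrak U}|X_n|/|G_n|^k$; $\mu_{G^k}$ extends uniquely to a $\sigma$-additive measure on the $\sigma$-algebra generated by the internal sets. Tame families. A family $\mathcal F=\bigcup_n\mathcal F_n$, with $\mathcal F_n$ consisting of internal subsets of $G^n$, is tame if: (I) for every group word $w$ in $n$ variables, $\{\bar g\in G^n: w(\bar g)=1_G\}\in\mathcal F_n$; (II) $\mathcal F$ is closed under finite Cartesian products, Boolean combinations, projections and permutations of coordinates; (III) if $Z\in\mathcal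 F_n$, then $\{(x,y)\in G^n\times G^n: x\cdot y\in Z\}\in\mathcal F_{2n}$; (IV) if $Z\in\mathcal F_{k+m}$ and $q\in[0,1]$ is rational, there is $Y_q\in\mathcal F_m$ with $\{y\in G^m:\mu_{G^k}(Z_y)>q\}\subseteq Y_q\subseteq\{y\in G^m:\mu_{G^k}(Z_y)\ge q\}$, where $Z_y=\{x\in G^k:(x,y)\in Z\}$. Throughout, a countable tame family $\mathcal F$ is fixed, and all internal (and $\omega$-internal) sets considered belong to it. For $A\subseteq G$, $\mathcal F(A)$ is the collection of all fibres $Y_a\subseteq G^n$, where $n\in\mathbb N$, $a$ is a finite tuple from $A$ and $Y\in\mathcal F_{n+|a|}$; its members are the internal sets defined over $A$. An $\omega$-internal set (defined over $A$) is a countable intersection of internal sets (defined over $A$). A subset $M\subseteq G$ is rich if every non-empty set in $\mathcal F(M)$, say in $G^n$, contains a tuple of $M^n$. Types and density. For $A\subseteq G$ countable and a finite tuple $b$ from $G$, $\operatorname{tp}(b/A)$ is the intersection of all $X\in\mathcal F(A)$ (of the appropriate arity) containing $b$. An $\omega$-internal set is dense if it is not contained in any internal set of density $0$; an internal set is dense if and only if it has positive density. A tuple $b$ is dense over $A$ if $\operatorname{tp}(b/A)$ is dense. A tuple $(b_1,\ldots,b_r)$ is in good position over $A$ if each $b_i$ is dense over $A\cup\{b_j:j<i\}$. Connected component. For a countable rich subset $M$, $G^{00}_M$ (the connected component of $G$ over $M$) is the smallest subgroup of $G$ of the form $\bigcap_{n}Z_n$, where each $Z_n$ is an internal set defined over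 $M$ with $1_G\in Z_n=Z_n^{-1}$, finitely many translates of $Z_n$ cover $G$, and $Z_{n+1}\cdot Z_{n+1}\subseteq Z_n$ for all $n$. By Hrushovski's stabiliser theorem (a known result), $G^{00}_M$ exists, is an $\omega$-internal normal subgroup defined over $M$, and satisfies: (i) if $(a,b)$ is in good position over $M$ with $b\in\operatorname{tp}(a/M)$, then $b\cdot a^{-1}\in G^{00}_M$; in particular $G^{00}_M$ is dense; (ii) if $a$ is dense over $M$ and $g\in G^{00}_M$ is dense over $M$, then $\operatorname{tp}(a/M)\cap\operatorname{tp}(a/M)\cdot g$ and $\operatorname{tp}(a/M)\cap g\cdot\operatorname{tp}(a/M)$ are dense; (iii) if $N\supseteq M$ is a countable rich subset, then $G^{00}_N\le G^{00}_M$. Almost sure stability. A half-graph of height $k$ induced by $S\subseteq G\times G$ is a sequence $(a_1,b_1,\ldots,a_k,b_k)\in G^{2k}$ such that $(a_i,b_j)\in S$ if and only if $i\le j$; the set of all of these is $\mathcal H_k(S)$. An internal relation $S\subseteq G\times G$ is almost surely $k$-stable if $\mu_{G^{2k}}(\mathcal H_k(S))=0$. *)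

theory Defs
  imports "HOL-Analysis.Analysis" "HOL-Algebra.Product_Groups" "HOL-Combinatorics.Permutations"
begin

text \<open>
  A tuple of length \<open>k\<close> is a list of length \<open>k\<close>, so the subsets of \<open>G\<^sup>k\<close> are sets of lists and
  concatenation of tuples is list concatenation. A subset \<open>Z\<close> of \<open>G\<close> itself corresponds to
  the set \<open>(\<lambda>z. [z]) ` Z\<close> of tuples of length one.
\<close>

definition cart_pow :: "('a, 'b) monoid_scheme \<Rightarrow> nat \<Rightarrow> 'a list set" where
  "cart_pow G k = {xs. set xs \<subseteq> carrier G \<and> length xs = k}"

definition nonprincipal_ultrafilter :: "nat filter \<Rightarrow> bool" where
  "nonprincipal_ultrafilter U \<longleftrightarrow>
     U \<noteq> bot \<and> (\<forall>P. eventually P U \<or> eventually (\<lambda>n. \<not> P n) U) \<and>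
     (\<forall>m. eventually (\<lambda>n. n \<noteq> m) U)"

text \<open>
  The ultraproduct is the quotient of the full product by the normal subgroup of those sequences
  that are trivial almost everywhere. The coset of a sequence is its class modulo
  almost everywhere equality, see \<open>null_sequences_coset\<close> below.
\<close>

definition null_sequences ::
    "nat filter \<Rightarrow> (nat \<Rightarrow> ('a, 'b) monoid_scheme) \<Rightarrow> (nat \<Rightarrow> 'a) set" where
  "null_sequences U Gs =
     {x \<in> carrier (product_group UNIV Gs). eventually (\<lambda>n. x n = \<one>\<^bsub>Gs n\<^esub>) U}"

definition ultraproduct ::
    "nat filter \<Rightarrow> (nat \<Rightarrow> ('a, 'b) monoid_scheme) \<Rightarrow> (nat \<Rightarrow> 'a) set monoid" where
  "ultraproduct U Gs = product_group UNIV Gs Mod null_sequences U Gs"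

definition nonstandard_finite_group ::
    "nat filter \<Rightarrow> (nat \<Rightarrow> ('a, 'b) monoid_scheme) \<Rightarrow> bool" where
  "nonstandard_finite_group U Gs \<longleftrightarrow>
     nonprincipal_ultrafilter U \<and>
     (\<forall>n. group (Gs n) \<and> finite (carrier (Gs n)) \<and> order (Gs n) < order (Gs (Suc n)))"

text \<open>
  The elements of the ultraproduct are classes, that is, sets of sequences; \<open>gs\<close> below is a list
  of representatives of the entries of \<open>xs\<close>.
\<close>

definition internal_set ::
    "nat filter \<Rightarrow> (nat \<Rightarrow> ('a, 'b) monoid_scheme) \<Rightarrow> nat \<Rightarrow> (nat \<Rightarrow> 'a list set) \<Rightarrow>
     (nat \<Rightarrow> 'a) set list set" where
  "internal_set U Gs k Xs =
     {xs \<in> cart_pow (ultraproduct U Gs) k.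
        \<exists>gs. list_all2 (\<in>) gs xs \<and> eventually (\<lambda>n. map (\<lambda>g. g n) gs \<in> Xs n) U}"

definition internal ::
    "nat filter \<Rightarrow> (nat \<Rightarrow> ('a, 'b) monoid_scheme) \<Rightarrow> nat \<Rightarrow> (nat \<Rightarrow> 'a) set list set \<Rightarrow> bool" where
  "internal U Gs k X \<longleftrightarrow>
     (\<exists>Xs. (\<forall>n. Xs n \<subseteq> cart_pow (Gs n) k) \<and> X = internal_set U Gs k Xs)"

text \<open>
  Only meaningful for internal \<open>X\<close>; there the limit exists and is independent of the chosen \<open>Xs\<close>,
  see \<open>loeb_density_internal_set\<close> below.
\<close>

definition loeb_density ::
    "nat filter \<Rightarrow> (nat \<Rightarrow> ('a, 'b) monoid_scheme) \<Rightarrow> nat \<Rightarrow> (nat \<Rightarrow> 'a) set list set \<Rightarrow> real" where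
  "loeb_density U Gs k X =
     (THE r. \<exists>Xs. (\<forall>n. Xs n \<subseteq> cart_pow (Gs n) k) \<and> X = internal_set U Gs k Xs \<and>
        ((\<lambda>n. real (card (Xs n)) / real (order (Gs n)) ^ k) \<longlongrightarrow> r) U)"

text \<open>
  A group word is a list of pairs \<open>(i, e)\<close>, each standing for the \<open>e\<close>-th power of the \<open>i\<close>-th
  variable.
\<close>

definition word_val :: "('g, 'b) monoid_scheme \<Rightarrow> (nat \<times> int) list \<Rightarrow> 'g list \<Rightarrow> 'g" where
  "word_val G w xs = foldr (\<lambda>(i, e) h. (xs ! i) [^]\<^bsub>G\<^esub> e \<otimes>\<^bsub>G\<^esub> h) w \<one>\<^bsub>G\<^esub>"

text \<open>The fibre of \<open>Z \<subseteq> G\<^sup>k\<^sup>+\<^sup>m\<close> over the tuple \<open>y\<close>, as a subset of \<open>G\<^sup>k\<close>.\<close>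

definition fibre :: "('g, 'b) monoid_scheme \<Rightarrow> nat \<Rightarrow> 'g list set \<Rightarrow> 'g list \<Rightarrow> 'g list set" where
  "fibre G k Z y = {x \<in> cart_pow G k. x @ y \<in> Z}"

definition tame_family ::
    "nat filter \<Rightarrow> (nat \<Rightarrow> ('a, 'b) monoid_scheme) \<Rightarrow>
     (nat \<Rightarrow> (nat \<Rightarrow> 'a) set list set set) \<Rightarrow> bool" where
  "tame_family U Gs F \<longleftrightarrow> (let G = ultraproduct U Gs in
     (\<forall>n. \<forall>X \<in> F n. internal U Gs n X) \<and>
     (\<forall>n w. (\<forall>(i, e) \<in> set w. i < n) \<longrightarrow>
        {xs \<in> cart_pow G n. word_val G w xs = \<one>\<^bsub>G\<^esub>} \<in> F n) \<and>
     (\<forall>n m. \<forall>X \<in> F n. \<forall>Y \<in> F m. {x @ y | x y. x \<in> X \<and> y \<in> Y} \<in> F (n + m)) \<and>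
     (\<forall>n. \<forall>X \<in> F n. cart_pow G n - X \<in> F n) \<and>
     (\<forall>n. \<forall>X \<in> F n. \<forall>Y \<in> F n. X \<union> Y \<in> F n \<and> X \<inter> Y \<in> F n) \<and>
     (\<forall>n m. \<forall>X \<in> F (n + m). take n ` X \<in> F n) \<and>
     (\<forall>n p. p permutes {..<n} \<longrightarrow> (\<forall>X \<in> F n. permute_list p ` X \<in> F n)) \<and>
     (\<forall>n. \<forall>Z \<in> F n.
        {x @ y | x y. x \<in> cart_pow G n \<and> y \<in> cart_pow G n \<and> map2 (\<otimes>\<^bsub>G\<^esub>) x y \<in> Z}
          \<in> F (2 * n)) \<and>
     (\<forall>k m. \<forall>Z \<in> F (k + m). \<forall>q \<in> \<rat> \<inter> {0..1}. \<exists>Y \<in> F m.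
        {y \<in> cart_pow G m. loeb_density U Gs k (fibre G k Z y) > q} \<subseteq> Y \<and>
        Y \<subseteq> {y \<in> cart_pow G m. loeb_density U Gs k (fibre G k Z y) \<ge> q}))"

text \<open>\<open>defined_over G F A n\<close> is the collection of the members of \<open>\<F>(A)\<close> that are subsets of \<open>G\<^sup>n\<close>.\<close>

definition defined_over ::
    "('g, 'b) monoid_scheme \<Rightarrow> (nat \<Rightarrow> 'g list set set) \<Rightarrow> 'g set \<Rightarrow> nat \<Rightarrow> 'g list set set" where
  "defined_over G F A n = {fibre G n Y a | Y a. set a \<subseteq> A \<and> Y \<in> F (n + length a)}"

definition rich :: "('g, 'b) monoid_scheme \<Rightarrow> (nat \<Rightarrow> 'g list set set) \<Rightarrow> 'g set \<Rightarrow> bool" where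
  "rich G F M \<longleftrightarrow>
     M \<subseteq> carrier G \<and> (\<forall>n. \<forall>X \<in> defined_over G F M n. X \<noteq> {} \<longrightarrow> (\<exists>x \<in> X. set x \<subseteq> M))"

definition tp ::
    "('g, 'b) monoid_scheme \<Rightarrow> (nat \<Rightarrow> 'g list set set) \<Rightarrow> 'g list \<Rightarrow> 'g set \<Rightarrow> 'g list set" where
  "tp G F b A = \<Inter> {X \<in> defined_over G F A (length b). b \<in> X}"

text \<open>
  \<open>X \<subseteq> G\<^sup>n\<close> is meant to be internal or \<open>\<omega>\<close>-internal. The internal sets of density zero
  range over the members of the family, with arbitrary parameters.
\<close>

definition dense ::
    "nat filter \<Rightarrow> (nat \<Rightarrow> ('a, 'b) monoid_scheme) \<Rightarrow> (nat \<Rightarrow> (nat \<Rightarrow> 'a) set list set set) \<Rightarrow>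
     nat \<Rightarrow> (nat \<Rightarrow> 'a) set list set \<Rightarrow> bool" where
  "dense U Gs F n X \<longleftrightarrow> (let G = ultraproduct U Gs in
     \<not> (\<exists>Z \<in> defined_over G F (carrier G) n. loeb_density U Gs n Z = 0 \<and> X \<subseteq> Z))"

definition dense_over ::
    "nat filter \<Rightarrow> (nat \<Rightarrow> ('a, 'b) monoid_scheme) \<Rightarrow> (nat \<Rightarrow> (nat \<Rightarrow> 'a) set list set set) \<Rightarrow>
     (nat \<Rightarrow> 'a) set list \<Rightarrow> (nat \<Rightarrow> 'a) set set \<Rightarrow> bool" where
  "dense_over U Gs F b A \<longleftrightarrow> dense U Gs F (length b) (tp (ultraproduct U Gs) F b A)"

definition component_candidate ::
    "('g, 'b) monoid_scheme \<Rightarrow> (nat \<Rightarrow> 'g list set set) \<Rightarrow> 'g set \<Rightarrow> 'g set \<Rightarrow> bool" where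
  "component_candidate G F M H \<longleftrightarrow> subgroup H G \<and>
     (\<exists>Z :: nat \<Rightarrow> 'g set. H = (\<Inter>n. Z n) \<and>
        (\<forall>n. (\<lambda>z. [z]) ` Z n \<in> defined_over G F M 1 \<and>
             \<one>\<^bsub>G\<^esub> \<in> Z n \<and> set_inv\<^bsub>G\<^esub> (Z n) = Z n \<and>
             (\<exists>T. finite T \<and> T \<subseteq> carrier G \<and> carrier G \<subseteq> (\<Union>t \<in> T. t <#\<^bsub>G\<^esub> Z n)) \<and>
             Z (Suc n) <#>\<^bsub>G\<^esub> Z (Suc n) \<subseteq> Z n))"

definition component_over ::
    "('g, 'b) monoid_scheme \<Rightarrow> (nat \<Rightarrow> 'g list set set) \<Rightarrow> 'g set \<Rightarrow> 'g set" where
  "component_over G F M = (LEAST H. component_candidate G F M H)"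

text \<open>
  The tuple \<open>(a\<^sub>1, b\<^sub>1, \<dots>, a\<^sub>k, b\<^sub>k)\<close> is the list \<open>xs\<close> of length \<open>2 * k\<close> with \<open>a\<^sub>i\<^sub>+\<^sub>1 = xs ! (2 * i)\<close>
  and \<open>b\<^sub>i\<^sub>+\<^sub>1 = xs ! (2 * i + 1)\<close>.
\<close>

definition half_graphs :: "('g, 'b) monoid_scheme \<Rightarrow> nat \<Rightarrow> 'g list set \<Rightarrow> 'g list set" where
  "half_graphs G k S =
     {xs \<in> cart_pow G (2 * k).
        \<forall>i < k. \<forall>j < k. [xs ! (2 * i), xs ! (2 * j + 1)] \<in> S \<longleftrightarrow> i \<le> j}"

definition almost_surely_stable ::
    "nat filter \<Rightarrow> (nat \<Rightarrow> ('a, 'b) monoid_scheme) \<Rightarrow> nat \<Rightarrow> (nat \<Rightarrow> 'a) set list set \<Rightarrow> bool" where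
  "almost_surely_stable U Gs k S \<longleftrightarrow>
     loeb_density U Gs (2 * k) (half_graphs (ultraproduct U Gs) k S) = 0"

definition squares :: "('g, 'b) monoid_scheme \<Rightarrow> 'g list set \<Rightarrow> 'g \<Rightarrow> 'g list set" where
  "squares G S g =
     {[x, y] | x y. x \<in> carrier G \<and> y \<in> carrier G \<and>
        [x, y] \<in> S \<and> [x \<otimes>\<^bsub>G\<^esub> g, y] \<in> S \<and> [x, y \<otimes>\<^bsub>G\<^esub> g] \<in> S \<and> [x \<otimes>\<^bsub>G\<^esub> g, y \<otimes>\<^bsub>G\<^esub> g] \<in> S}"

lemma null_sequences_normal:
  assumes "\<And>n. group (Gs n)"
  shows "null_sequences U Gs \<lhd> product_group UNIV Gs"
proof -
  interpret P: group "product_group UNIV Gs" by (simp add: assms)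
  have sub: "subgroup (null_sequences U Gs) (product_group UNIV Gs)"
  proof
    show "null_sequences U Gs \<subseteq> carrier (product_group UNIV Gs)"
      by (auto simp: null_sequences_def)
    show "\<one>\<^bsub>product_group UNIV Gs\<^esub> \<in> null_sequences U Gs"
      using P.one_closed by (auto simp: null_sequences_def simp del: carrier_product_group)
  next
    fix x y assume xy: "x \<in> null_sequences U Gs" "y \<in> null_sequences U Gs"
    then have "x \<otimes>\<^bsub>product_group UNIV Gs\<^esub> y \<in> carrier (product_group UNIV Gs)"
      unfolding null_sequences_def by blast
    moreover have "eventually (\<lambda>n. (x \<otimes>\<^bsub>product_group UNIV Gs\<^esub> y) n = \<one>\<^bsub>Gs n\<^esub>) U"
    proof -
      have "eventually (\<lambda>n. x n = \<one>\<^bsub>Gs n\<^esub>) U" "eventually (\<lambda>n. y n = \<one>\<^bsub>Gs n\<^esub>) U"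
        using xy by (auto simp: null_sequences_def)
      then show ?thesis
        by eventually_elim (simp add: assms group.is_monoid)
    qed
    ultimately show "x \<otimes>\<^bsub>product_group UNIV Gs\<^esub> y \<in> null_sequences U Gs"
      unfolding null_sequences_def by blast
  next
    fix x assume x: "x \<in> null_sequences U Gs"
    then have c: "x \<in> carrier (product_group UNIV Gs)" by (simp add: null_sequences_def)
    have "eventually (\<lambda>n. (inv\<^bsub>product_group UNIV Gs\<^esub> x) n = \<one>\<^bsub>Gs n\<^esub>) U"
    proof -
      have "eventually (\<lambda>n. x n = \<one>\<^bsub>Gs n\<^esub>) U" using x by (auto simp: null_sequences_def)
      then show ?thesis
        by eventually_elim (use c in \<open>simp add: assms group.is_monoid monoid.inv_one\<close>)
    qed
    then show "inv\<^bsub>product_group UNIV Gs\<^esub> x \<in> null_sequences U Gs"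
      using P.inv_closed[OF c] unfolding null_sequences_def by blast
  qed
  moreover have "x \<otimes>\<^bsub>product_group UNIV Gs\<^esub> h \<otimes>\<^bsub>product_group UNIV Gs\<^esub>
      inv\<^bsub>product_group UNIV Gs\<^esub> x \<in> null_sequences U Gs"
    if x: "x \<in> carrier (product_group UNIV Gs)" and h: "h \<in> null_sequences U Gs" for x h
  proof -
    have hc: "h \<in> carrier (product_group UNIV Gs)" using h by (simp add: null_sequences_def)
    have xn: "x n \<in> carrier (Gs n)" for n using x by auto
    have "eventually (\<lambda>n. h n = \<one>\<^bsub>Gs n\<^esub>) U" using h by (auto simp: null_sequences_def)
    then have "eventually (\<lambda>n. (x \<otimes>\<^bsub>product_group UNIV Gs\<^esub> h \<otimes>\<^bsub>product_group UNIV Gs\<^esub>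
        inv\<^bsub>product_group UNIV Gs\<^esub> x) n = \<one>\<^bsub>Gs n\<^esub>) U"
      by eventually_elim (use x in \<open>simp add: assms group.is_monoid monoid.r_one group.r_inv xn\<close>)
    moreover have "x \<otimes>\<^bsub>product_group UNIV Gs\<^esub> h \<otimes>\<^bsub>product_group UNIV Gs\<^esub>
        inv\<^bsub>product_group UNIV Gs\<^esub> x \<in> carrier (product_group UNIV Gs)"
      by (intro P.m_closed P.inv_closed x hc)
    ultimately show ?thesis unfolding null_sequences_def by blast
  qed
  ultimately show ?thesis
    by (intro P.normal_invI) 
qed

lemma group_ultraproduct:
  assumes "\<And>n. group (Gs n)"
  shows "group (ultraproduct U Gs)"
  unfolding ultraproduct_def
  by (rule normal.factorgroup_is_group[OF null_sequences_normal[OF assms]])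

lemma null_sequences_coset:
  assumes "\<And>n. group (Gs n)" and x: "x \<in> carrier (product_group UNIV Gs)"
  shows "null_sequences U Gs #>\<^bsub>product_group UNIV Gs\<^esub> x =
    {y \<in> carrier (product_group UNIV Gs). eventually (\<lambda>n. y n = x n) U}"
proof -
  interpret P: group "product_group UNIV Gs" by (simp add: assms)
  have xn: "x n \<in> carrier (Gs n)" for n using x by auto
  show ?thesis
  proof (intro Set.set_eqI iffI)
    fix y assume "y \<in> null_sequences U Gs #>\<^bsub>product_group UNIV Gs\<^esub> x"
    then obtain h where h: "h \<in> null_sequences U Gs" "y = h \<otimes>\<^bsub>product_group UNIV Gs\<^esub> x"
      by (auto simp: r_coset_def)
    then have "h \<in> carrier (product_group UNIV Gs)" by (simp add: null_sequences_def)
    with h(2) x have "y \<in> carrier (product_group UNIV Gs)" by blast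
    moreover have "eventually (\<lambda>n. h n = \<one>\<^bsub>Gs n\<^esub>) U" using h by (auto simp: null_sequences_def)
    then have "eventually (\<lambda>n. y n = x n) U"
      by eventually_elim (simp add: h(2) assms group.is_monoid monoid.l_one xn)
    ultimately show "y \<in> {y \<in> carrier (product_group UNIV Gs). eventually (\<lambda>n. y n = x n) U}"
      by blast
  next
    fix y assume "y \<in> {y \<in> carrier (product_group UNIV Gs). eventually (\<lambda>n. y n = x n) U}"
    then have y: "y \<in> carrier (product_group UNIV Gs)" "eventually (\<lambda>n. y n = x n) U" by auto
    let ?h = "y \<otimes>\<^bsub>product_group UNIV Gs\<^esub> inv\<^bsub>product_group UNIV Gs\<^esub> x"
    have "?h \<in> carrier (product_group UNIV Gs)" using x y(1) by blast
    moreover have "eventually (\<lambda>n. ?h n = \<one>\<^bsub>Gs n\<^esub>) U"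
      using y(2) by eventually_elim (use x in \<open>simp add: assms group.r_inv xn\<close>)
    ultimately have "?h \<in> null_sequences U Gs" unfolding null_sequences_def by blast
    moreover have "y = ?h \<otimes>\<^bsub>product_group UNIV Gs\<^esub> x"
      by (simp add: P.m_assoc x y(1) P.l_inv P.r_one del: carrier_product_group
          mult_product_group inv_product_group one_product_group)
    ultimately show "y \<in> null_sequences U Gs #>\<^bsub>product_group UNIV Gs\<^esub> x"
      unfolding r_coset_def by blast
  qed
qed

lemma internal_set_mono_imp:
  assumes grp: "\<And>n. group (Gs n)" and U: "nonprincipal_ultrafilter U"
    and X: "\<And>n. Xs n \<subseteq> cart_pow (Gs n) k"
    and le: "internal_set U Gs k Xs \<subseteq> internal_set U Gs k Ys"
  shows "eventually (\<lambda>n. Xs n \<subseteq> Ys n) U"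
proof (rule ccontr)
  assume "\<not> eventually (\<lambda>n. Xs n \<subseteq> Ys n) U"
  then have ev: "eventually (\<lambda>n. \<not> Xs n \<subseteq> Ys n) U"
    using U by (auto simp: nonprincipal_ultrafilter_def)
  let ?P = "product_group UNIV Gs" and ?N = "null_sequences U Gs"
  have "\<exists>t. t \<in> cart_pow (Gs n) k \<and> (\<not> Xs n \<subseteq> Ys n \<longrightarrow> t \<in> Xs n - Ys n)" for n
  proof (cases "Xs n \<subseteq> Ys n")
    case True
    have "replicate k \<one>\<^bsub>Gs n\<^esub> \<in> cart_pow (Gs n) k"
      using group.is_monoid[OF grp] monoid.one_closed by (fastforce simp: cart_pow_def)
    with True show ?thesis by blast
  next
    case False
    with X show ?thesis by blast
  qed
  then obtain t where t: "\<And>n. t n \<in> cart_pow (Gs n) k"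
    and tX: "\<And>n. \<not> Xs n \<subseteq> Ys n \<Longrightarrow> t n \<in> Xs n - Ys n" by metis
  have len: "length (t n) = k" for n using t[of n] by (simp add: cart_pow_def)
  define gs where "gs = map (\<lambda>i n. t n ! i) [0..<k]"
  define xs where "xs = map (\<lambda>g. ?N #>\<^bsub>?P\<^esub> g) gs"
  have gs_eq: "map (\<lambda>g. g n) gs = t n" for n
    by (rule nth_equalityI) (simp_all add: gs_def len)
  have gc: "g \<in> carrier ?P" if "g \<in> set gs" for g
  proof -
    from that obtain i where i: "i < k" "g = (\<lambda>n. t n ! i)" by (auto simp: gs_def)
    have "t n ! i \<in> carrier (Gs n)" for n
      using t[of n] i(1) by (auto simp: cart_pow_def)
    then show ?thesis by (auto simp: i(2))
  qed
  have coset: "?N #>\<^bsub>?P\<^esub> g = {y \<in> carrier ?P. eventually (\<lambda>n. y n = g n) U}" if "g \<in> set gs" for g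
    by (rule null_sequences_coset[OF grp gc[OF that]])
  have "xs \<in> cart_pow (ultraproduct U Gs) k"
    using gc by (auto simp: xs_def cart_pow_def ultraproduct_def FactGroup_def RCOSETS_def gs_def
        simp del: carrier_product_group)
  moreover have "list_all2 (\<in>) gs xs"
    unfolding xs_def by (simp add: list_all2_conv_all_nth coset gc del: carrier_product_group)
  moreover have "eventually (\<lambda>n. map (\<lambda>g. g n) gs \<in> Xs n) U"
    using ev by eventually_elim (use tX gs_eq in auto)
  ultimately have "xs \<in> internal_set U Gs k Xs" unfolding internal_set_def by blast
  with le have "xs \<in> internal_set U Gs k Ys" by blast
  then obtain hs where hs: "list_all2 (\<in>) hs xs" "eventually (\<lambda>n. map (\<lambda>g. g n) hs \<in> Ys n) U"
    unfolding internal_set_def by blast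
  have lhs: "length hs = k" using hs(1) by (auto simp: list_all2_conv_all_nth xs_def gs_def)
  have "eventually (\<lambda>n. (hs ! i) n = t n ! i) U" if "i < k" for i
  proof -
    have "hs ! i \<in> xs ! i" using hs(1) that lhs by (auto simp: list_all2_conv_all_nth)
    moreover have "gs ! i \<in> set gs" using that by (simp add: gs_def)
    ultimately show ?thesis
      using coset[of "gs ! i"] that by (simp add: xs_def gs_def del: carrier_product_group)
  qed
  then have "eventually (\<lambda>n. \<forall>i\<in>{..<k}. (hs ! i) n = t n ! i) U"
    by (intro eventually_ball_finite) auto
  then have "eventually (\<lambda>n. map (\<lambda>g. g n) hs = t n) U"
    by eventually_elim (auto intro!: nth_equalityI simp: lhs len)
  with hs(2) ev have "eventually (\<lambda>n. False) U"
    by eventually_elim (use tX in auto)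
  then show False using U by (auto simp: nonprincipal_ultrafilter_def)
qed

lemma loeb_density_internal_set:
  assumes G: "nonstandard_finite_group U Gs" and X: "\<And>n. Xs n \<subseteq> cart_pow (Gs n) k"
  shows "((\<lambda>n. real (card (Xs n)) / real (order (Gs n)) ^ k) \<longlongrightarrow>
    loeb_density U Gs k (internal_set U Gs k Xs)) U"
proof -
  have U: "nonprincipal_ultrafilter U" and grp: "\<And>n. group (Gs n)"
    and fin: "\<And>n. finite (carrier (Gs n))"
    using G by (auto simp: nonstandard_finite_group_def)
  have nb: "U \<noteq> bot" using U by (simp add: nonprincipal_ultrafilter_def)
  let ?r = "\<lambda>n. real (card (Xs n)) / real (order (Gs n)) ^ k"
  have r01: "?r n \<in> {0..1}" for n
  proof -
    have "card (Xs n) \<le> card (cart_pow (Gs n) k)"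
      using X fin by (intro card_mono) (auto simp: cart_pow_def finite_lists_length_eq)
    also have "\<dots> = order (Gs n) ^ k"
      using fin by (simp add: cart_pow_def card_lists_length_eq order_def)
    finally have "real (card (Xs n)) \<le> real (order (Gs n)) ^ k"
      by (metis of_nat_le_iff of_nat_power)
    then show ?thesis by (auto simp: divide_le_eq_1)
  qed
  have "filtermap ?r U \<noteq> bot" using nb by (simp add: filtermap_bot_iff)
  moreover have "eventually (\<lambda>x. x \<in> {0..1}) (filtermap ?r U)"
    unfolding eventually_filtermap using r01 by (intro always_eventually allI)
  ultimately obtain L where L: "inf (nhds L) (filtermap ?r U) \<noteq> bot"
    using compact_Icc[of "0::real" 1] unfolding compact_filter by blast
  have lim: "(?r \<longlongrightarrow> L) U"
  proof (rule topological_tendstoI, rule ccontr)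
    fix S assume S: "open S" "L \<in> S" and "\<not> eventually (\<lambda>n. ?r n \<in> S) U"
    then have "eventually (\<lambda>n. ?r n \<notin> S) U"
      using U unfolding nonprincipal_ultrafilter_def by blast
    then have "eventually (\<lambda>x. x \<notin> S) (filtermap ?r U)" by (simp add: eventually_filtermap)
    moreover have "eventually (\<lambda>x. x \<in> S) (nhds L)" using S by (auto simp: eventually_nhds)
    ultimately have "eventually (\<lambda>x. False) (inf (nhds L) (filtermap ?r U))"
      unfolding eventually_inf by blast
    with L show False by (simp add: trivial_limit_def)
  qed
  have "loeb_density U Gs k (internal_set U Gs k Xs) = L"
    unfolding loeb_density_def
  proof (rule the_equality)
    show "\<exists>Ys. (\<forall>n. Ys n \<subseteq> cart_pow (Gs n) k) \<and> internal_set U Gs k Xs = internal_set U Gs k Ys \<and>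
        ((\<lambda>n. real (card (Ys n)) / real (order (Gs n)) ^ k) \<longlongrightarrow> L) U"
      using X lim by blast
  next
    fix r assume "\<exists>Ys. (\<forall>n. Ys n \<subseteq> cart_pow (Gs n) k) \<and>
        internal_set U Gs k Xs = internal_set U Gs k Ys \<and>
        ((\<lambda>n. real (card (Ys n)) / real (order (Gs n)) ^ k) \<longlongrightarrow> r) U"
    then obtain Ys where Y: "\<And>n. Ys n \<subseteq> cart_pow (Gs n) k"
      and eq: "internal_set U Gs k Xs = internal_set U Gs k Ys"
      and limY: "((\<lambda>n. real (card (Ys n)) / real (order (Gs n)) ^ k) \<longlongrightarrow> r) U" by blast
    have "eventually (\<lambda>n. Xs n \<subseteq> Ys n) U"
      by (rule internal_set_mono_imp[OF grp U X]) (use eq in auto)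
    moreover have "eventually (\<lambda>n. Ys n \<subseteq> Xs n) U"
      by (rule internal_set_mono_imp[OF grp U Y]) (use eq in auto)
    ultimately have "eventually (\<lambda>n. real (card (Ys n)) / real (order (Gs n)) ^ k = ?r n) U"
      by eventually_elim (use subset_antisym in metis)
    with limY have "(?r \<longlongrightarrow> r) U" by (rule Lim_transform_eventually)
    then show "r = L" using tendsto_unique[OF nb _ lim] by blast
  qed
  with lim show ?thesis by simp
qed

end

theory Submission
  imports Defs
begin

text \<open>
  Two facts are combined. First, if \<open>g\<close> lies in the component and is dense over \<open>M\<close>, then
  \<open>\<mu>(A \<inter> A g\<^sup>-\<^sup>1) \<ge> \<mu>(A)\<^sup>2\<close> for every \<open>A \<in> \<F>(M)\<close>: the elements moving the convolution of \<open>A\<close> with a set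
  \<open>W \<in> \<F>(M)\<close> by nothing in \<open>L\<^sup>2\<close> form a candidate for the component (finitely many translates of a
  neighbourhood suffice because convolutions are almost periodic), so \<open>g\<close> fixes all these
  convolutions, and a failure of the inequality would give arbitrarily many functions of mean
  \<open>\<mu>(A)\<close> whose pairwise inner products stay below \<open>\<mu>(A)\<^sup>2\<close>. In particular the stabiliser theorem is not
  needed; the component exists because there are only countably many definable sets.
  Second, an almost surely stable dense relation contains almost all of some rectangle of positive
  density; moving its parameters into \<open>M\<close> gives \<open>A, B \<in> \<F>(M)\<close> with
  \<open>4 \<mu>(A \<times> B - S) < \<mu>(A)\<^sup>2 \<mu>(B)\<^sup>2\<close>. Among the pairs \<open>(x, y)\<close> with \<open>x, x g \<in> A\<close> and \<open>y, y g \<in> B\<close>, which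
  have density at least \<open>\<mu>(A)\<^sup>2 \<mu>(B)\<^sup>2\<close>, not all can then be lost to the four translates of \<open>A \<times> B - S\<close>.
\<close>

section \<open>Internal sets and their densities\<close>

text \<open>Smoothing by \<open>W\<close> is what makes the component accessible. The elements that
  almost fix the indicator of \<open>A\<close> itself need not form a generic set, whereas the bound
  for convolutions depends only on \<open>\<mu> W\<close> and on the error, not on the index n, so
  it survives the ultraproduct. Density of \<open>g\<close> over \<open>M\<close> makes every
  admissible \<open>W\<close> containing \<open>g\<close> of positive density, hence
  \<open>h\<^sub>W\<close> can be normalised. Recurrence is available only for sets defined over
  \<open>M\<close>. This is why the parameters of the rectangle have to be moved into
  \<open>M\<close>; afterwards the missing part is merely small, and it has to be small compared
  with the squares that recurrence provides. Fibre densities can be cut at a level only up to a gap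
  between two thresholds. All the slack comes from this: the radii r/2 and r of the neighbourhoods,
  the levels \<open>3 * d\<close>, \<open>2 * d\<close>, \<open>d\<close> in the recurrence
  argument, and the halved densities of the rectangle.\<close>

locale ultra =
  fixes U :: "nat filter" and Gs :: "nat \<Rightarrow> ('a, 'b) monoid_scheme"
  assumes nsfg: "nonstandard_finite_group U Gs"
begin

abbreviation "G \<equiv> ultraproduct U Gs"
abbreviation "\<mu> \<equiv> loeb_density U Gs"
abbreviation "P \<equiv> product_group UNIV Gs"
abbreviation at_idx :: "nat \<Rightarrow> (nat \<Rightarrow> 'a) list \<Rightarrow> 'a list" where
  "at_idx n ss \<equiv> map (\<lambda>s. s n) ss"

abbreviation mult_at ("_ \<star>\<^sub>_ _" [70, 1000, 71] 70) where
  "x \<star>\<^sub>n y \<equiv> x \<otimes>\<^bsub>Gs n\<^esub> y"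
abbreviation one_at ("\<one>\<^sub>_" [1000] 1000) where
  "\<one>\<^sub>n \<equiv> \<one>\<^bsub>Gs n\<^esub>"

abbreviation mult_G (infixl "\<cdot>" 70) where
  "x \<cdot> y \<equiv> x \<otimes>\<^bsub>G\<^esub> y"

lemma U_props: "U \<noteq> bot" "nonprincipal_ultrafilter U"
  using nsfg by (auto simp: nonstandard_finite_group_def nonprincipal_ultrafilter_def)

lemma grp [simp]: "group (Gs n)" and fin [simp]: "finite (carrier (Gs n))"
  using nsfg by (auto simp: nonstandard_finite_group_def)

lemma mon [simp]: "monoid (Gs n)"
  by (simp add: group.is_monoid)

lemma ev_not: "eventually (\<lambda>n. \<not> Q n) U \<longleftrightarrow> \<not> eventually Q U"
proof
  assume a: "eventually (\<lambda>n. \<not> Q n) U"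
  show "\<not> eventually Q U"
  proof
    assume "eventually Q U"
    with a have "eventually (\<lambda>n. False) U" by eventually_elim auto
    with U_props(1) show False by simp
  qed
qed (use U_props(2) in \<open>auto simp: nonprincipal_ultrafilter_def\<close>)

lemma ev_disj: "eventually (\<lambda>n. Q n \<or> R n) U \<longleftrightarrow> eventually Q U \<or> eventually R U"
  using ev_not[of Q] ev_not[of R] ev_not[of "\<lambda>n. Q n \<or> R n"]
  by (auto simp: eventually_conj_iff elim: eventually_mono)

text \<open>Ultrafilters are prime. A choice among finitely many alternatives that varies with the
  index can therefore be made constant almost everywhere.\<close>

lemma ev_bex:
  assumes "finite I" "eventually (\<lambda>n. \<exists>i\<in>I. Q i n) U"
  shows "\<exists>i\<in>I. eventually (Q i) U"
  using assms by (induction I) (auto simp: ev_disj U_props)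

sublocale group G
  by (rule group_ultraproduct) simp

section \<open>Elements of the ultraproduct and their representing sequences\<close>

lemma carrier_P: "s \<in> carrier P \<longleftrightarrow> (\<forall>n. s n \<in> carrier (Gs n))"
  by auto

text \<open>The cosets in the quotient group, rewritten as classes modulo almost everywhere
  equality. From here on an element \<open>x\<close> of \<open>G\<close> is handled through
  sequences \<open>s \<in> x\<close>.\<close>

definition cls :: "(nat \<Rightarrow> 'a) \<Rightarrow> (nat \<Rightarrow> 'a) set" where
  "cls s = {t. (\<forall>n. t n \<in> carrier (Gs n)) \<and> eventually (\<lambda>n. t n = s n) U}"

lemma cls_coset: "(\<And>n. s n \<in> carrier (Gs n)) \<Longrightarrow> null_sequences U Gs #>\<^bsub>P\<^esub> s = cls s"
  by (subst null_sequences_coset) (auto simp: cls_def)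

lemma carrier_G: "carrier G = cls ` {s. \<forall>n. s n \<in> carrier (Gs n)}"
proof -
  have "carrier G = (\<lambda>s. null_sequences U Gs #>\<^bsub>P\<^esub> s) ` {s. s \<in> carrier P}"
    unfolding ultraproduct_def FactGroup_def RCOSETS_def by auto
  also have "\<dots> = cls ` {s. \<forall>n. s n \<in> carrier (Gs n)}"
    unfolding carrier_P by (intro image_cong) (auto simp: cls_coset)
  finally show ?thesis .
qed

lemma cls_self: "(\<And>n. s n \<in> carrier (Gs n)) \<Longrightarrow> s \<in> cls s"
  by (simp add: cls_def)

lemma cls_in: "(\<And>n. s n \<in> carrier (Gs n)) \<Longrightarrow> cls s \<in> carrier G"
  by (auto simp: carrier_G)

lemma rep_cls: "x \<in> carrier G \<Longrightarrow> s \<in> x \<Longrightarrow> x = cls s"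
  by (auto simp: carrier_G cls_def elim: eventually_elim2)

lemma rep_in: "x \<in> carrier G \<Longrightarrow> s \<in> x \<Longrightarrow> s n \<in> carrier (Gs n)"
  by (auto simp: carrier_G cls_def)

lemma rep_ex: "x \<in> carrier G \<Longrightarrow> \<exists>s. s \<in> x"
  by (auto simp: carrier_G intro: cls_self)

lemma rep_eq: "x \<in> carrier G \<Longrightarrow> s \<in> x \<Longrightarrow> t \<in> x \<Longrightarrow> eventually (\<lambda>n. s n = t n) U"
  by (auto simp: carrier_G cls_def elim: eventually_elim2)

lemma rep_mult:
  assumes "x \<in> carrier G" "y \<in> carrier G" "s \<in> x" "t \<in> y"
  shows "(\<lambda>n. s n \<star>\<^sub>n t n) \<in> x \<cdot> y"
proof -
  have s: "s \<in> carrier P" and t: "t \<in> carrier P"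
    using assms rep_in by (simp_all add: carrier_P del: carrier_product_group)
  have "x \<cdot> y = x <#>\<^bsub>P\<^esub> y" by (simp add: ultraproduct_def FactGroup_def)
  moreover have "(\<lambda>n. s n \<star>\<^sub>n t n) = s \<otimes>\<^bsub>P\<^esub> t"
    by (simp add: product_group_def restrict_def)
  ultimately show ?thesis using assms(3,4) by (auto simp: set_mult_def)
qed

lemma rep_one: "(\<lambda>n. \<one>\<^sub>n) \<in> \<one>\<^bsub>G\<^esub>"
  by (auto simp: ultraproduct_def FactGroup_def null_sequences_def monoid.one_closed)

lemma rep_unique:
  assumes "x \<in> carrier G" "y \<in> carrier G" "s \<in> x" "t \<in> y" "eventually (\<lambda>n. s n = t n) U"
  shows "x = y"
proof -
  have "s \<in> cls t" using assms rep_in[OF assms(1,3)] by (simp add: cls_def)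
  then have "s \<in> y" using rep_cls[OF assms(2,4)] by simp
  then show ?thesis using rep_cls[OF assms(1,3)] rep_cls[OF assms(2)] by simp
qed

lemma rep_inv:
  assumes "x \<in> carrier G" "s \<in> x"
  shows "(\<lambda>n. inv\<^bsub>Gs n\<^esub> s n) \<in> inv\<^bsub>G\<^esub> x"
proof -
  let ?t = "\<lambda>n. inv\<^bsub>Gs n\<^esub> s n"
  have t: "?t n \<in> carrier (Gs n)" for n using rep_in[OF assms] by simp
  have "(\<lambda>n. ?t n \<star>\<^sub>n s n) \<in> cls ?t \<cdot> x"
    by (rule rep_mult[OF cls_in[OF t] assms(1) cls_self[OF t] assms(2)])
  then have "(\<lambda>n. \<one>\<^sub>n) \<in> cls ?t \<cdot> x"
    using rep_in[OF assms] by (simp add: group.l_inv)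
  then have "cls ?t \<cdot> x = \<one>\<^bsub>G\<^esub>"
    using cls_in[OF t] assms(1) by (intro rep_unique[OF _ _ _ rep_one]) auto
  then have "cls ?t = inv\<^bsub>G\<^esub> x"
    using inv_equality[of "cls ?t" x] assms(1) cls_in[OF t] by simp
  then show ?thesis using cls_self[OF t] by simp
qed

lemma tuple_rep_ex: "xs \<in> cart_pow G k \<Longrightarrow> \<exists>ss. list_all2 (\<in>) ss xs"
proof -
  assume xs: "xs \<in> cart_pow G k"
  then have "\<forall>x\<in>set xs. \<exists>s. s \<in> x" by (intro ballI rep_ex) (auto simp: cart_pow_def)
  then obtain f where f: "\<And>x. x \<in> set xs \<Longrightarrow> f x \<in> x" by metis
  have "list_all2 (\<in>) (map f xs) xs"
    by (auto simp: list_all2_conv_all_nth f)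
  then show ?thesis by blast
qed

lemma tuple_rep_in:
  assumes "xs \<in> cart_pow G k" "list_all2 (\<in>) ss xs"
  shows "at_idx n ss \<in> cart_pow (Gs n) k"
proof -
  have "ss ! i \<in> xs ! i" "xs ! i \<in> carrier G" if "i < k" for i
    using that assms by (auto simp: cart_pow_def list_all2_conv_all_nth)
  then have "(ss ! i) n \<in> carrier (Gs n)" if "i < k" for i using rep_in that by blast
  moreover have "length ss = k" using assms by (auto simp: cart_pow_def dest: list_all2_lengthD)
  ultimately show ?thesis by (auto simp: cart_pow_def in_set_conv_nth)
qed

lemma tuple_rep_eq:
  assumes "xs \<in> cart_pow G k" "list_all2 (\<in>) ss xs" "list_all2 (\<in>) ts xs"
  shows "eventually (\<lambda>n. at_idx n ss = at_idx n ts) U"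
proof -
  have len: "length ss = k" "length ts = k"
    using assms by (auto simp: cart_pow_def list_all2_conv_all_nth)
  have "eventually (\<lambda>n. (ss ! i) n = (ts ! i) n) U" if "i < k" for i
    using that assms by (intro rep_eq[of "xs ! i"]) (auto simp: cart_pow_def list_all2_conv_all_nth)
  then have "eventually (\<lambda>n. \<forall>i\<in>{..<k}. (ss ! i) n = (ts ! i) n) U"
    by (intro eventually_ball_finite) auto
  then show ?thesis by eventually_elim (auto intro!: nth_equalityI simp: len)
qed

text \<open>The form of saturation used throughout: tuples chosen independently at each index are
  the coordinates of a single tuple of \<open>G\<close>.\<close>

lemma tuple_choice:
  assumes "\<And>n. t n \<in> cart_pow (Gs n) k"
  obtains xs ss where "xs \<in> cart_pow G k" "list_all2 (\<in>) ss xs" "\<And>n. at_idx n ss = t n"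
proof
  let ?ss = "map (\<lambda>i n. t n ! i) [0..<k]"
  have "t n ! i \<in> carrier (Gs n)" if "i < k" for i n
    using assms[of n] that by (auto simp: cart_pow_def)
  then show "map cls ?ss \<in> cart_pow G k" "list_all2 (\<in>) ?ss (map cls ?ss)"
    by (auto simp: cart_pow_def list_all2_conv_all_nth intro!: cls_in cls_self)
  show "at_idx n ?ss = t n" for n
    using assms[of n] by (intro nth_equalityI) (auto simp: cart_pow_def)
qed

text \<open>The theorem of Los for membership: two representing tuples agree almost everywhere, so
  the existential in \<open>internal_set\<close> may be tested on any one of them.\<close>

lemma los_mem:
  assumes "xs \<in> cart_pow G k" "list_all2 (\<in>) ss xs"
  shows "xs \<in> internal_set U Gs k Xs \<longleftrightarrow> eventually (\<lambda>n. at_idx n ss \<in> Xs n) U"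
proof
  assume "xs \<in> internal_set U Gs k Xs"
  then obtain ts where ts: "list_all2 (\<in>) ts xs" "eventually (\<lambda>n. at_idx n ts \<in> Xs n) U"
    by (auto simp: internal_set_def)
  show "eventually (\<lambda>n. at_idx n ss \<in> Xs n) U"
    using ts(2) tuple_rep_eq[OF assms ts(1)] by eventually_elim auto
qed (use assms in \<open>auto simp: internal_set_def\<close>)

lemma internal_set_eqI:
  assumes "X \<subseteq> cart_pow G k"
    and "\<And>xs ss. xs \<in> cart_pow G k \<Longrightarrow> list_all2 (\<in>) ss xs \<Longrightarrow>
      xs \<in> X \<longleftrightarrow> eventually (\<lambda>n. at_idx n ss \<in> Xs n) U"
  shows "X = internal_set U Gs k Xs"
proof (intro Set.set_eqI)
  fix xs
  show "xs \<in> X \<longleftrightarrow> xs \<in> internal_set U Gs k Xs"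
  proof (cases "xs \<in> cart_pow G k")
    case True
    then obtain ss where ss: "list_all2 (\<in>) ss xs" using tuple_rep_ex by blast
    show ?thesis using assms(2)[OF True ss] los_mem[OF True ss] by simp
  qed (use assms(1) in \<open>auto simp: internal_set_def\<close>)
qed

section \<open>Densities at a fixed index and their limits\<close>

definition dens :: "nat \<Rightarrow> nat \<Rightarrow> 'a list set \<Rightarrow> real" where
  "dens n k X = real (card X) / real (order (Gs n)) ^ k"

lemma order_pos: "order (Gs n) > 0"
  using monoid.order_gt_0_iff_finite[OF mon] by simp

lemma finite_cart [simp]: "finite (cart_pow (Gs n) k)"
  by (simp add: cart_pow_def finite_lists_length_eq)

lemma card_cart: "card (cart_pow (Gs n) k) = order (Gs n) ^ k"
  by (simp add: cart_pow_def card_lists_length_eq order_def)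

lemma dens_ge0: "dens n k X \<ge> 0"
  by (simp add: dens_def)

lemma dens_mono: "X \<subseteq> Y \<Longrightarrow> Y \<subseteq> cart_pow (Gs n) k \<Longrightarrow> dens n k X \<le> dens n k Y"
  unfolding dens_def by (intro divide_right_mono of_nat_mono card_mono finite_subset[OF _ finite_cart]) auto

lemma dens_cart: "dens n k (cart_pow (Gs n) k) = 1"
  using order_pos[of n] by (simp add: dens_def card_cart)

lemma dens_le1: "X \<subseteq> cart_pow (Gs n) k \<Longrightarrow> dens n k X \<le> 1"
  using dens_mono[of X "cart_pow (Gs n) k" n k] dens_cart by simp

text \<open>Carries a representing sequence along with the internal set, so that an inequality
  between densities can be proved at each index and passed to the limit by
  \<open>reps_lim\<close>.\<close>

definition reps :: "nat \<Rightarrow> (nat \<Rightarrow> 'a) set list set \<Rightarrow> (nat \<Rightarrow> 'a list set) \<Rightarrow> bool" where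
  "reps k X Xs \<longleftrightarrow> (\<forall>n. Xs n \<subseteq> cart_pow (Gs n) k) \<and> X = internal_set U Gs k Xs"

lemma internal_reps: "internal U Gs k X \<longleftrightarrow> (\<exists>Xs. reps k X Xs)"
  by (auto simp: internal_def reps_def)

lemma repsI:
  assumes "X \<subseteq> cart_pow G k" "\<And>n. Xs n \<subseteq> cart_pow (Gs n) k"
    and "\<And>xs ss. xs \<in> cart_pow G k \<Longrightarrow> list_all2 (\<in>) ss xs \<Longrightarrow>
      xs \<in> X \<longleftrightarrow> eventually (\<lambda>n. at_idx n ss \<in> Xs n) U"
  shows "reps k X Xs"
  using internal_set_eqI[of X k Xs] assms by (auto simp: reps_def)

lemma reps_mem:
  assumes "reps k X Xs" "xs \<in> cart_pow G k" "list_all2 (\<in>) ss xs"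
  shows "xs \<in> X \<longleftrightarrow> eventually (\<lambda>n. at_idx n ss \<in> Xs n) U"
  using assms los_mem by (auto simp: reps_def)

lemma reps_sub: "reps k X Xs \<Longrightarrow> X \<subseteq> cart_pow G k"
  "reps k X Xs \<Longrightarrow> Xs n \<subseteq> cart_pow (Gs n) k"
  by (auto simp: reps_def internal_set_def)

lemma reps_lim: "reps k X Xs \<Longrightarrow> ((\<lambda>n. dens n k (Xs n)) \<longlongrightarrow> \<mu> k X) U"
  unfolding dens_def reps_def using loeb_density_internal_set[OF nsfg] by blast

lemma internal_sub: "internal U Gs k X \<Longrightarrow> X \<subseteq> cart_pow G k"
  using reps_sub(1) unfolding internal_reps by blast

lemma mu_ge0: "internal U Gs k X \<Longrightarrow> \<mu> k X \<ge> 0"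
  unfolding internal_reps
  by (elim exE) (rule tendsto_lowerbound[OF reps_lim always_eventually U_props(1)], auto simp: dens_ge0)

lemma mu_le1: "internal U Gs k X \<Longrightarrow> \<mu> k X \<le> 1"
proof -
  assume "internal U Gs k X"
  then obtain Xs where R: "reps k X Xs" by (auto simp: internal_reps)
  show ?thesis
    using dens_le1[OF reps_sub(2)[OF R]]
    by (intro tendsto_upperbound[OF reps_lim[OF R] _ U_props(1)] always_eventually allI)
qed

lemma reps_cart: "reps k (cart_pow G k) (\<lambda>n. cart_pow (Gs n) k)"
  using tuple_rep_in by (intro repsI) auto

lemma mu_cart: "\<mu> k (cart_pow G k) = 1"
  using reps_lim[OF reps_cart] U_props(1) by (simp add: dens_cart tendsto_const_iff)

lemma mu_empty: "\<mu> n {} = 0"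
proof -
  have "reps n {} (\<lambda>_. {})" using U_props(1) by (intro repsI) auto
  from reps_lim[OF this] show ?thesis using U_props(1) by (simp add: dens_def tendsto_const_iff)
qed

lemma mu_mono:
  assumes X: "internal U Gs k X" and Y: "internal U Gs k Y" and "X \<subseteq> Y"
  shows "\<mu> k X \<le> \<mu> k Y"
proof -
  obtain Xs Ys where XY: "reps k X Xs" "reps k Y Ys" using X Y internal_reps by auto
  have "eventually (\<lambda>n. Xs n \<subseteq> Ys n) U"
    using XY \<open>X \<subseteq> Y\<close> by (intro internal_set_mono_imp[OF grp U_props(2)]) (auto simp: reps_def)
  then have "eventually (\<lambda>n. dens n k (Xs n) \<le> dens n k (Ys n)) U"
    by eventually_elim (rule dens_mono[OF _ reps_sub(2)[OF XY(2)]])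
  then show ?thesis using reps_lim[OF XY(1)] reps_lim[OF XY(2)] U_props(1)
    by (intro tendsto_le[of U]) auto
qed

section \<open>Averaging over fibres\<close>

lemma reps_fibre:
  assumes Z: "reps (k + m) Z Zs" and y: "y \<in> cart_pow G m" "list_all2 (\<in>) ts y"
  shows "reps k (fibre G k Z y) (\<lambda>n. fibre (Gs n) k (Zs n) (at_idx n ts))"
proof (rule repsI)
  fix xs ss assume xs: "xs \<in> cart_pow G k" "list_all2 (\<in>) ss xs"
  then have "xs @ y \<in> cart_pow G (k + m)" "list_all2 (\<in>) (ss @ ts) (xs @ y)"
    using y by (auto simp: cart_pow_def intro: list_all2_appendI)
  from reps_mem[OF Z this] show "xs \<in> fibre G k Z y \<longleftrightarrow>
      eventually (\<lambda>n. at_idx n ss \<in> fibre (Gs n) k (Zs n) (at_idx n ts)) U"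
    using xs tuple_rep_in[OF xs] by (simp add: fibre_def)
qed (auto simp: fibre_def)

lemma sum_fibre:
  assumes "X \<subseteq> cart_pow (Gs n) (k + m)"
  shows "(\<Sum>c\<in>cart_pow (Gs n) m. real (card (fibre (Gs n) k X c))) = real (card X)"
proof -
  have "bij_betw (\<lambda>(c, x). x @ c) (SIGMA c:cart_pow (Gs n) m. fibre (Gs n) k X c) X"
  proof (rule bij_betw_byWitness[where f'="\<lambda>x. (drop k x, take k x)"])
    show "(\<lambda>x. (drop k x, take k x)) ` X \<subseteq> (SIGMA c:cart_pow (Gs n) m. fibre (Gs n) k X c)"
      using assms by (auto simp: fibre_def cart_pow_def dest: in_set_takeD in_set_dropD)
  qed (auto simp: fibre_def cart_pow_def)
  then have "card X = card (SIGMA c:cart_pow (Gs n) m. fibre (Gs n) k X c)"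
    by (simp add: bij_betw_same_card)
  also have "\<dots> = (\<Sum>c\<in>cart_pow (Gs n) m. card (fibre (Gs n) k X c))"
    by (rule card_SigmaI) (auto simp: fibre_def)
  finally show ?thesis by simp
qed

lemma avg_fibre:
  assumes "X \<subseteq> cart_pow (Gs n) (k + m)"
  shows "(\<Sum>c\<in>cart_pow (Gs n) m. dens n k (fibre (Gs n) k X c)) =
    dens n (k + m) X * real (order (Gs n)) ^ m"
  using sum_fibre[OF assms] order_pos[of n]
  by (simp add: dens_def sum_divide_distrib[symmetric] power_add)

lemma fibre_sub: "fibre H k X c \<subseteq> cart_pow H k"
  by (auto simp: fibre_def)

lemma cart_ne: "cart_pow (Gs n) m \<noteq> {}"
  using card_cart[of n m] order_pos[of n] by (metis card.empty less_irrefl zero_less_power)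

lemma avg_ex:
  fixes f :: "'c \<Rightarrow> real"
  assumes "finite C" "C \<noteq> {}"
  shows "\<exists>c\<in>C. sum f C \<le> real (card C) * f c"
proof (rule ccontr)
  assume "\<not> ?thesis"
  then have "\<And>c. c \<in> C \<Longrightarrow> f c < sum f C / real (card C)"
    using assms by (simp add: not_le field_simps card_gt_0_iff)
  then have "sum f C < (\<Sum>c\<in>C. sum f C / real (card C))"
    by (intro sum_strict_mono assms)
  then show False using assms by simp
qed

text \<open>Fixes coordinates in a positive and in a null set at once. The bounds are exact although
  averaging at one index leaves an error: the error tends to 0 along \<open>U\<close>, and the
  choices made at the single indices form one tuple.\<close>

lemma fubini_positivity:
  assumes X: "internal U Gs (k + m) X" and Y: "internal U Gs (l + m) Y" and Y0: "\<mu> (l + m) Y = 0"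
  obtains c where "c \<in> cart_pow G m" "\<mu> k (fibre G k X c) \<ge> \<mu> (k + m) X"
    "\<mu> l (fibre G l Y c) = 0"
proof -
  obtain Xs Ys where XY: "reps (k + m) X Xs" "reps (l + m) Y Ys" using X Y internal_reps by auto
  let ?x = "\<lambda>n. dens n (k + m) (Xs n)" and ?y = "\<lambda>n. dens n (l + m) (Ys n)"
  let ?X = "\<lambda>n c. dens n k (fibre (Gs n) k (Xs n) c)"
  let ?Y = "\<lambda>n c. dens n l (fibre (Gs n) l (Ys n) c)"
  \<comment> \<open>Weighting \<open>Y\<close> by \<open>1 / sqrt (\<mu> Y)\<close> makes a single averaging step control both fibres.\<close>
  have "\<exists>c\<in>cart_pow (Gs n) m. ?X n c \<ge> ?x n - sqrt (?y n) \<and> ?Y n c \<le> sqrt (?y n) + ?y n" for n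
  proof -
    have y0: "?y n \<ge> 0" by (rule dens_ge0)
    let ?N = "real (order (Gs n)) ^ m"
    have N: "?N > 0" using order_pos by simp
    obtain c where c: "c \<in> cart_pow (Gs n) m"
      "(\<Sum>c\<in>cart_pow (Gs n) m. ?X n c - ?Y n c / sqrt (?y n)) \<le> ?N * (?X n c - ?Y n c / sqrt (?y n))"
      using avg_ex[OF finite_cart cart_ne, of n m "\<lambda>c. ?X n c - ?Y n c / sqrt (?y n)"]
      by (auto simp: card_cart)
    have "(\<Sum>c\<in>cart_pow (Gs n) m. ?X n c - ?Y n c / sqrt (?y n)) = ?N * (?x n - ?y n / sqrt (?y n))"
      using avg_fibre[OF reps_sub(2)[OF XY(1)], of n] avg_fibre[OF reps_sub(2)[OF XY(2)], of n]
      by (simp add: sum_subtractf sum_divide_distrib[symmetric] algebra_simps)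
    also have "?y n / sqrt (?y n) = sqrt (?y n)" using y0 by (simp add: real_div_sqrt)
    finally have *: "?x n - sqrt (?y n) \<le> ?X n c - ?Y n c / sqrt (?y n)"
      using c(2) N by simp
    have "?Y n c / sqrt (?y n) \<ge> 0" using y0 dens_ge0 by simp
    with * have 1: "?X n c \<ge> ?x n - sqrt (?y n)" by linarith
    have "?Y n c \<le> sqrt (?y n) + ?y n"
    \<comment> \<open>If the density of Y at n is 0, the weight is a division by zero, which equals
      0, and the average carries no information about Y. In that case, however, all fibres of Y have
      density 0.\<close>
    proof (cases "?y n = 0")
      case True
      then have "(\<Sum>c\<in>cart_pow (Gs n) m. ?Y n c) = 0"
        using avg_fibre[OF reps_sub(2)[OF XY(2)], of n] by simp
      then have "?Y n c = 0" using c(1) by (subst (asm) sum_nonneg_eq_0_iff) (auto simp: dens_ge0)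
      then show ?thesis using True by simp
    next
      case False
      have "?X n c \<le> 1" by (rule dens_le1[OF fibre_sub])
      moreover have "?x n \<ge> 0" by (rule dens_ge0)
      ultimately have "?Y n c / sqrt (?y n) \<le> 1 + sqrt (?y n)" using * by linarith
      then have "?Y n c \<le> (1 + sqrt (?y n)) * sqrt (?y n)"
        using False y0 by (subst (asm) pos_divide_le_eq) auto
      then show ?thesis using y0 by (simp add: algebra_simps)
    qed
    with 1 c(1) show ?thesis by blast
  qed
  then obtain c where c: "\<And>n. c n \<in> cart_pow (Gs n) m" "\<And>n. ?X n (c n) \<ge> ?x n - sqrt (?y n)"
    "\<And>n. ?Y n (c n) \<le> sqrt (?y n) + ?y n" by metis
  obtain xs ss where xs: "xs \<in> cart_pow G m" "list_all2 (\<in>) ss xs" "\<And>n. at_idx n ss = c n"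
    using tuple_choice[OF c(1)] by metis
  have limX: "((\<lambda>n. ?X n (c n)) \<longlongrightarrow> \<mu> k (fibre G k X xs)) U"
    using reps_lim[OF reps_fibre[OF XY(1) xs(1,2)]] by (simp only: xs(3))
  have limY: "((\<lambda>n. ?Y n (c n)) \<longlongrightarrow> \<mu> l (fibre G l Y xs)) U"
    using reps_lim[OF reps_fibre[OF XY(2) xs(1,2)]] by (simp only: xs(3))
  have y: "(?y \<longlongrightarrow> 0) U" using reps_lim[OF XY(2)] Y0 by simp
  have sy: "((\<lambda>n. sqrt (?y n)) \<longlongrightarrow> 0) U" using tendsto_real_sqrt[OF y] by simp
  have "\<mu> k (fibre G k X xs) \<ge> \<mu> (k + m) X - 0"
    by (rule tendsto_le[OF U_props(1) limX tendsto_diff[OF reps_lim[OF XY(1)] sy]]) (simp add: c)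
  moreover have "\<mu> l (fibre G l Y xs) \<le> 0 + 0"
    by (rule tendsto_le[OF U_props(1) tendsto_add[OF sy y] limY]) (simp add: c)
  moreover have "\<mu> l (fibre G l Y xs) \<ge> 0"
    using reps_fibre[OF XY(2) xs(1,2)] by (intro mu_ge0) (auto simp: internal_reps)
  ultimately show thesis using that[of xs] xs(1) by simp
qed

text \<open>The bound \<open>q\<close> is known for elements of \<open>C\<close> in the
  ultraproduct, not at the indices. Choosing at each index a point of \<open>Cs n\<close> whose
  fibre is at least average yields an element of \<open>C\<close>, and \<open>q\<close> applies to
  it.\<close>

lemma fubini_bound:
  assumes Z: "internal U Gs (k + m) Z" and C: "internal U Gs m C"
    and ZC: "\<And>x y. x @ y \<in> Z \<Longrightarrow> y \<in> cart_pow G m \<Longrightarrow> y \<in> C"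
    and bd: "\<And>y. y \<in> C \<Longrightarrow> \<mu> k (fibre G k Z y) \<le> q"
  shows "\<mu> (k + m) Z \<le> q * \<mu> m C"
proof -
  obtain Ys Cs where YC: "reps (k + m) Z Ys" "reps m C Cs" using Z C internal_reps by auto
  \<comment> \<open>That Z lives over \<open>C\<close> holds only in the ultraproduct. Trimming the
    representing sequence makes it true at every index, so that the sum over all fibres reduces to a
    sum over \<open>Cs n\<close>.\<close>
  define Zs where "Zs n = {xs \<in> Ys n. drop k xs \<in> Cs n}" for n
  have drop_C: "drop k xs \<in> C" if "xs \<in> Z" for xs
  proof -
    have "xs \<in> cart_pow G (k + m)" using reps_sub(1)[OF YC(1)] that by (rule subsetD)
    then have "drop k xs \<in> cart_pow G m" by (auto simp: cart_pow_def dest: in_set_dropD)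
    then show ?thesis using ZC[of "take k xs" "drop k xs"] that by simp
  qed
  have "reps (k + m) Z Zs"
  proof (rule repsI)
    show "Zs n \<subseteq> cart_pow (Gs n) (k + m)" for n using reps_sub(2)[OF YC(1), of n] by (auto simp: Zs_def)
    fix xs ss assume xs: "xs \<in> cart_pow G (k + m)" "list_all2 (\<in>) ss xs"
    then have "drop k xs \<in> cart_pow G m" "list_all2 (\<in>) (drop k ss) (drop k xs)"
      by (auto simp: cart_pow_def dest: in_set_dropD intro: list_all2_dropI)
    from reps_mem[OF YC(2) this] reps_mem[OF YC(1) xs] drop_C[of xs]
    show "xs \<in> Z \<longleftrightarrow> eventually (\<lambda>n. at_idx n ss \<in> Zs n) U"
      by (simp add: Zs_def eventually_conj_iff drop_map) blast
  qed (rule reps_sub(1)[OF YC(1)])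
  note R = this YC(2)
  let ?Z = "\<lambda>n c. dens n k (fibre (Gs n) k (Zs n) c)"
  show ?thesis
  proof (cases "C = {}")
    case True
    then have "Z = {}" using drop_C by blast
    then show ?thesis using True mu_empty by simp
  next
    case False
    \<comment> \<open>At the indices where \<open>Cs n\<close> is empty any tuple serves as default;
      these are negligible because \<open>C\<close> is non-empty.\<close>
    have "\<exists>c\<in>cart_pow (Gs n) m. (Cs n \<noteq> {} \<longrightarrow> c \<in> Cs n \<and>
        (\<Sum>c\<in>Cs n. ?Z n c) \<le> real (card (Cs n)) * ?Z n c)" for n
    proof (cases "Cs n = {}")
      case False
      have "finite (Cs n)" using reps_sub(2)[OF R(2), of n] finite_cart by (rule finite_subset)
      from avg_ex[OF this False, of "?Z n"] show ?thesis using reps_sub(2)[OF R(2), of n] by blast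
    qed (use cart_ne[of n m] in auto)
    then obtain c where c: "\<And>n. c n \<in> cart_pow (Gs n) m" "\<And>n. Cs n \<noteq> {} \<Longrightarrow> c n \<in> Cs n"
      "\<And>n. Cs n \<noteq> {} \<Longrightarrow> (\<Sum>c\<in>Cs n. ?Z n c) \<le> real (card (Cs n)) * ?Z n (c n)" by metis
    obtain y ss where y: "y \<in> cart_pow G m" "list_all2 (\<in>) ss y" "\<And>n. at_idx n ss = c n"
      using tuple_choice[OF c(1)] by metis
    obtain y' where y': "y' \<in> C" using False by auto
    then have y'c: "y' \<in> cart_pow G m" using reps_sub(1)[OF R(2)] by blast
    then obtain ss' where ss': "list_all2 (\<in>) ss' y'" using tuple_rep_ex by blast
    have "eventually (\<lambda>n. at_idx n ss' \<in> Cs n) U"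
      using reps_mem[OF R(2) y'c ss'] y' by simp
    then have ne: "eventually (\<lambda>n. Cs n \<noteq> {}) U" by (rule eventually_mono) auto
    have "eventually (\<lambda>n. at_idx n ss \<in> Cs n) U"
      unfolding y(3) using ne by (rule eventually_mono) (rule c(2))
    then have "y \<in> C" using reps_mem[OF R(2) y(1,2)] by simp
    have lim: "((\<lambda>n. ?Z n (c n)) \<longlongrightarrow> \<mu> k (fibre G k Z y)) U"
      using reps_lim[OF reps_fibre[OF R(1) y(1,2)]] by (simp only: y(3))
    have "eventually (\<lambda>n. dens n (k + m) (Zs n) \<le> ?Z n (c n) * dens n m (Cs n)) U"
      using ne
    proof eventually_elim
      case (elim n)
      let ?N = "real (order (Gs n)) ^ m"
      have "dens n (k + m) (Zs n) * ?N = (\<Sum>c\<in>cart_pow (Gs n) m. ?Z n c)"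
        using avg_fibre[OF reps_sub(2)[OF R(1)], of n] by simp
      also have "\<dots> = (\<Sum>c\<in>Cs n. ?Z n c)"
      proof (rule sum.mono_neutral_right)
        show "\<forall>i\<in>cart_pow (Gs n) m - Cs n. ?Z n i = 0"
        proof
          fix i assume i: "i \<in> cart_pow (Gs n) m - Cs n"
          then have "fibre (Gs n) k (Zs n) i = {}" by (auto simp: fibre_def cart_pow_def Zs_def)
          then show "?Z n i = 0" by (simp add: dens_def)
        qed
      qed (use reps_sub(2)[OF R(2), of n] in auto)
      also have "\<dots> \<le> real (card (Cs n)) * ?Z n (c n)" using c(3) elim by simp
      finally show ?case using order_pos[of n] by (simp add: dens_def[of n m] field_simps)
    qed
    then have "\<mu> (k + m) Z \<le> \<mu> k (fibre G k Z y) * \<mu> m C"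
      by (intro tendsto_le[OF U_props(1) tendsto_mult[OF lim reps_lim[OF R(2)]] reps_lim[OF R(1)]])
    also have "\<dots> \<le> q * \<mu> m C" using bd[OF \<open>y \<in> C\<close>] mu_ge0[OF C] by (intro mult_right_mono)
    finally show ?thesis .
  qed
qed

end

section \<open>Definable sets\<close>

lemma word_val_append_word:
  assumes "group H" "\<And>i e. (i, e) \<in> set w \<union> set v \<Longrightarrow> xs ! i \<in> carrier H"
  shows "word_val H w xs \<in> carrier H" "word_val H (w @ v) xs = word_val H w xs \<otimes>\<^bsub>H\<^esub> word_val H v xs"
proof -
  interpret group H by fact
  have cl: "word_val H u xs \<in> carrier H" if "\<And>i e. (i, e) \<in> set u \<Longrightarrow> xs ! i \<in> carrier H" for u
    using that by (induction u) (auto simp: word_val_def)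
  from cl[of w] assms(2) show "word_val H w xs \<in> carrier H" by blast
  from assms(2) show "word_val H (w @ v) xs = word_val H w xs \<otimes>\<^bsub>H\<^esub> word_val H v xs"
  proof (induction w)
    case Nil
    then show ?case using cl[of v] by (auto simp: word_val_def)
  next
    case (Cons p w)
    obtain i e where p: "p = (i, e)" by (cases p)
    have "word_val H (w @ v) xs = word_val H w xs \<otimes>\<^bsub>H\<^esub> word_val H v xs"
      using Cons.prems by (intro Cons.IH) auto
    moreover have "xs ! i \<in> carrier H" "word_val H w xs \<in> carrier H" "word_val H v xs \<in> carrier H"
      using cl[of w] cl[of v] Cons.prems p by auto
    ultimately show ?case by (simp add: word_val_def p m_assoc)
  qed
qed

lemma word_val_cong:
  assumes "\<And>i e. (i, e) \<in> set w \<Longrightarrow> xs ! i = ys ! i"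
  shows "word_val H w xs = word_val H w ys"
  using assms unfolding word_val_def by (intro foldr_cong) auto

lemma cart_nth: "xs \<in> cart_pow H n \<Longrightarrow> i < n \<Longrightarrow> xs ! i \<in> carrier H"
  by (auto simp: cart_pow_def)

lemma cart_append: "xs \<in> cart_pow H n \<Longrightarrow> ys \<in> cart_pow H m \<Longrightarrow> xs @ ys \<in> cart_pow H (n + m)"
  by (auto simp: cart_pow_def)

lemma cart_take_drop:
  assumes "xs \<in> cart_pow H (n + m)"
  shows "take n xs \<in> cart_pow H n" "drop n xs \<in> cart_pow H m"
  using assms by (auto simp: cart_pow_def dest: in_set_takeD in_set_dropD)

lemma fibre_fibre:
  assumes "a \<in> cart_pow H l" "y \<in> cart_pow H m"
  shows "fibre H k (fibre H (k + m) Z a) y = fibre H k Z (y @ a)"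
  using assms by (auto simp: fibre_def cart_append)

lemma defined_over_countable:
  assumes "countable (\<Union>n. F n)" "countable A"
  shows "countable (defined_over G F A n)"
proof (rule countable_subset)
  show "defined_over G F A n \<subseteq> (\<lambda>(Y, a). fibre G n Y a) ` ((\<Union>n. F n) \<times> lists A)"
    by (force simp: defined_over_def lists_eq_set)
  show "countable ((\<lambda>(Y, a). fibre G n Y a) ` ((\<Union>n. F n) \<times> lists A))"
    using assms by (intro countable_image countable_SIGMA countable_lists) auto
qed

lemma defined_over_mono: "A \<subseteq> B \<Longrightarrow> defined_over G F A n \<subseteq> defined_over G F B n"
  by (fastforce simp: defined_over_def)

locale tame = ultra U Gs for U :: "nat filter" and Gs :: "nat \<Rightarrow> ('a, 'b) monoid_scheme" +
  fixes F :: "nat \<Rightarrow> (nat \<Rightarrow> 'a) set list set set"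
  assumes tame: "tame_family U Gs F"
begin

abbreviation "D \<equiv> defined_over G F"

section \<open>Closure of the tame family under substitution of words\<close>

lemma F_internal: "X \<in> F n \<Longrightarrow> internal U Gs n X"
  and F_word: "(\<And>i e. (i, e) \<in> set w \<Longrightarrow> i < n) \<Longrightarrow> {xs \<in> cart_pow G n. word_val G w xs = \<one>\<^bsub>G\<^esub>} \<in> F n"
  and F_prod: "X \<in> F n \<Longrightarrow> Y \<in> F m \<Longrightarrow> {x @ y | x y. x \<in> X \<and> y \<in> Y} \<in> F (n + m)"
  and F_compl: "X \<in> F n \<Longrightarrow> cart_pow G n - X \<in> F n"
  and F_Int: "X \<in> F n \<Longrightarrow> Y \<in> F n \<Longrightarrow> X \<inter> Y \<in> F n"
  and F_proj: "Z \<in> F (n + m) \<Longrightarrow> take n ` Z \<in> F n"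
  and F_threshold: "Z \<in> F (k + m) \<Longrightarrow> q \<in> \<rat> \<inter> {0..1} \<Longrightarrow> \<exists>Y \<in> F m.
        {y \<in> cart_pow G m. \<mu> k (fibre G k Z y) > q} \<subseteq> Y \<and>
        Y \<subseteq> {y \<in> cart_pow G m. \<mu> k (fibre G k Z y) \<ge> q}"
proof -
  note t = tame[unfolded tame_family_def Let_def]
  note t2 = conjunct2[OF t] note t3 = conjunct2[OF t2] note t4 = conjunct2[OF t3]
  note t5 = conjunct2[OF t4] note t6 = conjunct2[OF t5] note t9 = conjunct2[OF conjunct2[OF conjunct2[OF t6]]]
  show "internal U Gs n X" if "X \<in> F n" using that by (rule conjunct1[OF t, rule_format])
  show "{xs \<in> cart_pow G n. word_val G w xs = \<one>\<^bsub>G\<^esub>} \<in> F n" if "\<And>i e. (i, e) \<in> set w \<Longrightarrow> i < n"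
    using that by (intro conjunct1[OF t2, rule_format]) auto
  show "{x @ y | x y. x \<in> X \<and> y \<in> Y} \<in> F (n + m)" if "X \<in> F n" "Y \<in> F m"
    using that by (rule conjunct1[OF t3, rule_format])
  show "cart_pow G n - X \<in> F n" if "X \<in> F n" using that by (rule conjunct1[OF t4, rule_format])
  show "X \<inter> Y \<in> F n" if "X \<in> F n" "Y \<in> F n"
    using conjunct1[OF t5, rule_format, of X n Y] that by simp
  show "take n ` Z \<in> F n" if "Z \<in> F (n + m)" using that by (rule conjunct1[OF t6, rule_format])
  show "\<exists>Y \<in> F m. {y \<in> cart_pow G m. \<mu> k (fibre G k Z y) > q} \<subseteq> Y \<and>
      Y \<subseteq> {y \<in> cart_pow G m. \<mu> k (fibre G k Z y) \<ge> q}" if "Z \<in> F (k + m)" "q \<in> \<rat> \<inter> {0..1}"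
    using that by (rule t9[rule_format])
qed

lemma F_cart: "cart_pow G n \<in> F n"
  using F_word[of "[]" n] by (simp add: word_val_def)

lemma F_Ball: "finite I \<Longrightarrow> (\<And>i. i \<in> I \<Longrightarrow> X i \<in> F n) \<Longrightarrow> {xs \<in> cart_pow G n. \<forall>i\<in>I. xs \<in> X i} \<in> F n"
proof (induction I rule: finite_induct)
  case (insert i I)
  have "{xs \<in> cart_pow G n. \<forall>i\<in>insert i I. xs \<in> X i} = X i \<inter> {xs \<in> cart_pow G n. \<forall>i\<in>I. xs \<in> X i}"
    by auto
  then show ?case using insert F_Int by simp
qed (simp add: F_cart)

text \<open>The axioms provide solution sets of single equations. The equations
  \<open>w\<^sub>j(x) y\<^sub>j\<^sup>-\<^sup>1 = 1\<close> cut out the graph of the word map, with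
  y in the coordinates from n on; the preimage of \<open>X\<close> is the projection of the part of
  the graph with y in \<open>X\<close>.\<close>

lemma F_subst:
  assumes X: "X \<in> F (length ws)" and w: "\<And>w i e. w \<in> set ws \<Longrightarrow> (i, e) \<in> set w \<Longrightarrow> i < n"
  shows "{xs \<in> cart_pow G n. map (\<lambda>w. word_val G w xs) ws \<in> X} \<in> F n"
proof -
  define m where "m = length ws"
  have X_sub: "X \<subseteq> cart_pow G m" using F_internal[OF X] internal_sub m_def by blast
  let ?w = "\<lambda>j. ws ! j @ [(n + j, -1)]"
  let ?E = "\<lambda>j. {zs \<in> cart_pow G (n + m). word_val G (?w j) zs = \<one>\<^bsub>G\<^esub>}"
  let ?Y = "{x @ y | x y. x \<in> cart_pow G n \<and> y \<in> X}"
  let ?Z = "?Y \<inter> {zs \<in> cart_pow G (n + m). \<forall>j\<in>{..<m}. zs \<in> ?E j}"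
  have wj: "(i, e) \<in> set (ws ! j) \<Longrightarrow> i < n" if "j < m" for i e j
    using w[of "ws ! j" i e] that by (simp add: m_def)
  have "?E j \<in> F (n + m)" if "j < m" for j
    using wj[OF that] that by (intro F_word) (auto intro: trans_less_add1)
  then have "?Z \<in> F (n + m)"
    using X by (intro F_Int F_prod F_cart F_Ball) (auto simp: m_def)
  then have "take n ` ?Z \<in> F n" by (rule F_proj)
  also have "take n ` ?Z = {xs \<in> cart_pow G n. map (\<lambda>w. word_val G w xs) ws \<in> X}"
  proof -
    have key: "word_val G (?w j) (x @ y) = \<one>\<^bsub>G\<^esub> \<longleftrightarrow> word_val G (ws ! j) x = y ! j"
      if x: "x \<in> cart_pow G n" and y: "y \<in> cart_pow G m" and j: "j < m" for x y j
    proof -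
      have nth: "(x @ y) ! i = (if i < n then x ! i else y ! (i - n))" for i
        using x by (auto simp: nth_append cart_pow_def)
      have c: "\<And>i e. (i, e) \<in> set (ws ! j) \<union> set [(n + j, -1::int)] \<Longrightarrow> (x @ y) ! i \<in> carrier G"
        using wj[OF j] j by (auto simp: nth intro: cart_nth[OF x] cart_nth[OF y])
      have e: "word_val G (ws ! j) (x @ y) = word_val G (ws ! j) x"
        using wj[OF j] by (intro word_val_cong) (auto simp: nth)
      have cx: "word_val G (ws ! j) x \<in> carrier G"
        using wj[OF j] by (intro word_val_append_word(1)[OF is_group, of _ "[]"]) (auto intro: cart_nth[OF x])
      have yj: "y ! j \<in> carrier G" using cart_nth[OF y j] .
      have "word_val G [(n + j, -1)] (x @ y) = inv\<^bsub>G\<^esub> (y ! j)"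
        using yj by (simp add: word_val_def nth int_pow_neg)
      then have "word_val G (?w j) (x @ y) = word_val G (ws ! j) x \<cdot> inv\<^bsub>G\<^esub> (y ! j)"
        using word_val_append_word(2)[OF is_group, of "ws ! j" "[(n + j, -1)]" "x @ y"] c
        by (simp only: e)
      then show ?thesis using cx yj
        by (metis inv_closed inv_equality inv_inv r_inv)
    qed
    show ?thesis
    proof (intro Set.equalityI subsetI)
      fix z assume "z \<in> take n ` ?Z"
      then obtain x y where xy: "z = take n (x @ y)" "x \<in> cart_pow G n" "y \<in> X"
        "\<And>j. j < m \<Longrightarrow> word_val G (?w j) (x @ y) = \<one>\<^bsub>G\<^esub>" by blast
      have y: "y \<in> cart_pow G m" using xy X_sub by auto
      have "map (\<lambda>w. word_val G w x) ws = y"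
        using xy(4) key[OF xy(2) y] y by (intro nth_equalityI) (auto simp: m_def cart_pow_def)
      then show "z \<in> {xs \<in> cart_pow G n. map (\<lambda>w. word_val G w xs) ws \<in> X}"
        using xy by (simp add: cart_pow_def)
    next
      fix x assume x: "x \<in> {xs \<in> cart_pow G n. map (\<lambda>w. word_val G w xs) ws \<in> X}"
      let ?y = "map (\<lambda>w. word_val G w x) ws"
      have y: "?y \<in> cart_pow G m" using x X_sub by auto
      have in_Z: "x @ ?y \<in> ?Z"
        using x y key[of x ?y] by (auto simp: cart_append m_def)
      have "x = take n (x @ ?y)" using x by (simp add: cart_pow_def)
      then show "x \<in> take n ` ?Z" using in_Z by (rule image_eqI)
    qed
  qed
  finally show ?thesis .
qed

lemma word_val_var: "i < length xs \<Longrightarrow> xs \<in> cart_pow G n \<Longrightarrow> word_val G [(i, 1)] xs = xs ! i"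
  using cart_nth[of xs G n i] by (simp add: word_val_def cart_pow_def)

text \<open>Words consisting of one variable turn substitution into permuting, repeating or dropping
  coordinates.\<close>

lemma index_words:
  assumes "\<And>i. i \<in> set is \<Longrightarrow> i < n"
  shows "{xs \<in> cart_pow G n. map (\<lambda>w. word_val G w xs) (map (\<lambda>i. [(i, 1)]) is) \<in> X} =
    {xs \<in> cart_pow G n. map ((!) xs) is \<in> X}"
proof (rule Collect_cong, rule conj_cong[OF refl])
  fix xs assume xs: "xs \<in> cart_pow G n"
  have "map (\<lambda>w. word_val G w xs) (map (\<lambda>i. [(i, 1)]) is) = map ((!) xs) is"
    using assms xs by (auto simp: word_val_var cart_pow_def)
  then show "map (\<lambda>w. word_val G w xs) (map (\<lambda>i. [(i, 1)]) is) \<in> X \<longleftrightarrow> map ((!) xs) is \<in> X" by (simp only:)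
qed

lemma F_index:
  assumes "X \<in> F (length is)" "\<And>i. i \<in> set is \<Longrightarrow> i < n"
  shows "{xs \<in> cart_pow G n. map ((!) xs) is \<in> X} \<in> F n"
proof -
  have "{xs \<in> cart_pow G n. map (\<lambda>w. word_val G w xs) (map (\<lambda>i. [(i, 1)]) is) \<in> X} \<in> F n"
    using assms by (intro F_subst) auto
  then show ?thesis using index_words[of "is" n X] assms(2) by simp
qed

section \<open>Sets defined over a set of parameters\<close>

lemma F_D: "X \<in> F n \<Longrightarrow> X \<in> D A n"
proof -
  assume X: "X \<in> F n"
  have "X = fibre G n X []" using internal_sub[OF F_internal[OF X]] by (auto simp: fibre_def)
  moreover have "X \<in> F (n + length ([] :: (nat \<Rightarrow> 'a) set list))" using X by simp
  ultimately show ?thesis unfolding defined_over_def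
    by (metis (mono_tags, lifting) empty_set empty_subsetI mem_Collect_eq)
qed

lemma D_cart: "cart_pow G n \<in> D A n"
  by (rule F_D[OF F_cart])

lemma D_E:
  assumes "X \<in> D A n" "A \<subseteq> carrier G"
  obtains Y a where "X = fibre G n Y a" "a \<in> cart_pow G (length a)" "Y \<in> F (n + length a)" "set a \<subseteq> A"
  using assms by (auto simp: defined_over_def cart_pow_def)

lemma D_I: "set a \<subseteq> A \<Longrightarrow> Y \<in> F (n + length a) \<Longrightarrow> fibre G n Y a \<in> D A n"
  by (auto simp: defined_over_def)

lemma D_internal:
  assumes "A \<subseteq> carrier G" "X \<in> D A n"
  shows "internal U Gs n X"
proof -
  obtain Y a where Y: "X = fibre G n Y a" "a \<in> cart_pow G (length a)" "Y \<in> F (n + length a)"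
    using D_E assms by metis
  obtain ss where "list_all2 (\<in>) ss a" using tuple_rep_ex[OF Y(2)] by blast
  moreover obtain Ys where "reps (n + length a) Y Ys" using F_internal[OF Y(3)] internal_reps by blast
  ultimately show ?thesis using reps_fibre Y(1,2) internal_reps by blast
qed

text \<open>The parameters occupy the coordinates after the first n, and each is substituted by its
  own variable, so that \<open>F_subst\<close> applies before the fibre is taken.\<close>

lemma D_subst:
  assumes A: "A \<subseteq> carrier G" and X: "X \<in> D A (length ws)"
    and w: "\<And>w i e. w \<in> set ws \<Longrightarrow> (i, e) \<in> set w \<Longrightarrow> i < n"
  shows "{xs \<in> cart_pow G n. map (\<lambda>w. word_val G w xs) ws \<in> X} \<in> D A n"
proof -
  obtain Y a where Y: "X = fibre G (length ws) Y a" "a \<in> cart_pow G (length a)"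
    "Y \<in> F (length ws + length a)" "set a \<subseteq> A"
    using D_E[OF X A] by metis
  let ?ws = "ws @ map (\<lambda>i. [(n + i, 1)]) [0..<length a]"
  have "{xs \<in> cart_pow G (n + length a). map (\<lambda>w. word_val G w xs) ?ws \<in> Y} \<in> F (n + length a)"
    using Y w by (intro F_subst) (auto intro: trans_less_add1)
  from D_I[OF Y(4) this]
  have "fibre G n {xs \<in> cart_pow G (n + length a). map (\<lambda>w. word_val G w xs) ?ws \<in> Y} a \<in> D A n" .
  also have "fibre G n {xs \<in> cart_pow G (n + length a). map (\<lambda>w. word_val G w xs) ?ws \<in> Y} a =
      {xs \<in> cart_pow G n. map (\<lambda>w. word_val G w xs) ws \<in> X}"
  proof -
    have "map (\<lambda>w. word_val G w (xs @ a)) ?ws = map (\<lambda>w. word_val G w xs) ws @ a"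
      "map (\<lambda>w. word_val G w xs) ws \<in> cart_pow G (length ws)" if xs: "xs \<in> cart_pow G n" for xs
    proof -
      have nth: "(xs @ a) ! i = (if i < n then xs ! i else a ! (i - n))" for i
        using xs by (auto simp: nth_append cart_pow_def)
      have "word_val G w (xs @ a) = word_val G w xs" if "w \<in> set ws" for w
        using w[OF that] by (intro word_val_cong) (auto simp: nth)
      moreover have "map (\<lambda>i. word_val G [(n + i, 1)] (xs @ a)) [0..<length a] = a"
      proof (rule nth_equalityI)
        fix i assume "i < length (map (\<lambda>i. word_val G [(n + i, 1)] (xs @ a)) [0..<length a])"
        then have i: "i < length a" by simp
        have "word_val G [(n + i, 1)] (xs @ a) = (xs @ a) ! (n + i)"
          using i xs by (intro word_val_var[OF _ cart_append[OF xs Y(2)]]) (simp add: cart_pow_def)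
        then show "map (\<lambda>i. word_val G [(n + i, 1)] (xs @ a)) [0..<length a] ! i = a ! i"
          using i by (simp add: nth)
      qed simp
      ultimately show "map (\<lambda>w. word_val G w (xs @ a)) ?ws = map (\<lambda>w. word_val G w xs) ws @ a"
        by (simp add: comp_def)
      have "word_val G w xs \<in> carrier G" if "w \<in> set ws" for w
        using w[OF that] by (intro word_val_append_word(1)[OF is_group, of w "[]"]) (auto intro: cart_nth[OF xs])
      then show "map (\<lambda>w. word_val G w xs) ws \<in> cart_pow G (length ws)" by (auto simp: cart_pow_def)
    qed
    then show ?thesis using cart_append[OF _ Y(2)] by (auto simp: fibre_def Y(1) simp del: map_append map_map map_eq_conv)
  qed
  finally show ?thesis .
qed

lemma D_index:
  assumes A: "A \<subseteq> carrier G" and X: "X \<in> D A (length is)" "\<And>i. i \<in> set is \<Longrightarrow> i < n"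
  shows "{xs \<in> cart_pow G n. map ((!) xs) is \<in> X} \<in> D A n"
proof -
  have "{xs \<in> cart_pow G n. map (\<lambda>w. word_val G w xs) (map (\<lambda>i. [(i, 1)]) is) \<in> X} \<in> D A n"
    using assms by (intro D_subst) auto
  then show ?thesis using index_words[of "is" n X] X(2) by simp
qed

lemma D_compl:
  assumes "A \<subseteq> carrier G" "X \<in> D A n"
  shows "cart_pow G n - X \<in> D A n"
proof -
  obtain Y a where Y: "X = fibre G n Y a" "a \<in> cart_pow G (length a)" "Y \<in> F (n + length a)" "set a \<subseteq> A"
    using D_E assms by metis
  have "cart_pow G n - X = fibre G n (cart_pow G (n + length a) - Y) a"
    using Y(2) by (auto simp: Y(1) fibre_def cart_append)
  then show ?thesis using D_I[OF Y(4) F_compl[OF Y(3)]] by simp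
qed

text \<open>The two sets may come with different parameter tuples \<open>a\<close> and
  \<open>b\<close>. Both are first pulled back to the coordinates (x, a, b).\<close>

lemma D_Int:
  assumes A: "A \<subseteq> carrier G" and X: "X \<in> D A n" and X': "X' \<in> D A n"
  shows "X \<inter> X' \<in> D A n"
proof -
  obtain Y a where Y: "X = fibre G n Y a" "a \<in> cart_pow G (length a)" "Y \<in> F (n + length a)" "set a \<subseteq> A"
    using D_E[OF X A] by metis
  obtain Y' b where Y': "X' = fibre G n Y' b" "b \<in> cart_pow G (length b)" "Y' \<in> F (n + length b)" "set b \<subseteq> A"
    using D_E[OF X' A] by metis
  let ?n = "n + length (a @ b)"
  let ?V = "{zs \<in> cart_pow G ?n. map ((!) zs) [0..<n + length a] \<in> Y}"
  let ?V' = "{zs \<in> cart_pow G ?n. map ((!) zs) ([0..<n] @ [n + length a..<?n]) \<in> Y'}"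
  have "?V \<inter> ?V' \<in> F ?n"
    using Y Y' by (intro F_Int F_index) auto
  from D_I[OF _ this, of A] have "fibre G n (?V \<inter> ?V') (a @ b) \<in> D A n" using Y Y' by simp
  also have "fibre G n (?V \<inter> ?V') (a @ b) = X \<inter> X'"
  proof -
    have "map ((!) (x @ a @ b)) [0..<n + length a] = x @ a"
      "map ((!) (x @ a @ b)) ([0..<n] @ [n + length a..<?n]) = x @ b" if "length x = n" for x
      using that by (intro nth_equalityI; auto simp add: nth_append less_diff_conv2 add.commute)+
    moreover have "length x = n" if "x \<in> cart_pow G n" for x using that by (simp add: cart_pow_def)
    moreover have "x @ a @ b \<in> cart_pow G ?n" if "x \<in> cart_pow G n" for x
      using that Y(2) Y'(2) by (auto simp: cart_pow_def)
    ultimately show ?thesis by (auto simp: fibre_def Y(1) Y'(1) simp del: map_append)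
  qed
  finally show ?thesis .
qed

lemma D_conj:
  assumes "A \<subseteq> carrier G" "{xs \<in> cart_pow G n. Q xs} \<in> D A n" "{xs \<in> cart_pow G n. R xs} \<in> D A n"
  shows "{xs \<in> cart_pow G n. Q xs \<and> R xs} \<in> D A n"
proof -
  have "{xs \<in> cart_pow G n. Q xs \<and> R xs} = {xs \<in> cart_pow G n. Q xs} \<inter> {xs \<in> cart_pow G n. R xs}" by auto
  then show ?thesis using D_Int[OF assms] by simp
qed

lemma D_neg:
  assumes "A \<subseteq> carrier G" "{xs \<in> cart_pow G n. Q xs} \<in> D A n"
  shows "{xs \<in> cart_pow G n. \<not> Q xs} \<in> D A n"
proof -
  have "{xs \<in> cart_pow G n. \<not> Q xs} = cart_pow G n - {xs \<in> cart_pow G n. Q xs}" by auto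
  then show ?thesis using D_compl[OF assms] by simp
qed

lemma D_fibre:
  assumes A: "A \<subseteq> carrier G" and Z: "Z \<in> D A (k + m)" and b: "b \<in> cart_pow G m" "set b \<subseteq> A"
  shows "fibre G k Z b \<in> D A k"
proof -
  obtain Y a where Y: "Z = fibre G (k + m) Y a" "a \<in> cart_pow G (length a)" "Y \<in> F (k + m + length a)" "set a \<subseteq> A"
    using D_E[OF Z A] by metis
  have "Y \<in> F (k + length (b @ a))" using Y(3) b by (simp add: cart_pow_def add.assoc)
  then have "fibre G k Y (b @ a) \<in> D A k" using b Y by (intro D_I) auto
  then show ?thesis using fibre_fibre[OF Y(2) b(1), of k Y] Y(1) by simp
qed

text \<open>Condition (IV) gives a sandwich at one rational level in [0,1]. A gap
  \<open>r < s\<close> leaves room for such a level q with \<open>r < q < s\<close>, and levels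
  outside the unit interval are trivial because densities lie in it. Parameters are appended to
  y.\<close>

lemma D_threshold:
  assumes A: "A \<subseteq> carrier G" and Z: "Z \<in> D A (k + m)" and "r < s"
  obtains Y where "Y \<in> D A m" "\<And>y. y \<in> cart_pow G m \<Longrightarrow> \<mu> k (fibre G k Z y) \<ge> s \<Longrightarrow> y \<in> Y"
    "\<And>y. y \<in> Y \<Longrightarrow> y \<in> cart_pow G m \<and> \<mu> k (fibre G k Z y) \<ge> r"
proof -
  obtain V a where V: "Z = fibre G (k + m) V a" "a \<in> cart_pow G (length a)" "V \<in> F (k + m + length a)" "set a \<subseteq> A"
    using D_E[OF Z A] by metis
  have int: "internal U Gs k (fibre G k Z y)" if y: "y \<in> cart_pow G m" for y
    using D_internal[of "carrier G", OF _ D_fibre[of "carrier G" Z k m y]] defined_over_mono[OF A, of G F "k + m"] Z y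
    by (auto simp: cart_pow_def)
  consider "r < 0" | "r \<ge> 0" "r < 1" | "r \<ge> 1" by linarith
  then show thesis
  proof cases
    case 1
    have "\<mu> k (fibre G k Z y) \<ge> r" if "y \<in> cart_pow G m" for y using mu_ge0[OF int[OF that]] 1 by simp
    then show thesis using that[OF D_cart[of m A]] by blast
  next
    case 2
    obtain q where q: "q \<in> \<rat>" "r < q" "q < min s 1" using 2 \<open>r < s\<close> Rats_dense_in_real[of r "min s 1"] by auto
    have "V \<in> F (k + (m + length a))" using V(3) by (simp add: add.assoc)
    from F_threshold[OF this, of q] q 2 obtain Y where Y: "Y \<in> F (m + length a)"
      "{y \<in> cart_pow G (m + length a). \<mu> k (fibre G k V y) > q} \<subseteq> Y"
      "Y \<subseteq> {y \<in> cart_pow G (m + length a). \<mu> k (fibre G k V y) \<ge> q}" by auto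
    show thesis
    proof (rule that[of "fibre G m Y a"])
      show "fibre G m Y a \<in> D A m" using V Y by (intro D_I) auto
    next
      fix y assume y: "y \<in> cart_pow G m" "\<mu> k (fibre G k Z y) \<ge> s"
      then have "y @ a \<in> Y" using Y(2) fibre_fibre[OF V(2) y(1), of k V] V(1,2) q by (auto simp: cart_append)
      then show "y \<in> fibre G m Y a" using y by (simp add: fibre_def)
    next
      fix y assume "y \<in> fibre G m Y a"
      then have y: "y \<in> cart_pow G m" "y @ a \<in> Y" by (auto simp: fibre_def)
      then show "y \<in> cart_pow G m \<and> \<mu> k (fibre G k Z y) \<ge> r"
        using Y(3) fibre_fibre[OF V(2) y(1), of k V] V(1) q by fastforce
    qed
  next
    case 3
    have "\<not> \<mu> k (fibre G k Z y) \<ge> s" if "y \<in> cart_pow G m" for y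
      using mu_le1[OF int[OF that]] 3 \<open>r < s\<close> by simp
    moreover have "{} \<in> D A m" using D_compl[OF A D_cart[of m A]] by simp
    ultimately show thesis using that[of "{}"] by blast
  qed
qed

text \<open>Complement of the previous sandwich between the midpoint of r and s and s: values up to
  r lie strictly below the midpoint and hence are not cut off.\<close>

lemma D_threshold_le:
  assumes A: "A \<subseteq> carrier G" and Z: "Z \<in> D A (k + m)" and "r < s"
  obtains Y where "Y \<in> D A m" "\<And>y. y \<in> cart_pow G m \<Longrightarrow> \<mu> k (fibre G k Z y) \<le> r \<Longrightarrow> y \<in> Y"
    "\<And>y. y \<in> Y \<Longrightarrow> y \<in> cart_pow G m \<and> \<mu> k (fibre G k Z y) \<le> s"
proof -
  have "(r + s) / 2 < s" using \<open>r < s\<close> by simp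
  from D_threshold[OF A Z this] obtain Y where Y: "Y \<in> D A m"
    "\<And>y. y \<in> cart_pow G m \<Longrightarrow> \<mu> k (fibre G k Z y) \<ge> s \<Longrightarrow> y \<in> Y"
    "\<And>y. y \<in> Y \<Longrightarrow> y \<in> cart_pow G m \<and> \<mu> k (fibre G k Z y) \<ge> (r + s) / 2" by metis
  show thesis
  proof (rule that[OF D_compl[OF A Y(1)]])
    fix y assume "y \<in> cart_pow G m" "\<mu> k (fibre G k Z y) \<le> r"
    then show "y \<in> cart_pow G m - Y" using Y(3)[of y] \<open>r < s\<close> by fastforce
  next
    fix y assume "y \<in> cart_pow G m - Y"
    then show "y \<in> cart_pow G m \<and> \<mu> k (fibre G k Z y) \<le> s" using Y(2)[of y] by force
  qed
qed

end

section \<open>Existence of the component\<close>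

definition generic :: "('a, 'b) monoid_scheme \<Rightarrow> 'a set \<Rightarrow> bool" where
  "generic G A \<longleftrightarrow> (\<exists>T. finite T \<and> T \<subseteq> carrier G \<and> carrier G \<subseteq> (\<Union>t\<in>T. t <#\<^bsub>G\<^esub> A))"

lemma generic_mono:
  assumes "generic G A" "A \<subseteq> B"
  shows "generic G B"
proof -
  obtain T where T: "finite T" "T \<subseteq> carrier G" "carrier G \<subseteq> (\<Union>t\<in>T. t <#\<^bsub>G\<^esub> A)"
    using assms(1) unfolding generic_def by (elim exE conjE)
  have "(\<Union>t\<in>T. t <#\<^bsub>G\<^esub> A) \<subseteq> (\<Union>t\<in>T. t <#\<^bsub>G\<^esub> B)" unfolding l_coset_def using assms(2) by blast
  from subset_trans[OF T(3) this] show ?thesis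
    unfolding generic_def by (intro exI[of _ T] conjI T(1,2))
qed

text \<open>Intersections of generic sets can fail to be generic, but their squares behave well.
  Sort the elements by which translate of each \<open>A i\<close> they lie in; if x and r fall in
  the same of the finitely many cells, then \<open>r\<^sup>-\<^sup>1 x\<close> lies in
  \<open>A i\<^sup>-\<^sup>1 A i = A i A i\<close> for every i.\<close>

lemma (in group) generic_Int:
  assumes I: "finite I" and A: "\<And>i. i \<in> I \<Longrightarrow> A i \<subseteq> carrier G" "\<And>i. i \<in> I \<Longrightarrow> set_inv (A i) = A i"
    and gen: "\<And>i. i \<in> I \<Longrightarrow> generic G (A i)"
  shows "generic G {x \<in> carrier G. \<forall>i\<in>I. x \<in> A i <#> A i}"
proof -
  obtain T where T: "\<And>i. i \<in> I \<Longrightarrow> finite (T i) \<and> T i \<subseteq> carrier G \<and> carrier G \<subseteq> (\<Union>t\<in>T i. t <# A i)"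
  proof -
    have "\<forall>i\<in>I. \<exists>T. finite T \<and> T \<subseteq> carrier G \<and> carrier G \<subseteq> (\<Union>t\<in>T. t <# A i)"
      using gen unfolding generic_def by (rule ballI)
    from bchoice[OF this] show thesis by (elim exE) (rule that, erule bspec)
  qed
  have "\<forall>i\<in>I. \<forall>x\<in>carrier G. \<exists>t\<in>T i. x \<in> t <# A i" using T by fast
  then obtain \<tau> where \<tau>: "\<And>i x. i \<in> I \<Longrightarrow> x \<in> carrier G \<Longrightarrow> \<tau> i x \<in> T i \<and> x \<in> \<tau> i x <# A i" by metis
  \<comment> \<open>The cell of x records the chosen translate for every i. Restricting the function
    to \<open>I\<close> leaves finitely many cells, and one representative per cell gives the
    translating set.\<close>
  let ?cell = "\<lambda>x. restrict (\<lambda>i. \<tau> i x) I"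
  let ?rep = "\<lambda>p. SOME x. x \<in> carrier G \<and> ?cell x = p"
  let ?R = "?rep ` ?cell ` carrier G"
  have rep: "?rep (?cell x) \<in> carrier G \<and> ?cell (?rep (?cell x)) = ?cell x" if "x \<in> carrier G" for x
    using that by (intro someI[of "\<lambda>y. y \<in> carrier G \<and> ?cell y = ?cell x"]) simp
  have "?cell ` carrier G \<subseteq> (\<Pi>\<^sub>E i\<in>I. T i)" using \<tau> by auto
  moreover have "finite (\<Pi>\<^sub>E i\<in>I. T i)" using I T by (intro finite_PiE) auto
  ultimately have "finite (?cell ` carrier G)" by (rule finite_subset)
  then have finR: "finite ?R" by (rule finite_imageI)
  have subR: "?R \<subseteq> carrier G" using rep by auto
  have cover: "x \<in> (\<Union>r\<in>?R. r <# {x \<in> carrier G. \<forall>i\<in>I. x \<in> A i <#> A i})" if x: "x \<in> carrier G" for x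
  proof -
    define r where "r = ?rep (?cell x)"
    have r: "r \<in> carrier G" "?cell r = ?cell x" using rep[OF x] by (simp_all add: r_def)
    have "inv r \<otimes> x \<in> A i <#> A i" if i: "i \<in> I" for i
    proof -
      have "\<tau> i r = \<tau> i x" using fun_cong[OF r(2), of i] i by simp
      then obtain a b where ab: "a \<in> A i" "b \<in> A i" "r = \<tau> i x \<otimes> a" "x = \<tau> i x \<otimes> b"
        using \<tau>[OF i x] \<tau>[OF i r(1)] by (auto simp: l_coset_def)
      have c: "\<tau> i x \<in> carrier G" "a \<in> carrier G" "b \<in> carrier G" using \<tau>[OF i x] T[OF i] A[OF i] ab by auto
      have "inv a \<otimes> b = inv (\<tau> i x \<otimes> a) \<otimes> (\<tau> i x \<otimes> b)"
      proof -
        have "inv (\<tau> i x \<otimes> a) \<otimes> (\<tau> i x \<otimes> b) = inv a \<otimes> (inv (\<tau> i x) \<otimes> (\<tau> i x \<otimes> b))"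
          using c by (simp add: inv_mult_group m_assoc)
        also have "inv (\<tau> i x) \<otimes> (\<tau> i x \<otimes> b) = b" using c by (simp add: m_assoc[symmetric])
        finally show ?thesis ..
      qed
      then have "inv r \<otimes> x = inv a \<otimes> b" using ab(3,4) by simp
      moreover have "inv a \<in> A i" using A(2)[OF i] ab(1) by (auto simp: SET_INV_def)
      ultimately show ?thesis using ab(2) by (auto simp: set_mult_def)
    qed
    then have y: "inv r \<otimes> x \<in> {x \<in> carrier G. \<forall>i\<in>I. x \<in> A i <#> A i}" using r(1) x by simp
    have "x = r \<otimes> (inv r \<otimes> x)" using r(1) x by (simp add: m_assoc[symmetric])
    then have "x \<in> r <# {x \<in> carrier G. \<forall>i\<in>I. x \<in> A i <#> A i}" using y unfolding l_coset_def by blast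
    moreover have "r \<in> ?R" using x by (simp add: r_def)
    ultimately show ?thesis by blast
  qed
  show ?thesis unfolding generic_def
    by (intro exI[of _ ?R] conjI finR subR) (rule subsetI, rule cover)
qed

context tame
begin

text \<open>The sequences whose intersections are the candidates. Working with sequences instead of
  subgroups allows shifting them and merging several into one.\<close>

definition chain_over :: "(nat \<Rightarrow> 'a) set set \<Rightarrow> (nat \<Rightarrow> (nat \<Rightarrow> 'a) set set) \<Rightarrow> bool" where
  "chain_over M Z \<longleftrightarrow> (\<forall>n. (\<lambda>z. [z]) ` Z n \<in> D M 1 \<and>
             \<one>\<^bsub>G\<^esub> \<in> Z n \<and> set_inv\<^bsub>G\<^esub> (Z n) = Z n \<and> generic G (Z n) \<and>
             Z (Suc n) <#>\<^bsub>G\<^esub> Z (Suc n) \<subseteq> Z n)"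

lemma component_candidate_iff:
  "component_candidate G F M H \<longleftrightarrow> subgroup H G \<and> (\<exists>Z. H = (\<Inter>n. Z n) \<and> chain_over M Z)"
  unfolding component_candidate_def chain_over_def generic_def ..

lemma chain_carrier:
  assumes "M \<subseteq> carrier G" "chain_over M Z"
  shows "Z n \<subseteq> carrier G"
proof -
  have "(\<lambda>z. [z]) ` Z n \<subseteq> cart_pow G 1"
    using assms by (intro internal_sub D_internal) (auto simp: chain_over_def)
  then show ?thesis by (auto simp: cart_pow_def)
qed

lemma chain_decseq:
  assumes "M \<subseteq> carrier G" "chain_over M Z" "m \<le> n"
  shows "Z n \<subseteq> Z m"
proof (rule lift_Suc_antimono_le[of Z, OF _ \<open>m \<le> n\<close>])
  fix n
  show "Z (Suc n) \<subseteq> Z n"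
  proof
    fix z assume z: "z \<in> Z (Suc n)"
    then have "z \<cdot> \<one>\<^bsub>G\<^esub> \<in> Z (Suc n) <#>\<^bsub>G\<^esub> Z (Suc n)"
      using assms(2) unfolding set_mult_def chain_over_def by blast
    moreover have "z \<cdot> \<one>\<^bsub>G\<^esub> = z" using z chain_carrier[OF assms(1,2)] by (intro r_one) blast
    ultimately show "z \<in> Z n" using assms(2) unfolding chain_over_def by auto
  qed
qed

lemma chain_subgroup:
  assumes M: "M \<subseteq> carrier G" and Z: "chain_over M Z"
  shows "subgroup (\<Inter>n. Z n) G"
proof
  show "(\<Inter>n. Z n) \<subseteq> carrier G" using chain_carrier[OF M Z] by blast
  show "\<one>\<^bsub>G\<^esub> \<in> (\<Inter>n. Z n)" using Z by (simp add: chain_over_def)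
next
  fix x y assume "x \<in> (\<Inter>n. Z n)" "y \<in> (\<Inter>n. Z n)"
  then have "x \<cdot> y \<in> Z (Suc n) <#>\<^bsub>G\<^esub> Z (Suc n)" for n unfolding set_mult_def by blast
  then show "x \<cdot> y \<in> (\<Inter>n. Z n)" using Z unfolding chain_over_def by blast
next
  fix x assume "x \<in> (\<Inter>n. Z n)"
  then have "inv\<^bsub>G\<^esub> x \<in> set_inv\<^bsub>G\<^esub> (Z n)" for n by (auto simp: SET_INV_def)
  then show "inv\<^bsub>G\<^esub> x \<in> (\<Inter>n. Z n)" using Z unfolding chain_over_def by blast
qed

lemma chain_shift: "chain_over M Z \<Longrightarrow> chain_over M (\<lambda>n. Z (n + m))"
  by (simp add: chain_over_def)

lemma chain_carrier_const: "chain_over M (\<lambda>_. carrier G)"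
proof -
  have "(\<lambda>z. [z]) ` carrier G = cart_pow G 1"
    by (auto simp: cart_pow_def length_Suc_conv)
  then have "(\<lambda>z. [z]) ` carrier G \<in> D M 1" using D_cart[of 1 M] by simp
  moreover have "set_inv\<^bsub>G\<^esub> (carrier G) = carrier G"
  proof
    show "carrier G \<subseteq> set_inv\<^bsub>G\<^esub> (carrier G)"
      unfolding SET_INV_def using inv_inv inv_closed by (metis (no_types, lifting) UN_iff singletonI subsetI)
  qed (auto simp: SET_INV_def)
  moreover have "carrier G \<subseteq> \<one>\<^bsub>G\<^esub> <#\<^bsub>G\<^esub> carrier G"
    unfolding l_coset_def using l_one by (metis (no_types, lifting) UN_iff singletonI subsetI)
  then have "generic G (carrier G)"
    unfolding generic_def by (intro exI[of _ "{\<one>\<^bsub>G\<^esub>}"]) auto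
  moreover have "carrier G <#>\<^bsub>G\<^esub> carrier G \<subseteq> carrier G" by (auto simp: set_mult_def)
  ultimately show ?thesis unfolding chain_over_def by blast
qed

text \<open>There are only countably many heads of chains, so all chains can be merged into a single one
  and the least candidate exists.\<close>

lemma component_is_least:
  assumes M: "M \<subseteq> carrier G" "countable M" and F: "countable (\<Union>n. F n)"
  shows "component_candidate G F M (component_over G F M)"
    and "component_candidate G F M H \<Longrightarrow> component_over G F M \<subseteq> H"
proof -
  let ?heads = "{X. \<exists>Z. chain_over M Z \<and> Z 0 = X}"
  have "(\<lambda>X. (\<lambda>z. [z]) ` X) ` ?heads \<subseteq> D M 1" by (auto simp: chain_over_def)
  then have "countable ((\<lambda>X. (\<lambda>z. [z]) ` X) ` ?heads)"
    by (rule countable_subset[OF _ defined_over_countable[OF F M(2)]])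
  moreover have "inj_on (\<lambda>X. (\<lambda>z. [z]) ` X) ?heads" by (auto simp: inj_on_def)
  ultimately have cnt: "countable ?heads" by (rule countable_image_inj_on)
  have ne: "?heads \<noteq> {}" using chain_carrier_const by blast
  define X where "X = from_nat_into ?heads"
  have X: "range X = ?heads" unfolding X_def using range_from_nat_into[OF ne cnt] .
  then have "\<forall>i. \<exists>Z. chain_over M Z \<and> Z 0 = X i" by blast
  then obtain c where c: "\<And>i. chain_over M (c i)" "\<And>i. c i 0 = X i" by metis
  \<comment> \<open>A diagonal merge: only finitely many chains enter at each stage, so
    \<open>V n\<close> stays definable and generic, while chain i takes part from stage i
    on.\<close>
  define V where "V n = (\<Inter>i\<in>{..n}. c i n)" for n
  have V_chain: "chain_over M V" unfolding chain_over_def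
  proof (intro allI conjI)
    fix n
    have "(\<lambda>z. [z]) ` (\<Inter>i\<in>{..k}. c i n) \<in> D M 1" for k
    proof (induction k)
      case 0
      then show ?case using c(1)[of 0] by (simp add: chain_over_def)
    next
      case (Suc k)
      have "(\<lambda>z. [z]) ` (\<Inter>i\<in>{..Suc k}. c i n) =
          (\<lambda>z. [z]) ` (\<Inter>i\<in>{..k}. c i n) \<inter> (\<lambda>z. [z]) ` c (Suc k) n"
        by (auto simp: atMost_Suc)
      then show ?case using D_Int[OF M(1) Suc, of "(\<lambda>z. [z]) ` c (Suc k) n"] c(1)[of "Suc k"]
        by (simp add: chain_over_def)
    qed
    then show "(\<lambda>z. [z]) ` V n \<in> D M 1" by (simp add: V_def)
    show "\<one>\<^bsub>G\<^esub> \<in> V n" using c(1) by (simp add: V_def chain_over_def)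
    have inv_c: "inv\<^bsub>G\<^esub> x \<in> c i n" if "x \<in> c i n" for x i
      using c(1)[of i] that unfolding chain_over_def SET_INV_def by blast
    have Vc: "V n \<subseteq> carrier G" using chain_carrier[OF M(1) c(1)[of 0], of n] by (auto simp: V_def)
    have "inv\<^bsub>G\<^esub> x \<in> V n" if "x \<in> V n" for x using that inv_c by (auto simp: V_def)
    then show "set_inv\<^bsub>G\<^esub> (V n) = V n"
    proof (intro Set.equalityI subsetI)
      fix x assume x: "x \<in> V n" and i: "\<And>x. x \<in> V n \<Longrightarrow> inv\<^bsub>G\<^esub> x \<in> V n"
      have "x = inv\<^bsub>G\<^esub> (inv\<^bsub>G\<^esub> x)" using x Vc by (intro inv_inv[symmetric]) blast
      then show "x \<in> set_inv\<^bsub>G\<^esub> (V n)" unfolding SET_INV_def using i[OF x] by blast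
    qed (auto simp: SET_INV_def)
    have sq: "c i (Suc n) <#>\<^bsub>G\<^esub> c i (Suc n) \<subseteq> c i n" for i
      using c(1)[of i] by (simp add: chain_over_def)
    have sym: "set_inv\<^bsub>G\<^esub> (c i (Suc n)) = c i (Suc n)" and gen: "generic G (c i (Suc n))" for i
      using c(1)[of i] by (simp_all add: chain_over_def)
    \<comment> \<open>One step down every chain pays for genericity of the intersection: the squares
      of the sets at stage n + 1 are still inside those at stage n.\<close>
    have "generic G {x \<in> carrier G. \<forall>i\<in>{..n}. x \<in> c i (Suc n) <#>\<^bsub>G\<^esub> c i (Suc n)}"
      by (rule generic_Int[OF finite_atMost chain_carrier[OF M(1) c(1)] sym gen])
    moreover have "{x \<in> carrier G. \<forall>i\<in>{..n}. x \<in> c i (Suc n) <#>\<^bsub>G\<^esub> c i (Suc n)} \<subseteq> V n"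
      unfolding V_def using sq by blast
    ultimately show "generic G (V n)" by (rule generic_mono)
    show "V (Suc n) <#>\<^bsub>G\<^esub> V (Suc n) \<subseteq> V n"
    proof
      fix z assume "z \<in> V (Suc n) <#>\<^bsub>G\<^esub> V (Suc n)"
      then have "z \<in> c i (Suc n) <#>\<^bsub>G\<^esub> c i (Suc n)" if "i \<le> n" for i
        using that unfolding set_mult_def V_def by fastforce
      then show "z \<in> V n" using sq unfolding V_def by blast
    qed
  qed
  let ?H = "\<Inter>n. V n"
  have cand: "component_candidate G F M ?H"
    using chain_subgroup[OF M(1) V_chain] V_chain by (auto simp: component_candidate_iff)
  have least: "?H \<subseteq> H" if "component_candidate G F M H" for H
  proof -
    obtain Z where Z: "H = (\<Inter>n. Z n)" "chain_over M Z" using \<open>component_candidate G F M H\<close> by (auto simp: component_candidate_iff)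
    have "?H \<subseteq> Z n" for n
    proof -
      \<comment> \<open>Every member of a chain is the head of a shifted chain. Listing the heads
        therefore lists all members.\<close>
      have "Z n \<in> ?heads" using chain_shift[OF Z(2), of n] by (intro CollectI exI[of _ "\<lambda>k. Z (k + n)"]) simp
      then have "Z n \<in> range X" by (simp only: X)
      then obtain i where "Z n = X i" by blast
      then have "c i i \<subseteq> Z n" using chain_decseq[OF M(1) c(1), of 0 i i] c(2) by simp
      moreover have "V i \<subseteq> c i i" by (auto simp: V_def)
      ultimately show ?thesis by blast
    qed
    then show ?thesis by (auto simp: Z(1))
  qed
  have "component_over G F M = ?H" unfolding component_over_def
    by (rule Least_equality[where P="component_candidate G F M", OF cand]) (rule least)
  then show "component_candidate G F M (component_over G F M)"
    and "component_candidate G F M H \<Longrightarrow> component_over G F M \<subseteq> H"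
    using cand least by simp_all
qed

end

text \<open>The variance of a sum of m independent centred samples from \<open>W\<close>, multiplied
  by the number of samples. The offset s makes the induction go through, since the first sample is
  absorbed into it. For m = 0 the truncated exponent is harmless because of the factor m.\<close>

lemma second_moment:
  fixes \<phi> :: "'c \<Rightarrow> real"
  assumes W: "finite W" and sum0: "sum \<phi> W = 0"
  shows "(\<Sum>us\<in>{us. set us \<subseteq> W \<and> length us = m}. (sum_list (map \<phi> us) + s)\<^sup>2) =
    real (card W) ^ m * s\<^sup>2 + real m * real (card W) ^ (m - 1) * (\<Sum>u\<in>W. (\<phi> u)\<^sup>2)"
proof (induction m arbitrary: s)
  case 0
  have "{us. set us \<subseteq> W \<and> length us = 0} = {[]}" by auto
  then show ?case by simp
next
  case (Suc m)
  let ?L = "\<lambda>m. {us. set us \<subseteq> W \<and> length us = m}"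
  have L: "?L (Suc m) = (\<lambda>(u, us). u # us) ` (W \<times> ?L m)"
    by (auto simp: length_Suc_conv image_iff)
  have "(\<Sum>us\<in>?L (Suc m). (sum_list (map \<phi> us) + s)\<^sup>2) =
      (\<Sum>(u, us)\<in>W \<times> ?L m. (\<phi> u + sum_list (map \<phi> us) + s)\<^sup>2)"
    unfolding L by (subst sum.reindex) (auto simp: inj_on_def case_prod_beta)
  also have "\<dots> = (\<Sum>u\<in>W. \<Sum>us\<in>?L m. (sum_list (map \<phi> us) + (\<phi> u + s))\<^sup>2)"
    by (subst sum.cartesian_product[symmetric]) (simp add: ac_simps)
  also have "\<dots> = (\<Sum>u\<in>W. real (card W) ^ m * (\<phi> u + s)\<^sup>2 + real m * real (card W) ^ (m - 1) * (\<Sum>u\<in>W. (\<phi> u)\<^sup>2))"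
    by (simp only: Suc)
  also have "\<dots> = real (card W) ^ m * (\<Sum>u\<in>W. (\<phi> u + s)\<^sup>2) +
      real m * (real (card W) * real (card W) ^ (m - 1)) * (\<Sum>u\<in>W. (\<phi> u)\<^sup>2)"
    by (simp add: sum.distrib sum_distrib_left algebra_simps)
  also have "real m * (real (card W) * real (card W) ^ (m - 1)) = real m * real (card W) ^ m"
    by (cases m) auto
  also have "(\<Sum>u\<in>W. (\<phi> u + s)\<^sup>2) = (\<Sum>u\<in>W. (\<phi> u)\<^sup>2) + real (card W) * s\<^sup>2"
    using sum0 by (simp add: power2_sum sum.distrib sum_distrib_left[symmetric] sum_distrib_right[symmetric])
  finally show ?case by (simp add: algebra_simps)
qed

text \<open>Almost periodicity of convolutions, by sampling the average over \<open>W\<close> with \<open>m\<close> random elements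
  (Croot and Sisask).\<close>

lemma (in group) almost_periodicity:
  fixes f :: "'a \<Rightarrow> real" and t :: "nat \<Rightarrow> 'a"
  assumes fin: "finite (carrier G)" and f: "\<And>x. x \<in> carrier G \<Longrightarrow> 0 \<le> f x \<and> f x \<le> 1"
    and W: "W \<subseteq> carrier G" "W \<noteq> {}" and m: "m > 0"
    and t: "\<And>i. i < K \<Longrightarrow> t i \<in> carrier G"
    and K: "2 * order G ^ m < K * card W ^ m"
  defines "p \<equiv> \<lambda>x. (\<Sum>u\<in>W. f (x \<otimes> u)) / real (card W)"
  shows "\<exists>i j. i < j \<and> j < K \<and>
    (\<Sum>x\<in>carrier G. (p (x \<otimes> t i) - p (x \<otimes> t j))\<^sup>2) \<le> 8 * real (order G) / real m"
proof -
  have finW: "finite W" using W(1) fin by (rule finite_subset)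
  then have cW: "card W > 0" using W by (simp add: card_gt_0_iff)
  let ?L = "{us. set us \<subseteq> W \<and> length us = m}"
  have finL: "finite ?L" by (rule finite_lists_length_eq[OF finW])
  define S where "S us x = (\<Sum>u\<leftarrow>us. f (x \<otimes> u))" for us x
  define E where "E us = (\<Sum>x\<in>carrier G. (S us x - real m * p x)\<^sup>2)" for us
  let ?N = "real (order G)"
  have N: "?N > 0" using order_gt_0_iff_finite fin by simp
  have "(\<Sum>us\<in>?L. (S us x - real m * p x)\<^sup>2) \<le> real m * real (card W) ^ m" if x: "x \<in> carrier G" for x
  proof -
    let ?\<phi> = "\<lambda>u. f (x \<otimes> u) - p x"
    have f01: "0 \<le> f (x \<otimes> u) \<and> f (x \<otimes> u) \<le> 1" if "u \<in> W" for u using f x W(1) that by blast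
    have p0: "0 \<le> p x" unfolding p_def using f01 by (intro divide_nonneg_nonneg sum_nonneg) auto
    have "(\<Sum>u\<in>W. f (x \<otimes> u)) \<le> real (card W)" using sum_bounded_above[of W "\<lambda>u. f (x \<otimes> u)" 1] f01 by simp
    then have p1: "p x \<le> 1" unfolding p_def using cW by (simp add: divide_le_eq)
    have s0: "sum ?\<phi> W = 0" using cW by (simp add: sum_subtractf p_def)
    have S_eq: "S us x - real m * p x = sum_list (map ?\<phi> us)" if "us \<in> ?L" for us
    proof -
      have "sum_list (map ?\<phi> us) = (\<Sum>u\<leftarrow>us. f (x \<otimes> u)) - real (length us) * p x"
        by (induction us) (simp_all add: algebra_simps)
      then show ?thesis using that by (simp add: S_def)
    qed
    have "(\<Sum>us\<in>?L. (S us x - real m * p x)\<^sup>2) = (\<Sum>us\<in>?L. (sum_list (map ?\<phi> us) + 0)\<^sup>2)"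
      using S_eq by (intro sum.cong) auto
    also have "\<dots> = real m * real (card W) ^ (m - 1) * (\<Sum>u\<in>W. (?\<phi> u)\<^sup>2)"
      by (subst second_moment[OF finW s0]) simp
    also have "(\<Sum>u\<in>W. (?\<phi> u)\<^sup>2) \<le> real (card W)"
    proof -
      have "(?\<phi> u)\<^sup>2 \<le> 1" if "u \<in> W" for u
        using f01[OF that] p0 p1 by (intro abs_square_le_1[THEN iffD2]) auto
      then show ?thesis using sum_bounded_above[of W "\<lambda>u. (?\<phi> u)\<^sup>2" 1] by simp
    qed
    also have "real m * real (card W) ^ (m - 1) * real (card W) = real m * real (card W) ^ m"
      using m by (cases m) auto
    finally show ?thesis by (simp add: mult_left_mono)
  qed
  then have "(\<Sum>x\<in>carrier G. \<Sum>us\<in>?L. (S us x - real m * p x)\<^sup>2) \<le> (\<Sum>x\<in>carrier G. real m * real (card W) ^ m)"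
    by (intro sum_mono)
  then have tot: "(\<Sum>us\<in>?L. E us) \<le> ?N * real m * real (card W) ^ m"
    unfolding E_def by (subst sum.swap) (simp add: order_def)
  \<comment> \<open>The mean of \<open>E\<close> over all samples is at most \<open>?N * m\<close>.
    By Markov's inequality at least half of the samples stay below twice that value.\<close>
  define good where "good = {us \<in> ?L. E us \<le> 2 * ?N * real m}"
  have E0: "E us \<ge> 0" for us unfolding E_def by (intro sum_nonneg) auto
  have "real (card (?L - good)) * (2 * ?N * real m) \<le> (\<Sum>us\<in>?L - good. E us)"
    by (rule sum_bounded_below) (auto simp: good_def)
  also have "\<dots> \<le> (\<Sum>us\<in>?L. E us)" using E0 finL by (intro sum_mono2) auto
  also have "\<dots> \<le> ?N * real m * real (card W) ^ m" by (rule tot)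
  finally have "real (card (?L - good)) * 2 \<le> real (card W) ^ m"
    using N m by (simp add: field_simps)
  moreover have cL: "card ?L = card W ^ m" using card_lists_length_eq[OF finW] by simp
  have sub: "good \<subseteq> ?L" by (auto simp: good_def)
  have "card (?L - good) = card W ^ m - card good"
    using card_Diff_subset[OF finite_subset[OF sub finL] sub] cL by simp
  moreover have "card good \<le> card W ^ m" using card_mono[OF finL sub] cL by simp
  ultimately have "real (card W ^ m - card good) * 2 \<le> real (card W ^ m)" by simp
  then have good: "card W ^ m \<le> 2 * card good"
    using \<open>card good \<le> card W ^ m\<close> by (simp add: of_nat_diff del: of_nat_power)
  define tr where "tr i us = map (\<lambda>u. t i \<otimes> u) us" for i us
  have tr_inj: "inj_on (tr i) good" if "i < K" for i
  proof (rule inj_onI)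
    fix us vs assume uv: "us \<in> good" "vs \<in> good" "tr i us = tr i vs"
    have "set us \<union> set vs \<subseteq> carrier G" using uv(1,2) W(1) by (auto simp: good_def)
    then have "inj_on (\<lambda>u. t i \<otimes> u) (set us \<union> set vs)"
      using t[OF that] by (intro inj_onI) (metis Units_eq Units_l_cancel subsetD)
    then show "us = vs" using uv(3) unfolding tr_def by (metis inj_on_map_eq_map)
  qed
  \<comment> \<open>The K translates of \<open>good\<close> each have at least half of
    \<open>card W ^ m\<close> elements and all lie in the m-tuples of the group, so the assumption
    on K forces two of them to meet.\<close>
  have "\<exists>i j. i < j \<and> j < K \<and> tr i ` good \<inter> tr j ` good \<noteq> {}"
  proof (rule ccontr)
    assume no: "\<not> ?thesis"
    then have disj: "tr i ` good \<inter> tr j ` good = {}" if "i < K" "j < K" "i \<noteq> j" for i j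
      using that by (metis Int_commute nat_neq_iff)
    have fing: "finite good" using sub finL by (rule finite_subset)
    have "K * card good = (\<Sum>i<K. card (tr i ` good))" using tr_inj by (simp add: card_image)
    also have "\<dots> = card (\<Union>i<K. tr i ` good)"
      using disj fing by (intro card_UN_disjoint[symmetric]) auto
    also have "\<dots> \<le> card {us. set us \<subseteq> carrier G \<and> length us = m}"
      using t W(1) by (intro card_mono finite_lists_length_eq fin) (fastforce simp: good_def tr_def)
    also have "\<dots> = order G ^ m" using card_lists_length_eq[OF fin] by (simp add: order_def)
    finally have "2 * (K * card good) \<le> 2 * order G ^ m" by simp
    moreover have "K * card W ^ m \<le> 2 * (K * card good)" using mult_le_mono2[OF good, of K] by (simp add: ac_simps)
    ultimately show False using K by simp
  qed
  then obtain i j where ij: "i < j" "j < K" "tr i ` good \<inter> tr j ` good \<noteq> {}" by blast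
  then obtain us vs where uv: "us \<in> good" "vs \<in> good" "tr i us = tr j vs" by blast
  have ti: "t i \<in> carrier G" and tj: "t j \<in> carrier G" using t ij by auto
  \<comment> \<open>A sample translated by \<open>t i\<close> approximates the translate of p by
    \<open>t i\<close> with the same error. A common point of two translates of \<open>good\<close>
    thus approximates both translates of p.\<close>
  have shift: "(\<Sum>x\<in>carrier G. (S (tr i us) x - real m * p (x \<otimes> t i))\<^sup>2) = E us"
    if "us \<in> good" "t i \<in> carrier G" for us i
  proof -
    have "S (tr i us) x = S us (x \<otimes> t i)" if x: "x \<in> carrier G" for x
    proof -
      have "set us \<subseteq> carrier G" using \<open>us \<in> good\<close> W(1) by (auto simp: good_def)
      then show ?thesis using x \<open>t i \<in> carrier G\<close>
        by (induction us) (auto simp: S_def tr_def m_assoc)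
    qed
    then have "(\<Sum>x\<in>carrier G. (S (tr i us) x - real m * p (x \<otimes> t i))\<^sup>2) =
        (\<Sum>x\<in>carrier G. (S us (x \<otimes> t i) - real m * p (x \<otimes> t i))\<^sup>2)" by simp
    also have "\<dots> = E us" unfolding E_def
      using that(2) by (intro sum.reindex_bij_witness[of _ "\<lambda>x. x \<otimes> inv (t i)" "\<lambda>x. x \<otimes> t i"]) (auto simp: m_assoc)
    finally show ?thesis .
  qed
  have sq: "(real m * p (x \<otimes> t i) - real m * p (x \<otimes> t j))\<^sup>2 \<le>
      2 * (S (tr i us) x - real m * p (x \<otimes> t i))\<^sup>2 + 2 * (S (tr j vs) x - real m * p (x \<otimes> t j))\<^sup>2" for x
  proof -
    have "(b - c)\<^sup>2 \<le> 2 * (a - b)\<^sup>2 + 2 * (a - c)\<^sup>2" for a b c :: real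
      using zero_le_power2[of "2 * a - b - c"] by (simp add: power2_eq_square algebra_simps)
    then show ?thesis using uv(3) by simp
  qed
  have "(\<Sum>x\<in>carrier G. (real m * p (x \<otimes> t i) - real m * p (x \<otimes> t j))\<^sup>2) \<le>
      (\<Sum>x\<in>carrier G. 2 * (S (tr i us) x - real m * p (x \<otimes> t i))\<^sup>2 +
        2 * (S (tr j vs) x - real m * p (x \<otimes> t j))\<^sup>2)"
    by (intro sum_mono sq)
  also have "\<dots> = 2 * E us + 2 * E vs"
    using shift[OF uv(1) ti] shift[OF uv(2) tj] by (simp add: sum.distrib sum_distrib_left[symmetric])
  \<comment> \<open>Each of the two errors is at most \<open>2 * ?N * m\<close> and enters with
    factor 2, which gives the constant 8; division by the square of m follows.\<close>
  also have "\<dots> \<le> 8 * ?N * real m" using uv(1,2) by (auto simp: good_def)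
  finally have "(real m)\<^sup>2 * (\<Sum>x\<in>carrier G. (p (x \<otimes> t i) - p (x \<otimes> t j))\<^sup>2) \<le> 8 * ?N * real m"
    by (simp add: right_diff_distrib[symmetric] power_mult_distrib sum_distrib_left)
  then have "(\<Sum>x\<in>carrier G. (p (x \<otimes> t i) - p (x \<otimes> t j))\<^sup>2) \<le> 8 * ?N / real m"
    using m by (simp add: power2_eq_square field_simps)
  then show ?thesis using ij(1,2) by blast
qed

section \<open>Correlations of convolutions\<close>

abbreviation tuples1 where
  "tuples1 H Q \<equiv> {[x] | x. x \<in> carrier H \<and> Q x}"

abbreviation tuples2 where
  "tuples2 H Q \<equiv> {[x, y] | x y. x \<in> carrier H \<and> y \<in> carrier H \<and> Q x y}"

abbreviation tuples3 where
  "tuples3 H Q \<equiv> {[x, y, z] | x y z. x \<in> carrier H \<and> y \<in> carrier H \<and> z \<in> carrier H \<and> Q x y z}"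

lemma card_singletons: "card {[x] | x. x \<in> C \<and> Q x} = card {x \<in> C. Q x}"
proof -
  have "{[x] | x. x \<in> C \<and> Q x} = (\<lambda>x. [x]) ` {x \<in> C. Q x}" by auto
  then show ?thesis by (simp add: card_image inj_on_def)
qed

lemma card_pairs:
  assumes "finite C"
  shows "real (card {[x, y] | x y. x \<in> C \<and> y \<in> C \<and> Q x y}) = (\<Sum>x\<in>C. \<Sum>y\<in>C. of_bool (Q x y))"
proof -
  have "{[x, y] | x y. x \<in> C \<and> y \<in> C \<and> Q x y} = (\<lambda>(x, y). [x, y]) ` (SIGMA x:C. {y \<in> C. Q x y})" by auto
  then have "card {[x, y] | x y. x \<in> C \<and> y \<in> C \<and> Q x y} = card (SIGMA x:C. {y \<in> C. Q x y})"
    by (simp add: card_image inj_on_def split_beta)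
  also have "\<dots> = (\<Sum>x\<in>C. card {y \<in> C. Q x y})" using assms by (intro card_SigmaI) auto
  finally show ?thesis using assms by (simp add: sum_of_bool_eq Int_def)
qed

lemma card_triples:
  assumes "finite C"
  shows "real (card {[x, y, z] | x y z. x \<in> C \<and> y \<in> C \<and> z \<in> C \<and> Q x y z}) =
    (\<Sum>x\<in>C. \<Sum>y\<in>C. \<Sum>z\<in>C. of_bool (Q x y z))"
proof -
  have "{[x, y, z] | x y z. x \<in> C \<and> y \<in> C \<and> z \<in> C \<and> Q x y z} =
      (\<lambda>(x, us). x # us) ` (SIGMA x:C. {[y, z] | y z. y \<in> C \<and> z \<in> C \<and> Q x y z})" by auto
  then have "card {[x, y, z] | x y z. x \<in> C \<and> y \<in> C \<and> z \<in> C \<and> Q x y z} =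
      card (SIGMA x:C. {[y, z] | y z. y \<in> C \<and> z \<in> C \<and> Q x y z})"
    by (simp add: card_image inj_on_def split_beta)
  also have "\<dots> = (\<Sum>x\<in>C. card {[y, z] | y z. y \<in> C \<and> z \<in> C \<and> Q x y z})"
    using assms by (intro card_SigmaI) (auto intro!: finite_subset[OF _ finite_lists_length_eq[OF assms, of 2]])
  finally show ?thesis using card_pairs[OF assms] by simp
qed

lemma (in group) sum_translate:
  "a \<in> carrier G \<Longrightarrow> (\<Sum>x\<in>carrier G. f (x \<otimes> a)) = (\<Sum>x\<in>carrier G. f x)"
  by (intro sum.reindex_bij_witness[of _ "\<lambda>x. x \<otimes> inv a" "\<lambda>x. x \<otimes> a"]) (auto simp: m_assoc)

lemma sum_square_product:
  fixes f g :: "'c \<Rightarrow> 'c \<Rightarrow> real"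
  shows "(\<Sum>x\<in>C. \<Sum>y\<in>C. \<Sum>z\<in>C. f x y * g x z) / N ^ 3 =
    (\<Sum>x\<in>C. (\<Sum>y\<in>C. f x y) / N * ((\<Sum>z\<in>C. g x z) / N)) / N"
  by (simp add: sum_product sum_divide_distrib power3_eq_cube)

context ultra
begin

section \<open>Internal sets of short tuples described by predicates\<close>

lemma reps1:
  assumes "\<And>x a. x \<in> carrier G \<Longrightarrow> a \<in> x \<Longrightarrow> Q x \<longleftrightarrow> eventually (\<lambda>n. Qn n (a n)) U"
  shows "reps 1 (tuples1 G Q) (\<lambda>n. tuples1 (Gs n) (Qn n))"
proof (rule repsI)
  fix xs ss assume xs: "xs \<in> cart_pow G 1" "list_all2 (\<in>) ss xs"
  then obtain x where x: "xs = [x]" "x \<in> carrier G" by (auto simp: cart_pow_def length_Suc_conv)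
  then obtain a where a: "ss = [a]" "a \<in> x" using xs(2) by (auto simp: list_all2_Cons2)
  show "xs \<in> tuples1 G Q \<longleftrightarrow>
      eventually (\<lambda>n. at_idx n ss \<in> tuples1 (Gs n) (Qn n)) U"
    using assms[OF x(2) a(2)] x(2) rep_in[OF x(2) a(2)] by (simp add: x(1) a(1))
qed (auto simp: cart_pow_def)

lemma reps2:
  assumes "\<And>x y a b. x \<in> carrier G \<Longrightarrow> y \<in> carrier G \<Longrightarrow> a \<in> x \<Longrightarrow> b \<in> y \<Longrightarrow>
    Q x y \<longleftrightarrow> eventually (\<lambda>n. Qn n (a n) (b n)) U"
  shows "reps 2 (tuples2 G Q)
    (\<lambda>n. tuples2 (Gs n) (Qn n))"
proof (rule repsI)
  fix xs ss assume xs: "xs \<in> cart_pow G 2" "list_all2 (\<in>) ss xs"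
  then obtain x y where x: "xs = [x, y]" "x \<in> carrier G" "y \<in> carrier G"
    by (auto simp: cart_pow_def length_Suc_conv numeral_2_eq_2)
  then obtain a b where a: "ss = [a, b]" "a \<in> x" "b \<in> y" using xs(2) by (auto simp: list_all2_Cons2)
  show "xs \<in> tuples2 G Q \<longleftrightarrow>
      eventually (\<lambda>n. at_idx n ss \<in> tuples2 (Gs n) (Qn n)) U"
    using assms[OF x(2,3) a(2,3)] x(2,3) rep_in[OF x(2) a(2)] rep_in[OF x(3) a(3)] by (simp add: x(1) a(1))
qed (auto simp: cart_pow_def)

lemma reps3:
  assumes "\<And>x y z a b c. x \<in> carrier G \<Longrightarrow> y \<in> carrier G \<Longrightarrow> z \<in> carrier G \<Longrightarrow> a \<in> x \<Longrightarrow> b \<in> y \<Longrightarrow> c \<in> z \<Longrightarrow>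
    Q x y z \<longleftrightarrow> eventually (\<lambda>n. Qn n (a n) (b n) (c n)) U"
  shows "reps 3 (tuples3 G Q)
    (\<lambda>n. tuples3 (Gs n) (Qn n))"
proof (rule repsI)
  fix xs ss assume xs: "xs \<in> cart_pow G 3" "list_all2 (\<in>) ss xs"
  then obtain x y z where x: "xs = [x, y, z]" "x \<in> carrier G" "y \<in> carrier G" "z \<in> carrier G"
    by (auto simp: cart_pow_def length_Suc_conv numeral_3_eq_3)
  then obtain a b c where a: "ss = [a, b, c]" "a \<in> x" "b \<in> y" "c \<in> z" using xs(2) by (auto simp: list_all2_Cons2)
  show "xs \<in> tuples3 G Q \<longleftrightarrow>
      eventually (\<lambda>n. at_idx n ss \<in> tuples3 (Gs n) (Qn n)) U"
    using assms[OF x(2-4) a(2-4)] x(2-4) rep_in[OF x(2) a(2)] rep_in[OF x(3) a(3)] rep_in[OF x(4) a(4)]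
    by (simp add: x(1) a(1))
qed (auto simp: cart_pow_def)

lemma reps_mem1: "reps 1 X Xs \<Longrightarrow> x \<in> carrier G \<Longrightarrow> a \<in> x \<Longrightarrow> [x] \<in> X \<longleftrightarrow> eventually (\<lambda>n. [a n] \<in> Xs n) U"
  using reps_mem[of 1 X Xs "[x]" "[a]"] by (simp add: cart_pow_def)

lemma reps_mem2: "reps 2 X Xs \<Longrightarrow> x \<in> carrier G \<Longrightarrow> y \<in> carrier G \<Longrightarrow> a \<in> x \<Longrightarrow> b \<in> y \<Longrightarrow>
    [x, y] \<in> X \<longleftrightarrow> eventually (\<lambda>n. [a n, b n] \<in> Xs n) U"
  using reps_mem[of 2 X Xs "[x, y]" "[a, b]"] by (simp add: cart_pow_def)

text \<open>The density of \<open>corr A W V g\<close> is the inner product of \<open>x \<mapsto> h\<^sub>W (x g)\<close> with \<open>h\<^sub>V\<close>, and that of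
  \<open>test A W g\<close> the inner product of \<open>h\<^sub>W\<close> with the indicator of \<open>A g\<^sup>-\<^sup>1\<close>, where
  \<open>h\<^sub>W x\<close> is the density of \<open>{y \<in> W. x y \<in> A}\<close>.\<close>

definition corr where
  "corr A W V g = tuples3 G (\<lambda>x y z. [y] \<in> W \<and> [z] \<in> V \<and> [x \<cdot> g \<cdot> y] \<in> A \<and> [x \<cdot> z] \<in> A)"

abbreviation gram where
  "gram A W V \<equiv> \<mu> 3 (corr A W V \<one>\<^bsub>G\<^esub>)"

definition test where
  "test A W g = tuples2 G (\<lambda>x y. [y] \<in> W \<and> [x \<cdot> y] \<in> A \<and> [x \<cdot> g] \<in> A)"

section \<open>Averages and convolutions over the finite groups\<close>

definition avg :: "nat \<Rightarrow> ('a \<Rightarrow> real) \<Rightarrow> real" where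
  "avg n f = (\<Sum>x\<in>carrier (Gs n). f x) / real (order (Gs n))"

text \<open>\<open>h\<^sub>W\<close> at the index n: the convolution of the indicator of A with that
  of the inverse of W. It is normalised by the order of the group, not by the size of W, so that its
  moments are densities of internal sets.\<close>

definition conv :: "(nat \<Rightarrow> 'a list set) \<Rightarrow> (nat \<Rightarrow> 'a list set) \<Rightarrow> nat \<Rightarrow> 'a \<Rightarrow> real" where
  "conv As Ws n x = avg n (\<lambda>y. of_bool ([y] \<in> Ws n \<and> [x \<star>\<^sub>n y] \<in> As n))"

lemma avg_mono: "(\<And>x. x \<in> carrier (Gs n) \<Longrightarrow> f x \<le> g x) \<Longrightarrow> avg n f \<le> avg n g"
  unfolding avg_def by (intro divide_right_mono sum_mono) auto

lemma avg_const: "avg n (\<lambda>_. c) = c"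
  using order_pos[of n] by (auto simp: avg_def order_def)

lemma avg_add: "avg n (\<lambda>x. f x + g x) = avg n f + avg n g"
  by (simp add: avg_def sum.distrib add_divide_distrib)

lemma avg_diff: "avg n (\<lambda>x. f x - g x) = avg n f - avg n g"
  by (simp add: avg_def sum_subtractf diff_divide_distrib)

lemma avg_cmult: "avg n (\<lambda>x. c * f x) = c * avg n f"
  by (simp add: avg_def sum_distrib_left)

lemma avg_sum: "avg n (\<lambda>x. \<Sum>i\<in>I. f i x) = (\<Sum>i\<in>I. avg n (f i))"
  unfolding avg_def by (subst sum.swap) (simp add: sum_divide_distrib)

lemma avg_cong: "(\<And>x. x \<in> carrier (Gs n) \<Longrightarrow> f x = g x) \<Longrightarrow> avg n f = avg n g"
  by (simp add: avg_def)

lemma avg_translate: "a \<in> carrier (Gs n) \<Longrightarrow> avg n (\<lambda>x. f (x \<star>\<^sub>n a)) = avg n f"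
  by (simp add: avg_def group.sum_translate)

lemma avg_CS: "(avg n (\<lambda>x. f x * g x))\<^sup>2 \<le> avg n (\<lambda>x. (f x)\<^sup>2) * avg n (\<lambda>x. (g x)\<^sup>2)"
proof -
  let ?C = "carrier (Gs n)"
  have "(\<Sum>x\<in>?C. f x * g x)\<^sup>2 \<le> (\<Sum>x\<in>?C. (f x)\<^sup>2) * (\<Sum>x\<in>?C. (g x)\<^sup>2)"
    by (rule Cauchy_Schwarz_ineq_sum)
  then show ?thesis using order_pos[of n]
    by (simp add: avg_def power_divide divide_right_mono power2_eq_square)
qed

lemma conv_ge0: "conv As Ws n x \<ge> 0"
  unfolding conv_def avg_def by (intro divide_nonneg_nonneg sum_nonneg) auto

lemma dens1: "reps 1 W Ws \<Longrightarrow> dens n 1 (Ws n) = avg n (\<lambda>y. of_bool ([y] \<in> Ws n))"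
proof -
  assume W: "reps 1 W Ws"
  have "Ws n = tuples1 (Gs n) (\<lambda>x. [x] \<in> Ws n)"
    using reps_sub(2)[OF W, of n] by (auto simp: cart_pow_def length_Suc_conv)
  then have "card (Ws n) = card {x \<in> carrier (Gs n). [x] \<in> Ws n}"
    using card_singletons[of "carrier (Gs n)" "\<lambda>x. [x] \<in> Ws n"] by simp
  then show ?thesis by (simp add: dens_def avg_def sum_of_bool_eq Int_def)
qed

lemma conv_le: "reps 1 W Ws \<Longrightarrow> conv As Ws n x \<le> dens n 1 (Ws n)"
  unfolding conv_def by (subst dens1) (auto intro!: avg_mono)

lemma corr_reps:
  assumes A: "reps 1 A As" and W: "reps 1 W Ws" and V: "reps 1 V Vs" and g: "g \<in> carrier G" "s \<in> g"
  shows "reps 3 (corr A W V g) (\<lambda>n. tuples3 (Gs n) (\<lambda>x y z. [y] \<in> Ws n \<and> [z] \<in> Vs n \<and> [x \<star>\<^sub>n s n \<star>\<^sub>n y] \<in> As n \<and> [x \<star>\<^sub>n z] \<in> As n))"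
  unfolding corr_def
proof (rule reps3)
  fix x y z a b c assume c: "x \<in> carrier G" "y \<in> carrier G" "z \<in> carrier G" and r: "a \<in> x" "b \<in> y" "c \<in> z"
  have xg: "(\<lambda>n. a n \<star>\<^sub>n s n) \<in> x \<cdot> g" using c g r by (intro rep_mult)
  show "([y] \<in> W \<and> [z] \<in> V \<and> [x \<cdot> g \<cdot> y] \<in> A \<and> [x \<cdot> z] \<in> A) \<longleftrightarrow>
    eventually (\<lambda>n. [b n] \<in> Ws n \<and> [c n] \<in> Vs n \<and> [a n \<star>\<^sub>n s n \<star>\<^sub>n b n] \<in> As n \<and> [a n \<star>\<^sub>n c n] \<in> As n) U"
    unfolding eventually_conj_iff
    using reps_mem1[OF W c(2) r(2)] reps_mem1[OF V c(3) r(3)]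
      reps_mem1[OF A _ rep_mult[OF _ c(2) xg r(2)]] reps_mem1[OF A _ rep_mult[OF c(1) c(3) r(1) r(3)]] c g
    by simp
qed

lemma corr_lim:
  assumes A: "reps 1 A As" and W: "reps 1 W Ws" and V: "reps 1 V Vs" and g: "g \<in> carrier G" "s \<in> g"
  shows "((\<lambda>n. avg n (\<lambda>x. conv As Ws n (x \<star>\<^sub>n s n) * conv As Vs n x)) \<longlongrightarrow> \<mu> 3 (corr A W V g)) U"
proof -
  have "dens n 3 (tuples3 (Gs n) (\<lambda>x y z. [y] \<in> Ws n \<and> [z] \<in> Vs n \<and> [x \<star>\<^sub>n s n \<star>\<^sub>n y] \<in> As n \<and> [x \<star>\<^sub>n z] \<in> As n)) =
      avg n (\<lambda>x. conv As Ws n (x \<star>\<^sub>n s n) * conv As Vs n x)" for n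
  proof -
    have b: "of_bool ([y] \<in> Ws n \<and> [z] \<in> Vs n \<and> [x \<star>\<^sub>n s n \<star>\<^sub>n y] \<in> As n \<and> [x \<star>\<^sub>n z] \<in> As n) =
      (of_bool ([y] \<in> Ws n \<and> [x \<star>\<^sub>n s n \<star>\<^sub>n y] \<in> As n) * of_bool ([z] \<in> Vs n \<and> [x \<star>\<^sub>n z] \<in> As n) :: real)" for x y z
      by simp
    show ?thesis
      unfolding dens_def card_triples[OF fin] b avg_def conv_def by (rule sum_square_product)
  qed
  then show ?thesis using reps_lim[OF corr_reps[OF assms]] by simp
qed

lemma test_reps:
  assumes A: "reps 1 A As" and W: "reps 1 W Ws" and g: "g \<in> carrier G" "s \<in> g"
  shows "reps 2 (test A W g) (\<lambda>n. tuples2 (Gs n) (\<lambda>x y. [y] \<in> Ws n \<and> [x \<star>\<^sub>n y] \<in> As n \<and> [x \<star>\<^sub>n s n] \<in> As n))"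
  unfolding test_def
proof (rule reps2)
  fix x y a b assume c: "x \<in> carrier G" "y \<in> carrier G" and r: "a \<in> x" "b \<in> y"
  show "([y] \<in> W \<and> [x \<cdot> y] \<in> A \<and> [x \<cdot> g] \<in> A) \<longleftrightarrow>
    eventually (\<lambda>n. [b n] \<in> Ws n \<and> [a n \<star>\<^sub>n b n] \<in> As n \<and> [a n \<star>\<^sub>n s n] \<in> As n) U"
    unfolding eventually_conj_iff
    using reps_mem1[OF W c(2) r(2)] reps_mem1[OF A _ rep_mult[OF c r]]
      reps_mem1[OF A _ rep_mult[OF c(1) g(1) r(1) g(2)]] c g
    by simp
qed

lemma test_lim:
  assumes A: "reps 1 A As" and W: "reps 1 W Ws" and g: "g \<in> carrier G" "s \<in> g"
  shows "((\<lambda>n. avg n (\<lambda>x. conv As Ws n x * of_bool ([x \<star>\<^sub>n s n] \<in> As n))) \<longlongrightarrow> \<mu> 2 (test A W g)) U"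
proof -
  have "dens n 2 (tuples2 (Gs n) (\<lambda>x y. [y] \<in> Ws n \<and> [x \<star>\<^sub>n y] \<in> As n \<and> [x \<star>\<^sub>n s n] \<in> As n)) =
      avg n (\<lambda>x. conv As Ws n x * of_bool ([x \<star>\<^sub>n s n] \<in> As n))" for n
  proof -
    have b: "of_bool ([y] \<in> Ws n \<and> [x \<star>\<^sub>n y] \<in> As n \<and> [x \<star>\<^sub>n s n] \<in> As n) =
      (of_bool ([y] \<in> Ws n \<and> [x \<star>\<^sub>n y] \<in> As n) * of_bool ([x \<star>\<^sub>n s n] \<in> As n) :: real)" for x y
      by simp
    show ?thesis
      unfolding dens_def card_pairs[OF fin] b avg_def conv_def
      by (simp add: sum_distrib_right[symmetric] sum_divide_distrib[symmetric] power2_eq_square)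
  qed
  then show ?thesis using reps_lim[OF test_reps[OF assms]] by simp
qed

lemma avg_conv:
  assumes A: "reps 1 A As" and W: "reps 1 W Ws"
  shows "avg n (conv As Ws n) = dens n 1 (As n) * dens n 1 (Ws n)"
proof -
  have "avg n (conv As Ws n) = avg n (\<lambda>y. avg n (\<lambda>x. of_bool ([y] \<in> Ws n \<and> [x \<star>\<^sub>n y] \<in> As n)))"
    unfolding conv_def avg_def by (subst sum_divide_distrib[symmetric], subst sum.swap) (simp add: sum_divide_distrib)
  also have "\<dots> = avg n (\<lambda>y. dens n 1 (As n) * of_bool ([y] \<in> Ws n))"
  proof (rule avg_cong)
    fix y assume y: "y \<in> carrier (Gs n)"
    have "avg n (\<lambda>x. of_bool ([y] \<in> Ws n \<and> [x \<star>\<^sub>n y] \<in> As n)) =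
        avg n (\<lambda>x. of_bool ([y] \<in> Ws n \<and> [x] \<in> As n))"
      using avg_translate[OF y, of "\<lambda>x. of_bool ([y] \<in> Ws n \<and> [x] \<in> As n)"] by simp
    also have "\<dots> = dens n 1 (As n) * of_bool ([y] \<in> Ws n)"
      by (cases "[y] \<in> Ws n") (simp_all add: dens1[OF A] avg_const del: One_nat_def)
    finally show "avg n (\<lambda>x. of_bool ([y] \<in> Ws n \<and> [x \<star>\<^sub>n y] \<in> As n)) = dens n 1 (As n) * of_bool ([y] \<in> Ws n)" .
  qed
  finally show ?thesis by (simp only: avg_cmult dens1[OF W])
qed

lemma corr_sym:
  assumes "internal U Gs 1 A" "internal U Gs 1 W" "internal U Gs 1 V"
  shows "gram A W V = gram A V W"
proof -
  obtain As Ws Vs where R: "reps 1 A As" "reps 1 W Ws" "reps 1 V Vs" using assms internal_reps by metis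
  have "avg n (\<lambda>x. conv As Ws n (x \<star>\<^sub>n \<one>\<^sub>n) * conv As Vs n x) =
      avg n (\<lambda>x. conv As Vs n (x \<star>\<^sub>n \<one>\<^sub>n) * conv As Ws n x)" for n
    by (rule avg_cong) (simp add: monoid.r_one)
  then show ?thesis
    using corr_lim[OF R one_closed rep_one] corr_lim[OF R(1,3,2) one_closed rep_one] tendsto_unique[OF U_props(1)]
    by simp
qed

lemma corr_self_le:
  assumes "internal U Gs 1 A" "internal U Gs 1 W"
  shows "gram A W W \<le> (\<mu> 1 W)\<^sup>2"
proof -
  obtain As Ws where R: "reps 1 A As" "reps 1 W Ws" using assms internal_reps by metis
  have "avg n (\<lambda>x. conv As Ws n (x \<star>\<^sub>n \<one>\<^sub>n) * conv As Ws n x) \<le> (dens n 1 (Ws n))\<^sup>2" for n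
  proof -
    have "avg n (\<lambda>x. conv As Ws n (x \<star>\<^sub>n \<one>\<^sub>n) * conv As Ws n x) \<le> avg n (\<lambda>_. (dens n 1 (Ws n))\<^sup>2)"
      unfolding power2_eq_square by (intro avg_mono mult_mono conv_le[OF R(2)] conv_ge0 dens_ge0)
    then show ?thesis by (simp add: avg_const)
  qed
  then show ?thesis
    by (intro tendsto_le[OF U_props(1) tendsto_power[OF reps_lim[OF R(2)]] corr_lim[OF R R(2) one_closed rep_one]]) simp
qed

text \<open>The square of a mean is at most the mean of the square, applied to the linear
  combination of the functions \<open>h\<^sub>W\<close> with coefficients c. It limits how many
  functions of a given mean can have pairwise inner products well below the square of that
  mean.\<close>

lemma corr_gram:
  fixes c :: "nat \<Rightarrow> real"
  assumes A: "internal U Gs 1 A" and W: "\<And>i. i < N \<Longrightarrow> internal U Gs 1 (W i)"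
  shows "(\<Sum>i<N. c i * (\<mu> 1 A * \<mu> 1 (W i)))\<^sup>2 \<le> (\<Sum>i<N. \<Sum>j<N. c i * c j * gram A (W i) (W j))"
proof -
  obtain As where R: "reps 1 A As" using A internal_reps by metis
  have "\<forall>i. \<exists>Ws. i < N \<longrightarrow> reps 1 (W i) Ws" using W internal_reps by metis
  then obtain Ws where V: "\<And>i. i < N \<Longrightarrow> reps 1 (W i) (Ws i)" by metis
  let ?h = "\<lambda>n i. conv As (Ws i) n"
  have fin_ineq: "(\<Sum>i<N. c i * (dens n 1 (As n) * dens n 1 (Ws i n)))\<^sup>2 \<le>
      (\<Sum>i<N. \<Sum>j<N. c i * c j * avg n (\<lambda>x. ?h n i (x \<star>\<^sub>n \<one>\<^sub>n) * ?h n j x))" for n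
  proof -
    have "(\<Sum>i<N. c i * (dens n 1 (As n) * dens n 1 (Ws i n))) = (\<Sum>i<N. c i * avg n (?h n i))"
      using avg_conv[OF R V] by simp
    also have "\<dots> = avg n (\<lambda>x. (\<Sum>i<N. c i * ?h n i x) * 1)"
      by (simp add: avg_sum avg_cmult)
    finally have "(\<Sum>i<N. c i * (dens n 1 (As n) * dens n 1 (Ws i n)))\<^sup>2 \<le> avg n (\<lambda>x. (\<Sum>i<N. c i * ?h n i x)\<^sup>2)"
      using avg_CS[of n "\<lambda>x. \<Sum>i<N. c i * ?h n i x" "\<lambda>_. 1"] by (simp add: avg_const)
    also have "\<dots> = avg n (\<lambda>x. \<Sum>i<N. \<Sum>j<N. c i * c j * (?h n i (x \<star>\<^sub>n \<one>\<^sub>n) * ?h n j x))"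
      by (rule avg_cong) (simp add: monoid.r_one power2_eq_square sum_product ac_simps)
    also have "\<dots> = (\<Sum>i<N. \<Sum>j<N. c i * c j * avg n (\<lambda>x. ?h n i (x \<star>\<^sub>n \<one>\<^sub>n) * ?h n j x))"
      by (simp only: avg_sum avg_cmult)
    finally show ?thesis .
  qed
  have l1: "((\<lambda>n. (\<Sum>i<N. c i * (dens n 1 (As n) * dens n 1 (Ws i n)))\<^sup>2) \<longlongrightarrow>
      (\<Sum>i<N. c i * (\<mu> 1 A * \<mu> 1 (W i)))\<^sup>2) U"
    using V by (intro tendsto_power tendsto_sum tendsto_mult tendsto_const reps_lim[OF R] reps_lim) auto
  have l2: "((\<lambda>n. \<Sum>i<N. \<Sum>j<N. c i * c j * avg n (\<lambda>x. ?h n i (x \<star>\<^sub>n \<one>\<^sub>n) * ?h n j x)) \<longlongrightarrow>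
      (\<Sum>i<N. \<Sum>j<N. c i * c j * gram A (W i) (W j))) U"
    using V by (intro tendsto_sum tendsto_mult tendsto_const corr_lim[OF R _ _ one_closed rep_one]) auto
  show ?thesis by (rule tendsto_le[OF U_props(1) l2 l1 always_eventually]) (rule allI, rule fin_ineq)
qed

text \<open>The \<open>L\<^sup>2\<close>-distance between \<open>h\<^sub>W\<close> and its right translate by \<open>g\<close>.\<close>

definition shift_dist where
  "shift_dist A W g = sqrt (2 * (gram A W W - \<mu> 3 (corr A W W g)))"

text \<open>Two arguments are kept in order to have a genuine pseudometric: it satisfies the
  triangle inequality and is invariant under left multiplication of both arguments.\<close>

definition fin_dist :: "(nat \<Rightarrow> 'a list set) \<Rightarrow> (nat \<Rightarrow> 'a list set) \<Rightarrow> nat \<Rightarrow> 'a \<Rightarrow> 'a \<Rightarrow> real" where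
  "fin_dist As Ws n s t = sqrt (avg n (\<lambda>x. (conv As Ws n (x \<star>\<^sub>n s) - conv As Ws n (x \<star>\<^sub>n t))\<^sup>2))"

lemma fin_dist_translate:
  assumes "s \<in> carrier (Gs n)" "t \<in> carrier (Gs n)" "a \<in> carrier (Gs n)"
  shows "fin_dist As Ws n (a \<star>\<^sub>n s) (a \<star>\<^sub>n t) = fin_dist As Ws n s t"
proof -
  have "avg n (\<lambda>x. (conv As Ws n (x \<star>\<^sub>n (a \<star>\<^sub>n s)) - conv As Ws n (x \<star>\<^sub>n (a \<star>\<^sub>n t)))\<^sup>2) =
      avg n (\<lambda>x. (conv As Ws n (x \<star>\<^sub>n a \<star>\<^sub>n s) - conv As Ws n (x \<star>\<^sub>n a \<star>\<^sub>n t))\<^sup>2)"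
    using assms by (intro avg_cong) (simp add: monoid.m_assoc)
  also have "\<dots> = avg n (\<lambda>x. (conv As Ws n (x \<star>\<^sub>n s) - conv As Ws n (x \<star>\<^sub>n t))\<^sup>2)"
    by (rule avg_translate[OF assms(3)])
  finally show ?thesis by (simp add: fin_dist_def)
qed

lemma fin_dist_triangle: "fin_dist As Ws n s u \<le> fin_dist As Ws n s t + fin_dist As Ws n t u"
proof -
  let ?h = "\<lambda>s x. conv As Ws n (x \<star>\<^sub>n s)"
  have eq: "fin_dist As Ws n s t = L2_set (\<lambda>x. ?h s x - ?h t x) (carrier (Gs n)) / sqrt (real (order (Gs n)))" for s t
    by (simp add: fin_dist_def avg_def L2_set_def real_sqrt_divide)
  have "L2_set (\<lambda>x. ?h s x - ?h u x) (carrier (Gs n)) = L2_set (\<lambda>x. (?h s x - ?h t x) + (?h t x - ?h u x)) (carrier (Gs n))"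
    by simp
  also have "\<dots> \<le> L2_set (\<lambda>x. ?h s x - ?h t x) (carrier (Gs n)) + L2_set (\<lambda>x. ?h t x - ?h u x) (carrier (Gs n))"
    by (rule L2_set_triangle_ineq)
  finally show ?thesis unfolding eq by (simp add: add_divide_distrib[symmetric] divide_right_mono)
qed

lemma fin_dist_sym: "fin_dist As Ws n s t = fin_dist As Ws n t s"
  by (simp add: fin_dist_def power2_commute)

text \<open>Translation preserves the norm, so the squared distance between h and its translate is
  twice the difference of the squared norm of h and their inner product. This is the expression
  under the root in \<open>shift_dist\<close>.\<close>

lemma shift_dist_lim:
  assumes A: "reps 1 A As" and W: "reps 1 W Ws" and g: "g \<in> carrier G" "s \<in> g"
  shows "((\<lambda>n. fin_dist As Ws n (s n) \<one>\<^sub>n) \<longlongrightarrow> shift_dist A W g) U"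
proof -
  have "fin_dist As Ws n (s n) \<one>\<^sub>n =
      sqrt (2 * (avg n (\<lambda>x. conv As Ws n (x \<star>\<^sub>n \<one>\<^sub>n) * conv As Ws n x) -
        avg n (\<lambda>x. conv As Ws n (x \<star>\<^sub>n s n) * conv As Ws n x)))" for n
  proof -
    let ?h = "conv As Ws n"
    have s: "s n \<in> carrier (Gs n)" using rep_in[OF g] .
    have "avg n (\<lambda>x. (?h (x \<star>\<^sub>n s n) - ?h (x \<star>\<^sub>n \<one>\<^sub>n))\<^sup>2) =
        avg n (\<lambda>x. ((?h (x \<star>\<^sub>n s n))\<^sup>2 + (?h x)\<^sup>2) - 2 * (?h (x \<star>\<^sub>n s n) * ?h x))"
      by (intro avg_cong) (simp add: monoid.r_one power2_diff)
    also have "\<dots> = avg n (\<lambda>x. (?h (x \<star>\<^sub>n s n))\<^sup>2) + avg n (\<lambda>x. (?h x)\<^sup>2) - 2 * avg n (\<lambda>x. ?h (x \<star>\<^sub>n s n) * ?h x)"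
      by (simp only: avg_diff avg_add avg_cmult)
    also have "avg n (\<lambda>x. (?h (x \<star>\<^sub>n s n))\<^sup>2) = avg n (\<lambda>x. (?h x)\<^sup>2)"
      using avg_translate[OF s, of "\<lambda>x. (?h x)\<^sup>2"] .
    also have "avg n (\<lambda>x. (?h x)\<^sup>2) = avg n (\<lambda>x. ?h (x \<star>\<^sub>n \<one>\<^sub>n) * ?h x)"
      by (intro avg_cong) (simp add: monoid.r_one power2_eq_square)
    finally show ?thesis by (simp add: fin_dist_def)
  qed
  then show ?thesis unfolding shift_dist_def
    using tendsto_real_sqrt[OF tendsto_mult[OF tendsto_const
      tendsto_diff[OF corr_lim[OF A W W one_closed rep_one] corr_lim[OF A W W g]], of 2]] by simp
qed

lemma shift_dist_inv:
  assumes "internal U Gs 1 A" "internal U Gs 1 W" and g: "g \<in> carrier G"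
  shows "shift_dist A W (inv\<^bsub>G\<^esub> g) = shift_dist A W g"
proof -
  obtain As Ws where R: "reps 1 A As" "reps 1 W Ws" using assms internal_reps by metis
  obtain s where s: "s \<in> g" using rep_ex[OF g] by blast
  have sc: "s n \<in> carrier (Gs n)" for n using rep_in[OF g s] .
  have "fin_dist As Ws n (inv\<^bsub>Gs n\<^esub> s n) \<one>\<^sub>n = fin_dist As Ws n (s n) \<one>\<^sub>n" for n
    using fin_dist_translate[of "inv\<^bsub>Gs n\<^esub> s n" n "\<one>\<^sub>n" "s n" As Ws] sc
    by (simp add: group.r_inv monoid.r_one monoid.one_closed fin_dist_sym)
  then show ?thesis
    using tendsto_unique[OF U_props(1) shift_dist_lim[OF R inv_closed[OF g] rep_inv[OF g s]]]
      shift_dist_lim[OF R g s] by simp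
qed

text \<open>By left invariance the distance from st to s is that from t to 1, and the triangle
  inequality applies. Together with symmetry this makes \<open>shift_dist\<close> a length function
  on \<open>G\<close>.\<close>

lemma shift_dist_mult:
  assumes "internal U Gs 1 A" "internal U Gs 1 W" and g: "g \<in> carrier G" and h: "h \<in> carrier G"
  shows "shift_dist A W (g \<cdot> h) \<le> shift_dist A W g + shift_dist A W h"
proof -
  obtain As Ws where R: "reps 1 A As" "reps 1 W Ws" using assms internal_reps by metis
  obtain s t where s: "s \<in> g" and t: "t \<in> h" using rep_ex[OF g] rep_ex[OF h] by blast
  have sc: "s n \<in> carrier (Gs n)" "t n \<in> carrier (Gs n)" for n using rep_in[OF g s] rep_in[OF h t] .
  have "fin_dist As Ws n (s n \<star>\<^sub>n t n) \<one>\<^sub>n \<le>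
      fin_dist As Ws n (s n) \<one>\<^sub>n + fin_dist As Ws n (t n) \<one>\<^sub>n" for n
  proof -
    have "fin_dist As Ws n (s n \<star>\<^sub>n t n) (s n) = fin_dist As Ws n (t n) \<one>\<^sub>n"
      using fin_dist_translate[of "t n" n "\<one>\<^sub>n" "s n" As Ws] sc
      by (simp add: monoid.r_one monoid.one_closed)
    then show ?thesis using fin_dist_triangle[of As Ws n "s n \<star>\<^sub>n t n" "\<one>\<^sub>n" "s n"] by simp
  qed
  then show ?thesis
    by (intro tendsto_le[OF U_props(1) tendsto_add[OF shift_dist_lim[OF R g s] shift_dist_lim[OF R h t]]
      shift_dist_lim[OF R m_closed[OF g h] rep_mult[OF g h s t]]]) simp
qed

lemma shift_dist_one: "shift_dist A W \<one>\<^bsub>G\<^esub> = 0"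
  by (simp add: shift_dist_def)

lemma shift_dist_ge0:
  assumes "internal U Gs 1 A" "internal U Gs 1 W" and g: "g \<in> carrier G"
  shows "shift_dist A W g \<ge> 0"
  using shift_dist_mult[OF assms(1,2) g inv_closed[OF g]] shift_dist_inv[OF assms] g
  by (simp add: shift_dist_one)

text \<open>A change of variables moves the translation from the indicator of A to
  \<open>h\<^sub>W\<close>, where it becomes translation by the inverse of g. Cauchy-Schwarz against
  an indicator of norm at most 1 leaves the distance.\<close>

lemma test_shift:
  assumes "internal U Gs 1 A" "internal U Gs 1 W" and g: "g \<in> carrier G"
  shows "\<mu> 2 (test A W g) - \<mu> 2 (test A W \<one>\<^bsub>G\<^esub>) \<le> shift_dist A W g"
proof -
  obtain As Ws where R: "reps 1 A As" "reps 1 W Ws" using assms internal_reps by metis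
  obtain s where s: "s \<in> g" using rep_ex[OF g] by blast
  have "avg n (\<lambda>x. conv As Ws n x * of_bool ([x \<star>\<^sub>n s n] \<in> As n)) -
      avg n (\<lambda>x. conv As Ws n x * of_bool ([x \<star>\<^sub>n \<one>\<^sub>n] \<in> As n)) \<le>
      fin_dist As Ws n (inv\<^bsub>Gs n\<^esub> s n) \<one>\<^sub>n" for n
  proof -
    let ?h = "conv As Ws n" and ?i = "\<lambda>x. of_bool ([x] \<in> As n) :: real" and ?s' = "inv\<^bsub>Gs n\<^esub> s n"
    have sc: "s n \<in> carrier (Gs n)" using rep_in[OF g s] .
    have "avg n (\<lambda>x. ?h x * ?i (x \<star>\<^sub>n s n)) = avg n (\<lambda>x. ?h (x \<star>\<^sub>n s n \<star>\<^sub>n ?s') * ?i (x \<star>\<^sub>n s n))"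
      using sc by (intro avg_cong) (simp add: monoid.m_assoc group.r_inv monoid.r_one)
    also have "\<dots> = avg n (\<lambda>x. ?h (x \<star>\<^sub>n ?s') * ?i x)"
      using avg_translate[OF sc, of "\<lambda>x. ?h (x \<star>\<^sub>n ?s') * ?i x"] .
    finally have "avg n (\<lambda>x. ?h x * ?i (x \<star>\<^sub>n s n)) - avg n (\<lambda>x. ?h x * ?i (x \<star>\<^sub>n \<one>\<^sub>n)) =
        avg n (\<lambda>x. ?h (x \<star>\<^sub>n ?s') * ?i x - ?h x * ?i (x \<star>\<^sub>n \<one>\<^sub>n))"
      by (simp only: avg_diff)
    also have "\<dots> = avg n (\<lambda>x. (?h (x \<star>\<^sub>n ?s') - ?h (x \<star>\<^sub>n \<one>\<^sub>n)) * ?i x)"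
      by (intro avg_cong) (simp add: monoid.r_one left_diff_distrib)
    also have "\<dots> \<le> sqrt (avg n (\<lambda>x. (?h (x \<star>\<^sub>n ?s') - ?h (x \<star>\<^sub>n \<one>\<^sub>n))\<^sup>2) * avg n (\<lambda>x. (?i x)\<^sup>2))"
      by (rule real_le_rsqrt[OF avg_CS])
    also have "\<dots> \<le> sqrt (avg n (\<lambda>x. (?h (x \<star>\<^sub>n ?s') - ?h (x \<star>\<^sub>n \<one>\<^sub>n))\<^sup>2) * 1)"
    proof (intro real_sqrt_le_mono mult_left_mono)
      have "avg n (\<lambda>x. (?i x)\<^sup>2) \<le> avg n (\<lambda>_. 1)" by (intro avg_mono) simp
      then show "avg n (\<lambda>x. (?i x)\<^sup>2) \<le> 1" by (simp add: avg_const)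
      have "avg n (\<lambda>_. 0) \<le> avg n (\<lambda>x. (?h (x \<star>\<^sub>n ?s') - ?h (x \<star>\<^sub>n \<one>\<^sub>n))\<^sup>2)" by (intro avg_mono) simp
      then show "0 \<le> avg n (\<lambda>x. (?h (x \<star>\<^sub>n ?s') - ?h (x \<star>\<^sub>n \<one>\<^sub>n))\<^sup>2)" by (simp add: avg_const)
    qed
    finally show ?thesis by (simp add: fin_dist_def)
  qed
  then have "\<mu> 2 (test A W g) - \<mu> 2 (test A W \<one>\<^bsub>G\<^esub>) \<le> shift_dist A W (inv\<^bsub>G\<^esub> g)"
    by (intro tendsto_le[OF U_props(1) shift_dist_lim[OF R inv_closed[OF g] rep_inv[OF g s]]
      tendsto_diff[OF test_lim[OF R g s] test_lim[OF R one_closed rep_one]]]) simp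
  then show ?thesis using shift_dist_inv[OF assms] by simp
qed

text \<open>\<open>almost_periodicity\<close> with sample size m and number K fixed in advance from
  r and \<open>\<mu> W\<close>, so that the same K works at almost all indices.\<close>

lemma shift_dist_pigeonhole:
  assumes A: "internal U Gs 1 A" and W: "internal U Gs 1 W" "\<mu> 1 W > 0" and r: "r > 0"
  shows "\<exists>K::nat. \<forall>t. (\<forall>i<K. t i \<in> carrier G) \<longrightarrow>
    (\<exists>i j. i < j \<and> j < K \<and> shift_dist A W (inv\<^bsub>G\<^esub> (t i) \<cdot> t j) \<le> r)"
proof -
  obtain As Ws where R: "reps 1 A As" "reps 1 W Ws" using A W internal_reps by metis
  \<comment> \<open>At almost all indices the density of W exceeds half its limit; this lower bound
    makes K independent of the index.\<close>
  let ?d = "\<mu> 1 W / 2"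
  obtain m0 :: nat where m0: "8 / r\<^sup>2 < real m0" using reals_Archimedean2 by blast
  define m where "m = Suc m0"
  have "8 < real m0 * r\<^sup>2" using m0 r by (simp add: divide_less_eq)
  moreover have "real m * r\<^sup>2 = real m0 * r\<^sup>2 + r\<^sup>2" by (simp add: m_def algebra_simps)
  ultimately have "8 \<le> real m * r\<^sup>2" using zero_le_power2[of r] by linarith
  then have m: "m > 0" "8 / real m \<le> r\<^sup>2" by (simp_all add: m_def divide_le_eq mult.commute)
  obtain K :: nat where K: "2 / ?d ^ m < real K" using reals_Archimedean2 by blast
  have dm: "?d ^ m > 0" using W(2) by simp
  have ev: "eventually (\<lambda>n. dens n 1 (Ws n) > ?d) U"
    using order_tendstoD(1)[OF reps_lim[OF R(2)], of ?d] W(2) by simp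
  show ?thesis
  proof (rule exI[of _ K], intro allI impI)
    fix t assume t': "\<forall>i<K. t i \<in> carrier G"
    then have t: "t i \<in> carrier G" if "i < K" for i using that by blast
    have "\<forall>i. \<exists>s. i < K \<longrightarrow> s \<in> t i" using rep_ex[OF t] by blast
    then obtain s where s: "\<And>i. i < K \<Longrightarrow> s i \<in> t i" by metis
    have sc: "s i n \<in> carrier (Gs n)" if "i < K" for i n using rep_in[OF t[OF that] s[OF that]] .
    \<comment> \<open>The pair produced at n may vary with n. As there are only finitely many pairs,
      \<open>ev_bex\<close> afterwards selects one that works almost everywhere.\<close>
    have "eventually (\<lambda>n. \<exists>p\<in>{(i, j). i < j \<and> j < K}.
        fin_dist As Ws n (inv\<^bsub>Gs n\<^esub> s (fst p) n \<star>\<^sub>n s (snd p) n) \<one>\<^sub>n \<le> r) U"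
      using ev
    proof eventually_elim
      case (elim n)
      interpret H: group "Gs n" by simp
      let ?w = "{x \<in> carrier (Gs n). [x] \<in> Ws n}" and ?f = "\<lambda>x. of_bool ([x] \<in> As n) :: real"
      let ?p = "\<lambda>x. (\<Sum>u\<in>?w. ?f (x \<star>\<^sub>n u)) / real (card ?w)"
      let ?N = "real (order (Gs n))"
      have N: "?N > 0" using order_pos by simp
      have cw: "dens n 1 (Ws n) = real (card ?w) / ?N"
        unfolding dens1[OF R(2)] avg_def by (simp add: sum_of_bool_eq Int_def)
      have wpos: "card ?w > 0" using elim W(2) N unfolding cw by (intro Nat.gr0I) simp
      have "2 < real K * ?d ^ m" using K dm by (simp add: divide_less_eq)
      also have "\<dots> \<le> real K * (real (card ?w) / ?N) ^ m"
        using elim W(2) unfolding cw by (intro mult_left_mono power_mono) auto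
      finally have "2 * ?N ^ m < real K * real (card ?w) ^ m"
        using N by (simp add: power_divide less_divide_eq)
      then have "real (2 * order (Gs n) ^ m) < real (K * card ?w ^ m)" by simp
      then have Km: "2 * order (Gs n) ^ m < K * card ?w ^ m" by (simp only: of_nat_less_iff)
      have "\<exists>i j. i < j \<and> j < K \<and>
          (\<Sum>x\<in>carrier (Gs n). (?p (x \<star>\<^sub>n s i n) - ?p (x \<star>\<^sub>n s j n))\<^sup>2) \<le> 8 * ?N / real m"
        using wpos by (intro H.almost_periodicity[OF fin _ _ _ m(1) sc Km]) (auto simp: card_gt_0_iff)
      then obtain i j where ij: "i < j" "j < K"
        "(\<Sum>x\<in>carrier (Gs n). (?p (x \<star>\<^sub>n s i n) - ?p (x \<star>\<^sub>n s j n))\<^sup>2) \<le> 8 * ?N / real m"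
        by (elim exE conjE)
      \<comment> \<open>\<open>almost_periodicity\<close> normalises by the size of W. Passing to
        \<open>conv\<close> multiplies by the density of W, which is at most 1, so distances do not
        grow.\<close>
      have conv_p: "conv As Ws n x = real (card ?w) / ?N * ?p x" for x
      proof -
        have "(\<Sum>y\<in>carrier (Gs n). of_bool ([y] \<in> Ws n \<and> [x \<star>\<^sub>n y] \<in> As n)) = (\<Sum>u\<in>?w. ?f (x \<star>\<^sub>n u))"
          by (intro sum.mono_neutral_cong_right) auto
        then have "conv As Ws n x = (\<Sum>u\<in>?w. ?f (x \<star>\<^sub>n u)) / ?N" by (simp only: conv_def avg_def)
        also have "\<dots> = real (card ?w) / ?N * ?p x"
        proof -
          have "a / b = c / b * (a / c)" if "c \<noteq> 0" for a b c :: real using that by simp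
          moreover have "real (card ?w) \<noteq> 0" using wpos by linarith
          ultimately show ?thesis by blast
        qed
        finally show ?thesis .
      qed
      have w1: "real (card ?w) / ?N \<le> 1" using dens_le1[OF reps_sub(2)[OF R(2)]] unfolding cw[symmetric] .
      have "avg n (\<lambda>x. (conv As Ws n (x \<star>\<^sub>n s i n) - conv As Ws n (x \<star>\<^sub>n s j n))\<^sup>2) \<le>
          avg n (\<lambda>x. (?p (x \<star>\<^sub>n s i n) - ?p (x \<star>\<^sub>n s j n))\<^sup>2)"
      proof (rule avg_mono)
        fix x
        have "(real (card ?w) / ?N * a - real (card ?w) / ?N * b)\<^sup>2 \<le> (a - b)\<^sup>2" for a b :: real
        proof -
          have "(real (card ?w) / ?N)\<^sup>2 * (a - b)\<^sup>2 \<le> 1 * (a - b)\<^sup>2"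
            using w1 N by (intro mult_right_mono power_le_one) auto
          then show ?thesis by (simp only: right_diff_distrib[symmetric] power_mult_distrib mult_1)
        qed
        then show "(conv As Ws n (x \<star>\<^sub>n s i n) - conv As Ws n (x \<star>\<^sub>n s j n))\<^sup>2 \<le>
          (?p (x \<star>\<^sub>n s i n) - ?p (x \<star>\<^sub>n s j n))\<^sup>2" unfolding conv_p .
      qed
      also have "\<dots> \<le> 8 / real m" using ij(3) N m(1) by (simp add: avg_def divide_le_eq)
      also have "\<dots> \<le> r\<^sup>2" by (rule m(2))
      finally have "fin_dist As Ws n (s i n) (s j n) \<le> r"
        unfolding fin_dist_def using r by (intro real_le_lsqrt) auto
      moreover have "fin_dist As Ws n (inv\<^bsub>Gs n\<^esub> s i n \<star>\<^sub>n s j n) \<one>\<^sub>n = fin_dist As Ws n (s i n) (s j n)"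
      proof -
        have c: "s i n \<in> carrier (Gs n)" "s j n \<in> carrier (Gs n)" using sc ij by auto
        have "fin_dist As Ws n (s i n \<star>\<^sub>n (inv\<^bsub>Gs n\<^esub> s i n \<star>\<^sub>n s j n)) (s i n \<star>\<^sub>n \<one>\<^sub>n) =
            fin_dist As Ws n (inv\<^bsub>Gs n\<^esub> s i n \<star>\<^sub>n s j n) \<one>\<^sub>n"
          using c by (intro fin_dist_translate) auto
        then show ?thesis using c by (simp add: H.m_assoc[symmetric] fin_dist_sym)
      qed
      ultimately show ?case using ij(1,2) by (intro bexI[of _ "(i, j)"]) auto
    qed
    moreover have "finite {(i, j). i < j \<and> j < K}"
      by (rule finite_subset[of _ "{..<K} \<times> {..<K}"]) auto
    ultimately obtain i j where ij: "i < j" "j < K"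
      and e: "eventually (\<lambda>n. fin_dist As Ws n (inv\<^bsub>Gs n\<^esub> s i n \<star>\<^sub>n s j n) \<one>\<^sub>n \<le> r) U"
      using ev_bex[of "{(i, j). i < j \<and> j < K}"
        "\<lambda>p n. fin_dist As Ws n (inv\<^bsub>Gs n\<^esub> s (fst p) n \<star>\<^sub>n s (snd p) n) \<one>\<^sub>n \<le> r"] by auto
    have c: "t i \<in> carrier G" "t j \<in> carrier G" "s i \<in> t i" "s j \<in> t j" using t s ij by auto
    have "shift_dist A W (inv\<^bsub>G\<^esub> (t i) \<cdot> t j) \<le> r"
      by (rule tendsto_upperbound[OF shift_dist_lim[OF R _ rep_mult[OF inv_closed c(2) rep_inv c(4)]] e U_props(1)])
        (use c in auto)
    then show "\<exists>i j. i < j \<and> j < K \<and> shift_dist A W (inv\<^bsub>G\<^esub> (t i) \<cdot> t j) \<le> r" using ij by blast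
  qed
qed

text \<open>If finitely many translates of the ball never covered \<open>G\<close>, elements at
  pairwise distance above r could be chosen greedily for ever, against the pigeonhole bound.\<close>

lemma shift_dist_generic:
  assumes A: "internal U Gs 1 A" and W: "internal U Gs 1 W" "\<mu> 1 W > 0" and r: "r > 0"
  shows "generic G {g \<in> carrier G. shift_dist A W g \<le> r}"
proof (rule ccontr)
  let ?B = "{g \<in> carrier G. shift_dist A W g \<le> r}"
  assume neg: "\<not> generic G ?B"
  have no: "\<exists>x\<in>carrier G. \<forall>t\<in>T. x \<notin> t <#\<^bsub>G\<^esub> ?B" if "finite T" "T \<subseteq> carrier G" for T
  proof (rule ccontr)
    assume "\<not> (\<exists>x\<in>carrier G. \<forall>t\<in>T. x \<notin> t <#\<^bsub>G\<^esub> ?B)"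
    then have "carrier G \<subseteq> (\<Union>t\<in>T. t <#\<^bsub>G\<^esub> ?B)" by blast
    with neg that show False unfolding generic_def by blast
  qed
  obtain K :: nat where K: "\<forall>t. (\<forall>i<K. t i \<in> carrier G) \<longrightarrow>
    (\<exists>i j. i < j \<and> j < K \<and> shift_dist A W (inv\<^bsub>G\<^esub> (t i) \<cdot> t j) \<le> r)"
    using shift_dist_pigeonhole[OF A W r] by (elim exE)
  have "\<exists>t. (\<forall>i<k. t i \<in> carrier G) \<and> (\<forall>i j. i < j \<longrightarrow> j < k \<longrightarrow> \<not> shift_dist A W (inv\<^bsub>G\<^esub> (t i) \<cdot> t j) \<le> r)" for k :: nat
  proof (induction k)
    case (Suc k)
    then obtain t where t: "\<And>i. i < k \<Longrightarrow> t i \<in> carrier G"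
      "\<And>i j. i < j \<Longrightarrow> j < k \<Longrightarrow> \<not> shift_dist A W (inv\<^bsub>G\<^esub> (t i) \<cdot> t j) \<le> r" by blast
    have "t ` {..<k} \<subseteq> carrier G" using t(1) by blast
    from no[OF _ this] obtain x where x: "x \<in> carrier G" "\<And>i. i < k \<Longrightarrow> x \<notin> t i <#\<^bsub>G\<^esub> ?B" by blast
    have far: "\<not> shift_dist A W (inv\<^bsub>G\<^esub> (t i) \<cdot> x) \<le> r" if i: "i < k" for i
    proof
      assume "shift_dist A W (inv\<^bsub>G\<^esub> (t i) \<cdot> x) \<le> r"
      moreover have "x = t i \<cdot> (inv\<^bsub>G\<^esub> (t i) \<cdot> x)" using t(1)[OF i] x(1) by (simp add: m_assoc[symmetric])
      moreover have "inv\<^bsub>G\<^esub> (t i) \<cdot> x \<in> carrier G" using t(1)[OF i] x(1) by simp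
      ultimately have "x \<in> t i <#\<^bsub>G\<^esub> {g \<in> carrier G. shift_dist A W g \<le> r}" unfolding l_coset_def by blast
      then show False using x(2)[OF i] by simp
    qed
    show ?case
      using t x(1) far by (intro exI[of _ "t(k := x)"]) (auto simp: less_Suc_eq)
  qed simp
  from this[of K] K show False by blast
qed

end

section \<open>Recurrence along the component\<close>

context tame
begin

section \<open>Definability of the correlation sets, uniformly in the translating element\<close>

lemma D_word:
  assumes "A \<subseteq> carrier G" "X \<in> D A 1" "\<And>i e. (i, e) \<in> set w \<Longrightarrow> i < n"
    and "\<And>xs. xs \<in> cart_pow G n \<Longrightarrow> word_val G w xs = f xs"
  shows "{xs \<in> cart_pow G n. [f xs] \<in> X} \<in> D A n"
proof -
  have "{xs \<in> cart_pow G n. map (\<lambda>w. word_val G w xs) [w] \<in> X} \<in> D A n"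
    using assms(1-3) by (intro D_subst) auto
  also have "{xs \<in> cart_pow G n. map (\<lambda>w. word_val G w xs) [w] \<in> X} = {xs \<in> cart_pow G n. [f xs] \<in> X}"
    using assms(4) by (intro Collect_cong conj_cong refl) simp
  finally show ?thesis .
qed

lemma D_coord:
  assumes "A \<subseteq> carrier G" "X \<in> D A 1" "i < n"
  shows "{xs \<in> cart_pow G n. [xs ! i] \<in> X} \<in> D A n"
  using D_index[of A X "[i]" n] assms by simp

lemma D_inv:
  assumes "A \<subseteq> carrier G" "X \<in> D A 1" "i < n"
  shows "{xs \<in> cart_pow G n. [inv\<^bsub>G\<^esub> (xs ! i)] \<in> X} \<in> D A n"
  by (rule D_word[where w = "[(i, -1)]", OF assms(1,2)])
    (use assms(3) cart_nth[of _ G n i] in \<open>auto simp: word_val_def int_pow_neg\<close>)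

lemma D_mult:
  assumes "A \<subseteq> carrier G" "X \<in> D A 1" "i < n" "j < n"
  shows "{xs \<in> cart_pow G n. [xs ! i \<cdot> xs ! j] \<in> X} \<in> D A n"
  by (rule D_word[where w = "[(i, 1), (j, 1)]", OF assms(1,2)])
    (use assms(3,4) cart_nth[of _ G n i] cart_nth[of _ G n j] in \<open>auto simp: word_val_def\<close>)

lemma D_mult3:
  assumes "A \<subseteq> carrier G" "X \<in> D A 1" "i < n" "j < n" "k < n"
  shows "{xs \<in> cart_pow G n. [xs ! i \<cdot> xs ! j \<cdot> xs ! k] \<in> X} \<in> D A n"
  by (rule D_word[where w = "[(i, 1), (j, 1), (k, 1)]", OF assms(1,2)])
    (use assms(3-5) cart_nth[of _ G n i] cart_nth[of _ G n j] cart_nth[of _ G n k] in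
      \<open>auto simp: word_val_def m_assoc\<close>)

lemma cart1_iff: "xs \<in> cart_pow H 1 \<longleftrightarrow> (\<exists>x\<in>carrier H. xs = [x])"
  by (auto simp: cart_pow_def length_Suc_conv)

lemma cart2_iff: "xs \<in> cart_pow H 2 \<longleftrightarrow> (\<exists>x\<in>carrier H. \<exists>y\<in>carrier H. xs = [x, y])"
  by (auto simp: cart_pow_def length_Suc_conv numeral_2_eq_2)

lemma cart3_iff: "xs \<in> cart_pow H 3 \<longleftrightarrow> (\<exists>x\<in>carrier H. \<exists>y\<in>carrier H. \<exists>z\<in>carrier H. xs = [x, y, z])"
  by (auto simp: cart_pow_def length_Suc_conv numeral_3_eq_3)

text \<open>Presents the sets for all g as fibres of a single set defined over \<open>M\<close>.
  Conditions on their density then become definable conditions on g.\<close>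

lemma corr_D:
  assumes M: "M \<subseteq> carrier G" and AWV: "A \<in> D M 1" "W \<in> D M 1" "V \<in> D M 1"
  obtains Z where "Z \<in> D M (3 + 1)" "\<And>g. g \<in> carrier G \<Longrightarrow> fibre G 3 Z [g] = corr A W V g"
proof
  let ?Z = "{xs \<in> cart_pow G (3 + 1). [xs ! 1] \<in> W \<and> [xs ! 2] \<in> V \<and>
    [xs ! 0 \<cdot> xs ! 3 \<cdot> xs ! 1] \<in> A \<and> [xs ! 0 \<cdot> xs ! 2] \<in> A}"
  show "?Z \<in> D M (3 + 1)" by (intro D_conj D_coord D_mult D_mult3 M AWV) simp_all
  fix g assume g: "g \<in> carrier G"
  then have "[x, y, z] @ [g] \<in> cart_pow G (3 + 1)" if "x \<in> carrier G" "y \<in> carrier G" "z \<in> carrier G" for x y z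
    using that by (simp add: cart_pow_def)
  then show "fibre G 3 ?Z [g] = corr A W V g"
    unfolding fibre_def corr_def cart3_iff by fastforce
qed

lemma test_D:
  assumes M: "M \<subseteq> carrier G" and AW: "A \<in> D M 1" "W \<in> D M 1"
  obtains Z where "Z \<in> D M (2 + 1)" "\<And>g. g \<in> carrier G \<Longrightarrow> fibre G 2 Z [g] = test A W g"
proof
  let ?Z = "{xs \<in> cart_pow G (2 + 1). [xs ! 1] \<in> W \<and> [xs ! 0 \<cdot> xs ! 1] \<in> A \<and> [xs ! 0 \<cdot> xs ! 2] \<in> A}"
  show "?Z \<in> D M (2 + 1)" by (intro D_conj D_coord D_mult M AW) simp_all
  fix g assume g: "g \<in> carrier G"
  then have "[x, y] @ [g] \<in> cart_pow G (2 + 1)" if "x \<in> carrier G" "y \<in> carrier G" for x y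
    using that by (simp add: cart_pow_def)
  then show "fibre G 2 ?Z [g] = test A W g"
    unfolding fibre_def test_def cart2_iff by fastforce
qed

definition recur where
  "recur A g = tuples1 G (\<lambda>x. [x] \<in> A \<and> [x \<cdot> g] \<in> A)"

lemma recur_D:
  assumes M: "M \<subseteq> carrier G" and A: "A \<in> D M 1"
  obtains Z where "Z \<in> D M (1 + 1)" "\<And>g. g \<in> carrier G \<Longrightarrow> fibre G 1 Z [g] = recur A g"
proof
  let ?Z = "{xs \<in> cart_pow G (1 + 1). [xs ! 0] \<in> A \<and> [xs ! 0 \<cdot> xs ! 1] \<in> A}"
  show "?Z \<in> D M (1 + 1)" by (intro D_conj D_coord D_mult M A) simp_all
  fix g assume g: "g \<in> carrier G"
  then have "[x] @ [g] \<in> cart_pow G (1 + 1)" if "x \<in> carrier G" for x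
    using that by (simp add: cart_pow_def)
  then show "fibre G 1 ?Z [g] = recur A g"
    unfolding fibre_def recur_def cart1_iff by fastforce
qed

lemma internal_fibre:
  assumes "internal U Gs n Z" "y \<in> cart_pow G m" "n = k + m"
  shows "internal U Gs k (fibre G k Z y)"
proof -
  obtain Zs where Z: "reps (k + m) Z Zs" using assms(1,3) unfolding internal_reps by blast
  obtain ts where ts: "list_all2 (\<in>) ts y" using tuple_rep_ex[OF assms(2)] by (elim exE)
  show ?thesis unfolding internal_reps by (rule exI) (rule reps_fibre[OF Z assms(2) ts])
qed

lemma corr_internal:
  assumes "internal U Gs 1 A" "internal U Gs 1 W" "internal U Gs 1 V" "g \<in> carrier G"
  shows "internal U Gs 3 (corr A W V g)"
proof -
  obtain As Ws Vs where R: "reps 1 A As" "reps 1 W Ws" "reps 1 V Vs"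
    using assms(1-3) unfolding internal_reps by (elim exE)
  obtain s where s: "s \<in> g" using rep_ex[OF assms(4)] by (elim exE)
  show ?thesis unfolding internal_reps by (rule exI) (rule corr_reps[OF R assms(4) s])
qed

lemma test_internal:
  assumes "internal U Gs 1 A" "internal U Gs 1 W" "g \<in> carrier G"
  shows "internal U Gs 2 (test A W g)"
proof -
  obtain As Ws where R: "reps 1 A As" "reps 1 W Ws" using assms(1,2) unfolding internal_reps by (elim exE)
  obtain s where s: "s \<in> g" using rep_ex[OF assms(3)] by (elim exE)
  show ?thesis unfolding internal_reps by (rule exI) (rule test_reps[OF R assms(3) s])
qed

lemma shift_dist_le_iff:
  assumes "r \<ge> 0"
  shows "shift_dist A W g \<le> r \<longleftrightarrow> \<mu> 3 (corr A W W g) \<ge> gram A W W - r\<^sup>2 / 2"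
proof -
  have "shift_dist A W g \<le> r \<longleftrightarrow> 2 * (gram A W W - \<mu> 3 (corr A W W g)) \<le> r\<^sup>2"
    unfolding shift_dist_def using assms real_sqrt_le_iff[of _ "r\<^sup>2"] by (simp del: real_sqrt_le_iff)
  then show ?thesis by auto
qed

text \<open>The zero set of a length function is the intersection of its balls, which are generic
  when \<open>\<mu> W\<close> is positive. The balls are definable only approximately and are
  replaced by symmetric definable sets in between.\<close>

lemma shift_dist_candidate:
  assumes M: "M \<subseteq> carrier G" and A: "A \<in> D M 1" and W: "W \<in> D M 1" "\<mu> 1 W > 0"
  shows "component_candidate G F M {g \<in> carrier G. shift_dist A W g = 0}"
proof -
  have Ai: "internal U Gs 1 A" and Wi: "internal U Gs 1 W" using D_internal[OF M] A W by auto
  obtain Z where Z: "Z \<in> D M (3 + 1)" "\<And>g. g \<in> carrier G \<Longrightarrow> fibre G 3 Z [g] = corr A W W g"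
    using corr_D[OF M A W(1) W(1)] by metis
  \<comment> \<open>The definable set \<open>V n\<close> lies between the balls of radius
    \<open>r n / 2\<close> and \<open>r n\<close>. With ratio 1/4, two elements of
    \<open>V (Suc n)\<close> have a product of length at most \<open>r n / 2\<close>, which is back
    in \<open>V n\<close>.\<close>
  define r :: "nat \<Rightarrow> real" where "r n = (1 / 4) ^ n" for n
  have r: "r n > 0" "r (Suc n) = r n / 4" for n by (simp_all add: r_def)
  have "\<exists>Y. Y \<in> D M 1 \<and> (\<forall>g\<in>carrier G. shift_dist A W g \<le> r n / 2 \<longrightarrow> [g] \<in> Y) \<and>
      (\<forall>g. [g] \<in> Y \<longrightarrow> g \<in> carrier G \<and> shift_dist A W g \<le> r n)" for n
  proof -
    let ?e = "gram A W W"
    have "?e - (r n)\<^sup>2 / 2 < ?e - (r n / 2)\<^sup>2 / 2" using r(1)[of n] by (simp add: power_divide)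
    from D_threshold[OF M Z(1) this] obtain Y where Y: "Y \<in> D M 1"
      "\<And>y. y \<in> cart_pow G 1 \<Longrightarrow> \<mu> 3 (fibre G 3 Z y) \<ge> ?e - (r n / 2)\<^sup>2 / 2 \<Longrightarrow> y \<in> Y"
      "\<And>y. y \<in> Y \<Longrightarrow> y \<in> cart_pow G 1 \<and> \<mu> 3 (fibre G 3 Z y) \<ge> ?e - (r n)\<^sup>2 / 2" by metis
    have "[g] \<in> Y" if "g \<in> carrier G" "shift_dist A W g \<le> r n / 2" for g
      using Y(2)[of "[g]"] that Z(2)[OF that(1)] shift_dist_le_iff[of "r n / 2" A W g] r(1)[of n]
      by (simp add: cart_pow_def)
    moreover have "g \<in> carrier G \<and> shift_dist A W g \<le> r n" if "[g] \<in> Y" for g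
      using Y(3)[OF that] Z(2)[of g] shift_dist_le_iff[of "r n" A W g] r(1)[of n]
      by (simp add: cart_pow_def)
    ultimately show ?thesis using Y(1) by blast
  qed
  then obtain Y where Y: "\<And>n. Y n \<in> D M 1"
    "\<And>n g. g \<in> carrier G \<Longrightarrow> shift_dist A W g \<le> r n / 2 \<Longrightarrow> [g] \<in> Y n"
    "\<And>n g. [g] \<in> Y n \<Longrightarrow> g \<in> carrier G \<and> shift_dist A W g \<le> r n" by metis
  \<comment> \<open>The balls are symmetric but the sets sandwiched between them may fail to be,
    hence the second condition.\<close>
  define V where "V n = {g \<in> carrier G. [g] \<in> Y n \<and> [inv\<^bsub>G\<^esub> g] \<in> Y n}" for n
  have V_in: "g \<in> V n" if "g \<in> carrier G" "shift_dist A W g \<le> r n / 2" for g n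
    using Y(2) that shift_dist_inv[OF Ai Wi that(1)] by (simp add: V_def)
  have V_out: "g \<in> carrier G \<and> shift_dist A W g \<le> r n" if "g \<in> V n" for g n
    using that Y(3) by (simp add: V_def)
  have "chain_over M V" unfolding chain_over_def
  proof (intro allI conjI)
    fix n
    have "(\<lambda>z. [z]) ` V n = {xs \<in> cart_pow G 1. [xs ! 0] \<in> Y n \<and> [inv\<^bsub>G\<^esub> (xs ! 0)] \<in> Y n}"
      unfolding V_def cart1_iff by force
    moreover have "{xs \<in> cart_pow G 1. [xs ! 0] \<in> Y n \<and> [inv\<^bsub>G\<^esub> (xs ! 0)] \<in> Y n} \<in> D M 1"
      by (intro D_conj D_coord D_inv M Y(1)) simp_all
    ultimately show "(\<lambda>z. [z]) ` V n \<in> D M 1" by simp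
    show "\<one>\<^bsub>G\<^esub> \<in> V n" using V_in[OF one_closed] r(1)[of n] by (simp add: shift_dist_one)
    have inv_V: "inv\<^bsub>G\<^esub> x \<in> V n" if "x \<in> V n" for x using that by (simp add: V_def)
    show "set_inv\<^bsub>G\<^esub> (V n) = V n"
    proof (intro Set.equalityI subsetI)
      fix x assume x: "x \<in> V n"
      have "x = inv\<^bsub>G\<^esub> (inv\<^bsub>G\<^esub> x)" using V_out[OF x] by (intro inv_inv[symmetric]) blast
      then show "x \<in> set_inv\<^bsub>G\<^esub> (V n)" unfolding SET_INV_def using inv_V[OF x] by blast
    next
      fix x assume "x \<in> set_inv\<^bsub>G\<^esub> (V n)"
      then show "x \<in> V n" using inv_V unfolding SET_INV_def by blast
    qed
    have sub: "{g \<in> carrier G. shift_dist A W g \<le> r n / 2} \<subseteq> V n" using V_in by blast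
    show "generic G (V n)"
      using r(1)[of n] by (intro generic_mono[OF shift_dist_generic[OF Ai Wi W(2)] sub]) simp
    show "V (Suc n) <#>\<^bsub>G\<^esub> V (Suc n) \<subseteq> V n"
    proof
      fix z assume "z \<in> V (Suc n) <#>\<^bsub>G\<^esub> V (Suc n)"
      then obtain x y where z: "z = x \<cdot> y" "x \<in> V (Suc n)" "y \<in> V (Suc n)" unfolding set_mult_def by blast
      then have x: "x \<in> carrier G" "shift_dist A W x \<le> r n / 4" and y: "y \<in> carrier G" "shift_dist A W y \<le> r n / 4"
        using V_out[of x "Suc n"] V_out[of y "Suc n"] r(2) by auto
      have "shift_dist A W (x \<cdot> y) \<le> r n / 2" using shift_dist_mult[OF Ai Wi x(1) y(1)] x y by linarith
      then show "z \<in> V n" unfolding z(1) using x(1) y(1) by (intro V_in m_closed)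
    qed
  qed
  moreover have "{g \<in> carrier G. shift_dist A W g = 0} = (\<Inter>n. V n)"
  proof (intro Set.equalityI subsetI)
    fix g assume "g \<in> {g \<in> carrier G. shift_dist A W g = 0}"
    then have "g \<in> V n" for n using V_in[of g n] r(1)[of n] by simp
    then show "g \<in> (\<Inter>n. V n)" by blast
  next
    fix g assume "g \<in> (\<Inter>n. V n)"
    then have g: "g \<in> carrier G" "shift_dist A W g \<le> r n" for n using V_out[of g n] by blast+
    have "r \<longlonglongrightarrow> 0" unfolding r_def by (rule LIMSEQ_realpow_zero) auto
    then have "shift_dist A W g \<le> 0" using g(2) by (intro LIMSEQ_le_const[of r]) auto
    then show "g \<in> {g \<in> carrier G. shift_dist A W g = 0}"
      using shift_dist_ge0[OF Ai Wi g(1)] g(1) by simp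
  qed
  ultimately show ?thesis
    unfolding component_candidate_iff using chain_subgroup[OF M] by metis
qed

text \<open>Such an X contains the type of g. This is what permits division by the densities of
  definable sets around g.\<close>

lemma dense_over_pos:
  assumes M: "M \<subseteq> carrier G" and g: "dense_over U Gs F [g] M" and X: "X \<in> D M 1" "[g] \<in> X"
  shows "\<mu> 1 X > 0"
proof -
  have "tp G F [g] M \<subseteq> X" using X by (auto simp: tp_def)
  moreover have "X \<in> D (carrier G) 1" using X(1) defined_over_mono[OF M, of G F 1] by blast
  ultimately have "\<mu> 1 X \<noteq> 0" using g by (auto simp: dense_over_def dense_def Let_def)
  then show ?thesis using mu_ge0[OF D_internal[OF M X(1)]] by simp
qed

text \<open>If \<open>g\<close> violated the bound then so would all elements of some \<open>W\<^sub>0 \<in> \<F>(M)\<close> containing \<open>g\<close>, and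
  one could choose \<open>W\<^sub>0, W\<^sub>1, \<dots>\<close> inductively such that the normalised functions \<open>h\<^sub>W\<close> of mean
  \<open>\<mu> A\<close> have pairwise inner products below \<open>(\<mu> A)\<^sup>2\<close> by a fixed amount: the inner product of \<open>h\<^sub>W\<close> with
  \<open>h\<^sub>V\<close> averages \<open>\<mu> (test A W w)\<close> over \<open>w \<in> V\<close>, and \<open>g\<close> being in the component fixes \<open>h\<^sub>W\<close>.\<close>

lemma component_recurrence:
  assumes M: "M \<subseteq> carrier G" "countable M" and F: "countable (\<Union>n. F n)"
    and g: "g \<in> component_over G F M" "dense_over U Gs F [g] M" and A: "A \<in> D M 1"
  shows "\<mu> 1 (recur A g) \<ge> (\<mu> 1 A)\<^sup>2"
proof (rule ccontr)
  let ?m = "(\<mu> 1 A)\<^sup>2"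
  assume neg: "\<not> \<mu> 1 (recur A g) \<ge> ?m"
  \<comment> \<open>A third of the deficit at g: the deficit is \<open>3 * d\<close> at g, at least
    \<open>2 * d\<close> on the definable set \<open>E\<close>, and at least d after one more
    threshold in \<open>step\<close>.\<close>
  define d where "d = (?m - \<mu> 1 (recur A g)) / 3"
  have d: "d > 0" "\<mu> 1 (recur A g) = ?m - 3 * d" using neg by (simp_all add: d_def field_simps)
  have "subgroup (component_over G F M) G"
    using component_is_least(1)[OF M F] unfolding component_candidate_def by (rule conjunct1)
  then have gc: "g \<in> carrier G" using g(1) by (rule subgroup.mem_carrier)
  have Ai: "internal U Gs 1 A" using D_internal[OF M(1) A] .
  obtain R where R: "R \<in> D M (1 + 1)" "\<And>g. g \<in> carrier G \<Longrightarrow> fibre G 1 R [g] = recur A g"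
    using recur_D[OF M(1) A] by metis
  have "?m - 3 * d < ?m - 2 * d" using d by simp
  from D_threshold_le[OF M(1) R(1) this] obtain E where E: "E \<in> D M 1"
    "\<And>y. y \<in> cart_pow G 1 \<Longrightarrow> \<mu> 1 (fibre G 1 R y) \<le> ?m - 3 * d \<Longrightarrow> y \<in> E"
    "\<And>y. y \<in> E \<Longrightarrow> y \<in> cart_pow G 1 \<and> \<mu> 1 (fibre G 1 R y) \<le> ?m - 2 * d" by metis
  have gE: "[g] \<in> E" using E(2)[of "[g]"] R(2)[OF gc] d(2) gc by (simp add: cart_pow_def)
  have recE: "w \<in> carrier G \<and> \<mu> 1 (recur A w) \<le> ?m - 2 * d" if "[w] \<in> E" for w
    using E(3)[OF that] R(2)[of w] by (simp add: cart_pow_def)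
  define good where "good W \<longleftrightarrow> W \<in> D M 1 \<and> [g] \<in> W \<and> W \<subseteq> E" for W
  have pos: "\<mu> 1 W > 0" if "good W" for W
    using dense_over_pos[OF M(1) g(2)] that by (simp add: good_def)
  have good_int: "internal U Gs 1 W" if "good W" for W using that D_internal[OF M(1)] by (simp add: good_def)
  have step: "\<exists>E'. E' \<in> D M 1 \<and> [g] \<in> E' \<and>
      (\<forall>w. [w] \<in> E' \<longrightarrow> \<mu> 2 (test A W w) \<le> \<mu> 1 W * (?m - d))" if W: "good W" for W
  proof -
    have WD: "W \<in> D M 1" using W by (simp add: good_def)
    note Wi = good_int[OF W]
    obtain Z where Z: "Z \<in> D M (2 + 1)" "\<And>g. g \<in> carrier G \<Longrightarrow> fibre G 2 Z [g] = test A W g"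
      using test_D[OF M(1) A WD] by metis
    have t1: "\<mu> 2 (test A W \<one>\<^bsub>G\<^esub>) \<le> (?m - 2 * d) * \<mu> 1 W"
    proof -
      \<comment> \<open>For g = 1 the set \<open>test\<close> consists of the pairs (x, y) with y in
        W and both x and xy in A, so its fibre over y measures recurrence along y, which is
        deficient on \<open>E\<close>.\<close>
      have fib: "fibre G 1 (test A W \<one>\<^bsub>G\<^esub>) [y] \<subseteq> recur A y" if "y \<in> carrier G" for y
        using that by (auto simp: fibre_def test_def recur_def cart1_iff)
      have int: "internal U Gs (1 + 1) (test A W \<one>\<^bsub>G\<^esub>)"
        using test_internal[OF Ai Wi one_closed] by (simp add: numeral_2_eq_2)
      have "\<mu> (1 + 1) (test A W \<one>\<^bsub>G\<^esub>) \<le> (?m - 2 * d) * \<mu> 1 W"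
      proof (rule fubini_bound[OF int Wi])
        fix x y assume xy: "x @ y \<in> test A W \<one>\<^bsub>G\<^esub>" "y \<in> cart_pow G 1"
        from xy(2) obtain w where "y = [w]" unfolding cart1_iff by blast
        then show "y \<in> W" using xy(1) by (auto simp: test_def)
      next
        fix y assume "y \<in> W"
        moreover have "W \<subseteq> E" using W by (simp add: good_def)
        ultimately obtain w where w: "y = [w]" "[w] \<in> E" using E(3) by (metis cart1_iff subsetD)
        have wc: "w \<in> carrier G" using recE[OF w(2)] by blast
        have i1: "internal U Gs 1 (fibre G 1 (test A W \<one>\<^bsub>G\<^esub>) y)"
          using wc w(1) by (intro internal_fibre[OF int]) (simp_all add: cart_pow_def)
        have "internal U Gs 1 (fibre G 1 R [w])"
          using wc by (intro internal_fibre[OF D_internal[OF M(1) R(1)]]) (simp_all add: cart_pow_def)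
        then have i2: "internal U Gs 1 (recur A w)" using R(2)[OF wc] by simp
        have "\<mu> 1 (fibre G 1 (test A W \<one>\<^bsub>G\<^esub>) y) \<le> \<mu> 1 (recur A w)"
          using mu_mono[OF i1 i2] fib recE[OF w(2)] w(1) by simp
        then show "\<mu> 1 (fibre G 1 (test A W \<one>\<^bsub>G\<^esub>) y) \<le> ?m - 2 * d" using recE[OF w(2)] by simp
      qed
      then show ?thesis by (simp add: numeral_2_eq_2)
    qed
    \<comment> \<open>Membership of g in the component acts here: the length of g vanishes, so the
      deficit passes from \<open>test\<close> at the identity to \<open>test\<close> at g and, being
      definable, to a neighbourhood of g over \<open>M\<close>.\<close>
    have "component_over G F M \<subseteq> {g \<in> carrier G. shift_dist A W g = 0}"
      using component_is_least(2)[OF M F shift_dist_candidate[OF M(1) A WD pos[OF W]]] .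
    then have "shift_dist A W g = 0" using g(1) by blast
    then have tg: "\<mu> 2 (test A W g) \<le> (?m - 2 * d) * \<mu> 1 W" using test_shift[OF Ai Wi gc] t1 by simp
    have "(?m - 2 * d) * \<mu> 1 W < (?m - d) * \<mu> 1 W" using d(1) pos[OF W] by simp
    from D_threshold_le[OF M(1) Z(1) this] obtain E' where E': "E' \<in> D M 1"
      "\<And>y. y \<in> cart_pow G 1 \<Longrightarrow> \<mu> 2 (fibre G 2 Z y) \<le> (?m - 2 * d) * \<mu> 1 W \<Longrightarrow> y \<in> E'"
      "\<And>y. y \<in> E' \<Longrightarrow> y \<in> cart_pow G 1 \<and> \<mu> 2 (fibre G 2 Z y) \<le> (?m - d) * \<mu> 1 W" by metis
    have "[g] \<in> E'" using E'(2)[of "[g]"] Z(2)[OF gc] tg gc by (simp add: cart_pow_def)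
    moreover have "\<mu> 2 (test A W w) \<le> \<mu> 1 W * (?m - d)" if "[w] \<in> E'" for w
      using E'(3)[OF that] Z(2)[of w] by (simp add: cart_pow_def mult.commute)
    ultimately show ?thesis using E'(1) by blast
  qed
  have pair: "gram A W V \<le> \<mu> 1 W * (?m - d) * \<mu> 1 V"
    if W: "good W" and V: "good V" and t: "\<And>w. [w] \<in> V \<Longrightarrow> \<mu> 2 (test A W w) \<le> \<mu> 1 W * (?m - d)" for W V
  proof -
    have WV: "W \<in> D M 1" "V \<in> D M 1" using W V by (simp_all add: good_def)
    have int: "internal U Gs (2 + 1) (corr A W V \<one>\<^bsub>G\<^esub>)"
      using corr_internal[OF Ai good_int[OF W] good_int[OF V] one_closed] by simp
    have "\<mu> (2 + 1) (corr A W V \<one>\<^bsub>G\<^esub>) \<le> \<mu> 1 W * (?m - d) * \<mu> 1 V"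
    proof (rule fubini_bound[OF int good_int[OF V]])
      fix x y assume xy: "x @ y \<in> corr A W V \<one>\<^bsub>G\<^esub>" "y \<in> cart_pow G 1"
      from xy(2) obtain w where w: "y = [w]" unfolding cart1_iff by blast
      from xy(1) obtain a b c where "x @ [w] = [a, b, c]" "[c] \<in> V" unfolding corr_def w by blast
      then show "y \<in> V" unfolding w by (metis append1_eq_conv append_Cons append_Nil)
    next
      fix y assume y: "y \<in> V"
      then obtain w where w: "y = [w]" "w \<in> carrier G"
        using internal_sub[OF good_int[OF V]] by (metis cart1_iff subsetD)
      \<comment> \<open>Integrating \<open>corr\<close> over its third coordinate turns the inner
        product into an average of \<open>test A W w\<close> over w in V.\<close>
      have "fibre G 2 (corr A W V \<one>\<^bsub>G\<^esub>) [w] = test A W w"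
        using w(2) y unfolding fibre_def test_def corr_def cart2_iff w(1) by auto
      then show "\<mu> 2 (fibre G 2 (corr A W V \<one>\<^bsub>G\<^esub>) y) \<le> \<mu> 1 W * (?m - d)"
        using t[of w] y w(1) by simp
    qed
    then show ?thesis by simp
  qed
  have seq: "\<exists>W. (\<forall>i<N. good (W i)) \<and>
      (\<forall>i j. i < j \<longrightarrow> j < N \<longrightarrow> gram A (W i) (W j) \<le> \<mu> 1 (W i) * (?m - d) * \<mu> 1 (W j))" for N :: nat
  proof (induction N)
    case (Suc N)
    then obtain W where W: "\<And>i. i < N \<Longrightarrow> good (W i)"
      "\<And>i j. i < j \<Longrightarrow> j < N \<Longrightarrow> gram A (W i) (W j) \<le> \<mu> 1 (W i) * (?m - d) * \<mu> 1 (W j)" by blast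
    have "\<forall>i. \<exists>E'. i < N \<longrightarrow> E' \<in> D M 1 \<and> [g] \<in> E' \<and>
      (\<forall>w. [w] \<in> E' \<longrightarrow> \<mu> 2 (test A (W i) w) \<le> \<mu> 1 (W i) * (?m - d))" using step W(1) by blast
    then obtain E' where E': "\<And>i. i < N \<Longrightarrow> E' i \<in> D M 1" "\<And>i. i < N \<Longrightarrow> [g] \<in> E' i"
      "\<And>i w. i < N \<Longrightarrow> [w] \<in> E' i \<Longrightarrow> \<mu> 2 (test A (W i) w) \<le> \<mu> 1 (W i) * (?m - d)" by metis
    \<comment> \<open>The next set meets the conditions imposed by all earlier ones. It still
      contains g, so its density is positive.\<close>
    define V where "V = {xs \<in> E. \<forall>i<N. xs \<in> E' i}"
    have "{xs \<in> E. \<forall>i<k. xs \<in> E' i} \<in> D M 1" if "k \<le> N" for k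
      using that
    proof (induction k)
      case (Suc k)
      have "{xs \<in> E. \<forall>i<Suc k. xs \<in> E' i} = {xs \<in> E. \<forall>i<k. xs \<in> E' i} \<inter> E' k"
        by (auto simp: less_Suc_eq)
      then show ?case using Suc E'(1)[of k] D_Int[OF M(1)] by simp
    qed (use E(1) in simp)
    then have V: "good V" using gE E'(2) by (auto simp: good_def V_def)
    have "gram A (W i) V \<le> \<mu> 1 (W i) * (?m - d) * \<mu> 1 V" if "i < N" for i
      using that by (intro pair[OF W(1) V] E'(3)) (auto simp: V_def)
    then show ?case using W V by (intro exI[of _ "W(N := V)"]) (auto simp: less_Suc_eq)
  qed simp
  \<comment> \<open>Chosen so that \<open>d * N\<close> exceeds \<open>1 + d\<close>, whereas the
    Gram inequality below yields \<open>d * N \<le> 1 + d - ?m\<close>.\<close>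
  obtain N :: nat where N: "(1 + d) / d < real N" using reals_Archimedean2 by blast
  obtain W where W: "\<And>i. i < N \<Longrightarrow> good (W i)"
      "\<And>i j. i < j \<Longrightarrow> j < N \<Longrightarrow> gram A (W i) (W j) \<le> \<mu> 1 (W i) * (?m - d) * \<mu> 1 (W j)"
    using seq[of N] by blast
  have Wp: "\<mu> 1 (W i) > 0" and Wi: "internal U Gs 1 (W i)" if "i < N" for i
    using pos[OF W(1)[OF that]] good_int[OF W(1)[OF that]] by auto
  \<comment> \<open>These coefficients give every function the mean \<open>\<mu> 1 A\<close>. The
    diagonal entries of the Gram matrix become at most 1, the others at most
    \<open>?m - d\<close>.\<close>
  let ?c = "\<lambda>i. 1 / \<mu> 1 (W i)"
  have term_le: "?c i * ?c j * gram A (W i) (W j) \<le> (if i = j then 1 else 0) + (?m - d) * (if i = j then 0 else 1)"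
    if ij: "i < N" "j < N" for i j
  proof -
    have *: "?c i * ?c j * gram A (W i) (W j) \<le> q" if "gram A (W i) (W j) \<le> \<mu> 1 (W i) * q * \<mu> 1 (W j)" for q
      using that Wp[OF ij(1)] Wp[OF ij(2)] by (simp add: divide_le_eq mult.commute mult.left_commute)
    consider "i = j" | "i < j" | "j < i" by linarith
    then show ?thesis
    proof cases
      case 1
      have "gram A (W i) (W j) \<le> \<mu> 1 (W i) * 1 * \<mu> 1 (W j)"
        using corr_self_le[OF Ai Wi[OF ij(1)]] 1 by (simp add: power2_eq_square)
      from *[OF this] show ?thesis using 1 by simp
    next
      case 2
      from *[OF W(2)[OF 2 ij(2)]] show ?thesis using 2 by simp
    next
      case 3
      have "gram A (W i) (W j) \<le> \<mu> 1 (W i) * (?m - d) * \<mu> 1 (W j)"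
        using W(2)[OF 3 ij(1)] corr_sym[OF Ai Wi[OF ij(1)] Wi[OF ij(2)]] by (simp add: mult.commute mult.left_commute)
      from *[OF this] show ?thesis using 3 by simp
    qed
  qed
  have "(\<Sum>i<N. ?c i * (\<mu> 1 A * \<mu> 1 (W i))) = (\<Sum>i<N. \<mu> 1 A)"
  proof (intro sum.cong refl)
    fix i assume "i \<in> {..<N}"
    then have "\<mu> 1 (W i) \<noteq> 0" using Wp[of i] by auto
    then show "?c i * (\<mu> 1 A * \<mu> 1 (W i)) = \<mu> 1 A" by simp
  qed
  then have "(real N * \<mu> 1 A)\<^sup>2 \<le> (\<Sum>i<N. \<Sum>j<N. ?c i * ?c j * gram A (W i) (W j))"
    using corr_gram[OF Ai Wi, of N "\<lambda>i. i" ?c] by simp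
  also have "\<dots> \<le> (\<Sum>i<N. \<Sum>j<N. (if i = j then 1 else 0) + (?m - d) * (if i = j then 0 else 1))"
    using term_le by (intro sum_mono) auto
  also have "\<dots> = real N + (?m - d) * (real N * (real N - 1))"
  proof -
    have row: "(\<Sum>j<N. (if i = j then 1 else 0) + (?m - d) * (if i = j then 0 else 1)) = 1 + (?m - d) * (real N - 1)" if "i < N" for i
    proof -
      have "(\<Sum>j<N. (if i = j then 0 else 1 :: real)) = (\<Sum>j<N. 1 - (if i = j then 1 else 0))" by (intro sum.cong) auto
      also have "\<dots> = real N - 1" using that by (simp add: sum_subtractf)
      finally show ?thesis using that by (simp add: sum.distrib sum_distrib_left[symmetric])
    qed
    have "(\<Sum>i<N. \<Sum>j<N. (if i = j then 1 else 0) + (?m - d) * (if i = j then 0 else 1)) =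
        (\<Sum>i<N. 1 + (?m - d) * (real N - 1))"
      by (intro sum.cong refl row) simp
    then show ?thesis by (simp add: distrib_left)
  qed
  finally have "real N * real N * ?m \<le> real N + (?m - d) * (real N * (real N - 1))"
    by (simp add: power2_eq_square ac_simps)
  then have "real N * (real N * ?m) \<le> real N * (1 + (?m - d) * (real N - 1))"
    by (simp add: algebra_simps)
  moreover have dN: "1 + d < d * real N" using N d(1) by (simp add: divide_less_eq mult.commute)
  then have "real N > 0" using d(1) by (intro Nat.gr0I[THEN of_nat_0_less_iff[THEN iffD2]]) auto
  ultimately have "real N * ?m \<le> 1 + (?m - d) * (real N - 1)" by simp
  then have "d * real N \<le> 1 + d - ?m" by (simp add: algebra_simps)
  then show False using dN zero_le_power2[of "\<mu> 1 A"] by linarith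
qed

end

section \<open>Stable relations\<close>

context tame
begin

lemma D_Ball:
  assumes M: "M \<subseteq> carrier G" and I: "finite I" and P: "\<And>i. i \<in> I \<Longrightarrow> {xs \<in> cart_pow G n. Q i xs} \<in> D M n"
  shows "{xs \<in> cart_pow G n. \<forall>i\<in>I. Q i xs} \<in> D M n"
  using I P
proof (induction I rule: finite_induct)
  case empty
  then show ?case using D_cart by simp
next
  case (insert i I)
  have "{xs \<in> cart_pow G n. Q i xs \<and> (\<forall>i\<in>I. Q i xs)} \<in> D M n"
    using insert by (intro D_conj M) auto
  then show ?case by simp
qed

lemma D_pair:
  assumes "M \<subseteq> carrier G" "S \<in> D M 2" "i < n" "j < n"
  shows "{xs \<in> cart_pow G n. [xs ! i, xs ! j] \<in> S} \<in> D M n"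
proof -
  have "S \<in> D M (length [i, j])" using assms(2) by (simp add: numeral_2_eq_2)
  from D_index[OF assms(1) this, of n] show ?thesis using assms(3,4) by auto
qed

lemma D_triple:
  assumes "M \<subseteq> carrier G" "S \<in> D M 3" "i < n" "j < n" "k < n"
  shows "{xs \<in> cart_pow G n. [xs ! i, xs ! j, xs ! k] \<in> S} \<in> D M n"
proof -
  have "S \<in> D M (length [i, j, k])" using assms(2) by (simp add: numeral_3_eq_3)
  from D_index[OF assms(1) this, of n] show ?thesis using assms(3-5) by auto
qed

lemma D_section:
  assumes S: "S \<in> D (carrier G) 2" and A: "A \<in> D (carrier G) 1" and b: "b \<in> carrier G"
  shows "{[x] | x. [x] \<in> A \<and> [x, b] \<in> S} \<in> D (carrier G) 1"
    and "{[x] | x. [x] \<in> A \<and> [b, x] \<notin> S} \<in> D (carrier G) 1"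
proof -
  note C = order_refl[of "carrier G"]
  have cA: "x \<in> carrier G" if "[x] \<in> A" for x
    using internal_sub[OF D_internal[OF C A]] that by (auto simp: cart_pow_def)
  have b1: "[b] \<in> cart_pow G 1" "set [b] \<subseteq> carrier G" using b by (simp_all add: cart_pow_def)
  have "{xs \<in> cart_pow G (1 + 1). [xs ! 0] \<in> A \<and> [xs ! 0, xs ! 1] \<in> S} \<in> D (carrier G) (1 + 1)"
    by (intro D_conj D_coord D_pair C S A) simp_all
  from D_fibre[OF C this b1]
  show "{[x] | x. [x] \<in> A \<and> [x, b] \<in> S} \<in> D (carrier G) 1"
  proof (rule back_subst[of "\<lambda>X. X \<in> D (carrier G) 1"])
    show "fibre G 1 {xs \<in> cart_pow G (1 + 1). [xs ! 0] \<in> A \<and> [xs ! 0, xs ! 1] \<in> S} [b] =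
        {[x] | x. [x] \<in> A \<and> [x, b] \<in> S}"
      using b cA by (auto simp: fibre_def cart_pow_def length_Suc_conv)
  qed
  have "{xs \<in> cart_pow G (1 + 1). [xs ! 0] \<in> A \<and> \<not> [xs ! 1, xs ! 0] \<in> S} \<in> D (carrier G) (1 + 1)"
    by (intro D_conj D_neg D_coord D_pair C S A) simp_all
  from D_fibre[OF C this b1]
  show "{[x] | x. [x] \<in> A \<and> [b, x] \<notin> S} \<in> D (carrier G) 1"
  proof (rule back_subst[of "\<lambda>X. X \<in> D (carrier G) 1"])
    show "fibre G 1 {xs \<in> cart_pow G (1 + 1). [xs ! 0] \<in> A \<and> \<not> [xs ! 1, xs ! 0] \<in> S} [b] =
        {[x] | x. [x] \<in> A \<and> [b, x] \<notin> S}"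
      using b cA by (auto simp: fibre_def cart_pow_def length_Suc_conv)
  qed
qed

lemma mu_reindex:
  assumes X: "internal U Gs n X" and p: "distinct p" "set p = {..<n}"
  shows "\<mu> n {xs \<in> cart_pow G n. map ((!) xs) p \<in> X} = \<mu> n X"
proof -
  have lp: "length p = n" using p distinct_card by fastforce
  obtain Xs where R: "reps n X Xs" using X unfolding internal_reps by (elim exE)
  have cart: "map ((!) xs) p \<in> cart_pow H n" if "xs \<in> cart_pow H n" for xs and H :: "('c, 'd) monoid_scheme"
    using that p lp by (auto simp: cart_pow_def)
  let ?X = "{xs \<in> cart_pow G n. map ((!) xs) p \<in> X}" and ?Y = "\<lambda>m. {xs \<in> cart_pow (Gs m) n. map ((!) xs) p \<in> Xs m}"
  have "reps n ?X ?Y"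
  proof (rule repsI)
    fix xs ss assume xs: "xs \<in> cart_pow G n" "list_all2 (\<in>) ss xs"
    have l: "length xs = n" "length ss = n" using xs list_all2_lengthD by (auto simp: cart_pow_def)
    have "list_all2 (\<in>) (map ((!) ss) p) (map ((!) xs) p)"
      using xs(2) p l by (auto simp: list_all2_conv_all_nth)
    from reps_mem[OF R cart[OF xs(1)] this]
    have "map ((!) xs) p \<in> X \<longleftrightarrow> eventually (\<lambda>m. at_idx m (map ((!) ss) p) \<in> Xs m) U" .
    moreover have "at_idx m (map ((!) ss) p) = map ((!) (at_idx m ss)) p" for m
      using p l by (auto intro!: map_cong)
    ultimately have "map ((!) xs) p \<in> X \<longleftrightarrow> eventually (\<lambda>m. map ((!) (at_idx m ss)) p \<in> Xs m) U"
      by (simp only:)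
    then show "xs \<in> ?X \<longleftrightarrow> eventually (\<lambda>m. at_idx m ss \<in> ?Y m) U"
      using xs tuple_rep_in[OF xs] by simp
  qed auto
  moreover have "dens m n (?Y m) = dens m n (Xs m)" for m
  proof -
    let ?f = "\<lambda>xs. map ((!) xs) p"
    have inj: "inj_on ?f (cart_pow (Gs m) n)"
    proof (rule inj_onI)
      fix xs ys assume xy: "xs \<in> cart_pow (Gs m) n" "ys \<in> cart_pow (Gs m) n" "?f xs = ?f ys"
      then have "xs ! i = ys ! i" if "i < n" for i using that p(2) by simp
      then show "xs = ys" using xy by (intro nth_equalityI) (auto simp: cart_pow_def)
    qed
    have "?f ` cart_pow (Gs m) n = cart_pow (Gs m) n"
      using inj cart by (intro endo_inj_surj finite_cart) auto
    moreover have "?f ` ?Y m = ?f ` cart_pow (Gs m) n \<inter> Xs m" by blast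
    ultimately have "?f ` ?Y m = Xs m" using reps_sub(2)[OF R, of m] by (simp only: Int_absorb1)
    moreover have "inj_on ?f (?Y m)" using inj by (rule inj_on_subset) auto
    ultimately have "card (?Y m) = card (Xs m)" using card_image[of ?f "?Y m"] by (simp only:)
    then show ?thesis by (simp add: dens_def)
  qed
  ultimately have "((\<lambda>m. dens m n (Xs m)) \<longlongrightarrow> \<mu> n ?X) U" using reps_lim[of n ?X ?Y] by simp
  then show ?thesis using tendsto_unique[OF U_props(1) _ reps_lim[OF R]] by simp
qed

lemma mu_pos_ne: "\<mu> n X > 0 \<Longrightarrow> \<exists>x. x \<in> X"
  using mu_empty[of n] by (metis ex_in_conv less_irrefl)

text \<open>Often used with a fibre in dimension 0, where \<open>G\<^sup>0\<close> has a single
  point of density 1: for k = 0 and \<open>\<mu> n X > 0\<close> the tuple c lies in X, and for l =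
  0 it lies outside Y.\<close>

lemma fubini_choice:
  assumes "internal U Gs n X" "internal U Gs n' Y" "\<mu> n' Y = 0" "n = k + m" "n' = l + m"
  shows "\<exists>c\<in>cart_pow G m. \<mu> k (fibre G k X c) \<ge> \<mu> n X \<and> \<mu> l (fibre G l Y c) = 0"
proof -
  have "internal U Gs (k + m) X" "internal U Gs (l + m) Y" "\<mu> (l + m) Y = 0" using assms by simp_all
  from fubini_positivity[OF this] show ?thesis using assms(4) by metis
qed

lemma cart1_eqI:
  assumes "X \<subseteq> cart_pow G 1" "Y \<subseteq> cart_pow G 1" "\<And>x. x \<in> carrier G \<Longrightarrow> [x] \<in> X \<longleftrightarrow> [x] \<in> Y"
  shows "X = Y"
proof (rule Set.set_eqI)
  fix u
  show "u \<in> X \<longleftrightarrow> u \<in> Y"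
  proof (cases "u \<in> cart_pow G 1")
    case True
    then obtain x where "u = [x]" "x \<in> carrier G" unfolding cart1_iff by blast
    then show ?thesis using assms(3) by simp
  next
    case False
    then show ?thesis using assms(1,2) by blast
  qed
qed

lemma cart2_eqI:
  assumes "X \<subseteq> cart_pow G 2" "Y \<subseteq> cart_pow G 2"
    "\<And>x y. x \<in> carrier G \<Longrightarrow> y \<in> carrier G \<Longrightarrow> [y, x] \<in> X \<longleftrightarrow> [y, x] \<in> Y"
  shows "X = Y"
proof (rule Set.set_eqI)
  fix u
  show "u \<in> X \<longleftrightarrow> u \<in> Y"
  proof (cases "u \<in> cart_pow G 2")
    case True
    then obtain y x where "u = [y, x]" "y \<in> carrier G" "x \<in> carrier G" unfolding cart2_iff by blast
    then show ?thesis using assms(3) by simp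
  next
    case False
    then show ?thesis using assms(1,2) by blast
  qed
qed

text \<open>The pair is listed as \<open>[y, x]\<close> because fibres fix the last coordinates, and
  in \<open>rectangle_of_null\<close> the non-adjacent pair appears there in the order b',
  a.\<close>

definition missing where
  "missing S A B = {[y, x] | x y. [x] \<in> A \<and> [y] \<in> B \<and> [x, y] \<notin> S}"

definition edges where
  "edges S A B = {[x, y] | x y. [x] \<in> A \<and> [y] \<in> B \<and> [x, y] \<in> S}"

text \<open>The induction on the height shrinks the two sides, so they are kept as
  variables.\<close>

definition half_graphs_in where
  "half_graphs_in S A B k = {xs \<in> half_graphs G k S. \<forall>i<k. [xs ! (2 * i)] \<in> A \<and> [xs ! (2 * i + 1)] \<in> B}"

lemma D_sub: "M \<subseteq> carrier G \<Longrightarrow> X \<in> D M n \<Longrightarrow> X \<subseteq> cart_pow G n"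
  using internal_sub[OF D_internal] .

lemma D_sing: "M \<subseteq> carrier G \<Longrightarrow> X \<in> D M 1 \<Longrightarrow> [x] \<in> X \<Longrightarrow> x \<in> carrier G"
  using D_sub[of M X 1] by (auto simp: cart_pow_def)

lemma missing_eq:
  assumes "M \<subseteq> carrier G" "A \<in> D M 1" "B \<in> D M 1"
  shows "missing S A B = {xs \<in> cart_pow G 2. [xs ! 1] \<in> A \<and> [xs ! 0] \<in> B \<and> \<not> [xs ! 1, xs ! 0] \<in> S}"
  using D_sing[OF assms(1,2)] D_sing[OF assms(1,3)] unfolding missing_def cart2_iff by force

lemma edges_eq:
  assumes "M \<subseteq> carrier G" "A \<in> D M 1" "B \<in> D M 1"
  shows "edges S A B = {xs \<in> cart_pow G 2. [xs ! 0] \<in> A \<and> [xs ! 1] \<in> B \<and> [xs ! 0, xs ! 1] \<in> S}"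
  using D_sing[OF assms(1,2)] D_sing[OF assms(1,3)] unfolding edges_def cart2_iff by force

lemma missing_D:
  assumes "M \<subseteq> carrier G" "A \<in> D M 1" "B \<in> D M 1" "S \<in> D M 2"
  shows "missing S A B \<in> D M 2"
  unfolding missing_eq[OF assms(1-3)] using assms by (intro D_conj D_neg D_coord D_pair) simp_all

lemma edges_D:
  assumes "M \<subseteq> carrier G" "A \<in> D M 1" "B \<in> D M 1" "S \<in> D M 2"
  shows "edges S A B \<in> D M 2"
  unfolding edges_eq[OF assms(1-3)] using assms by (intro D_conj D_coord D_pair) simp_all

lemma half_graphs_D:
  assumes M: "M \<subseteq> carrier G" and S: "S \<in> D M 2"
  shows "half_graphs G k S \<in> D M (2 * k)"
proof -
  have "{xs \<in> cart_pow G (2 * k). \<forall>i\<in>{..<k}. \<forall>j\<in>{..<k}. [xs ! (2 * i), xs ! (2 * j + 1)] \<in> S \<longleftrightarrow> i \<le> j} \<in> D M (2 * k)"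
  proof (intro D_Ball M finite_lessThan)
    fix i j assume ij: "i \<in> {..<k}" "j \<in> {..<k}"
    have p: "{xs \<in> cart_pow G (2 * k). [xs ! (2 * i), xs ! (2 * j + 1)] \<in> S} \<in> D M (2 * k)"
      using ij by (intro D_pair M S) auto
    show "{xs \<in> cart_pow G (2 * k). [xs ! (2 * i), xs ! (2 * j + 1)] \<in> S \<longleftrightarrow> i \<le> j} \<in> D M (2 * k)"
      using p D_neg[OF M p] by (cases "i \<le> j") (simp_all del: mult_Suc_right)
  qed
  also have "{xs \<in> cart_pow G (2 * k). \<forall>i\<in>{..<k}. \<forall>j\<in>{..<k}. [xs ! (2 * i), xs ! (2 * j + 1)] \<in> S \<longleftrightarrow> i \<le> j} = half_graphs G k S"
    unfolding half_graphs_def Ball_def lessThan_iff by (rule refl)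
  finally show ?thesis .
qed

lemma half_graphs_in_D:
  assumes M: "M \<subseteq> carrier G" and S: "S \<in> D M 2" and AB: "A \<in> D M 1" "B \<in> D M 1"
  shows "half_graphs_in S A B k \<in> D M (2 * k)"
proof -
  have "{xs \<in> cart_pow G (2 * k). \<forall>i\<in>{..<k}. [xs ! (2 * i)] \<in> A \<and> [xs ! (2 * i + 1)] \<in> B} \<in> D M (2 * k)"
    using AB by (intro D_Ball D_conj D_coord M finite_lessThan) auto
  from D_Int[OF M half_graphs_D[OF M S] this]
  show ?thesis
  proof (rule back_subst[of "\<lambda>X. X \<in> D M (2 * k)"])
    show "half_graphs G k S \<inter> {xs \<in> cart_pow G (2 * k). \<forall>i\<in>{..<k}. [xs ! (2 * i)] \<in> A \<and> [xs ! (2 * i + 1)] \<in> B} =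
        half_graphs_in S A B k"
      unfolding half_graphs_in_def half_graphs_def by blast
  qed
qed

text \<open>The new pair comes last, so b has to be related to every earlier left point and a to no
  earlier right point. The restrictions of the two sides say exactly this.\<close>

lemma half_graph_extend:
  assumes xs: "xs \<in> half_graphs_in S {[x] | x. [x] \<in> A \<and> [x, b] \<in> S} {[y] | y. [y] \<in> B \<and> [a, y] \<notin> S} k"
    and ab: "[a] \<in> A" "[b] \<in> B" "[a, b] \<in> S" "a \<in> carrier G" "b \<in> carrier G"
  shows "xs @ [a, b] \<in> half_graphs_in S A B (Suc k)"
proof -
  have h: "xs \<in> cart_pow G (2 * k)" "\<And>i j. i < k \<Longrightarrow> j < k \<Longrightarrow> [xs ! (2 * i), xs ! (2 * j + 1)] \<in> S \<longleftrightarrow> i \<le> j"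
    "\<And>i. i < k \<Longrightarrow> [xs ! (2 * i)] \<in> A \<and> [xs ! (2 * i), b] \<in> S"
    "\<And>i. i < k \<Longrightarrow> [xs ! (2 * i + 1)] \<in> B \<and> [a, xs ! (2 * i + 1)] \<notin> S"
    using xs unfolding half_graphs_in_def half_graphs_def by auto
  have len: "length xs = 2 * k" using h(1) by (simp add: cart_pow_def)
  have n1: "(xs @ [a, b]) ! (2 * i) = (if i < k then xs ! (2 * i) else a)" if "i < Suc k" for i
    using that len by (auto simp: nth_append less_Suc_eq)
  have n2: "(xs @ [a, b]) ! (2 * i + 1) = (if i < k then xs ! (2 * i + 1) else b)" if "i < Suc k" for i
    using that len by (auto simp: nth_append less_Suc_eq)
  have "xs @ [a, b] \<in> cart_pow G (2 * Suc k)" using h(1) ab by (auto simp: cart_pow_def)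
  moreover have "[(xs @ [a, b]) ! (2 * i), (xs @ [a, b]) ! (2 * j + 1)] \<in> S \<longleftrightarrow> i \<le> j"
    if ij: "i < Suc k" "j < Suc k" for i j
    unfolding n1[OF ij(1)] n2[OF ij(2)] using h(2)[of i j] h(3)[of i] h(4)[of j] ab ij by auto
  moreover have "[(xs @ [a, b]) ! (2 * i)] \<in> A \<and> [(xs @ [a, b]) ! (2 * i + 1)] \<in> B" if i: "i < Suc k" for i
    unfolding n1[OF i] n2[OF i] using h(3)[of i] h(4)[of i] ab by auto
  ultimately show ?thesis unfolding half_graphs_in_def half_graphs_def by blast
qed

text \<open>If almost no \<open>a, b, a', b'\<close> with \<open>(a, b), (a', b), (a', b') \<in> S\<close> have \<open>(a, b') \<notin> S\<close>, then
  the fibres \<open>S\<^sup>b\<close> are pairwise either almost disjoint or almost equal, and the class of a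
  typical one is a complete rectangle.\<close>

lemma rectangle_of_null:
  assumes S: "S \<in> D (carrier G) 2" and AB: "A \<in> D (carrier G) 1" "B \<in> D (carrier G) 1"
    and pos: "\<mu> 2 (edges S A B) > 0"
    and N: "N = {xs \<in> cart_pow G 4. [xs ! 0] \<in> A \<and> [xs ! 1] \<in> B \<and> [xs ! 2] \<in> A \<and> [xs ! 3] \<in> B \<and>
      [xs ! 2, xs ! 3] \<in> S \<and> [xs ! 0, xs ! 3] \<in> S \<and> \<not> [xs ! 2, xs ! 1] \<in> S \<and> [xs ! 0, xs ! 1] \<in> S}"
    and null: "\<mu> 4 N = 0"
  shows "\<exists>A' B'. A' \<in> D (carrier G) 1 \<and> B' \<in> D (carrier G) 1 \<and> \<mu> 1 A' > 0 \<and> \<mu> 1 B' > 0 \<and>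
    \<mu> 2 (missing S A' B') = 0"
proof -
  let ?C = "carrier G"
  note C = order_refl[of ?C]
  note Dint = D_internal[OF C]
  have ND: "N \<in> D ?C 4" unfolding N using S AB by (intro D_conj D_neg D_coord D_pair C) simp_all
  have N_iff: "[x, b', a, b] \<in> N \<longleftrightarrow> [x] \<in> A \<and> [b'] \<in> B \<and> [a] \<in> A \<and> [b] \<in> B \<and>
      [a, b] \<in> S \<and> [x, b] \<in> S \<and> [a, b'] \<notin> S \<and> [x, b'] \<in> S" for x b' a b
    using D_sing[OF C AB(1)] D_sing[OF C AB(2)] by (auto simp: N cart_pow_def)
  \<comment> \<open>Triples (x, y, z) in which x is adjacent to both y and z. Over a fixed z = b
    they are the edges leaving the neighbourhood of b.\<close>
  define L where "L = {xs \<in> cart_pow G 3. [xs ! 0] \<in> A \<and> [xs ! 1] \<in> B \<and> [xs ! 2] \<in> B \<and>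
    [xs ! 0, xs ! 2] \<in> S \<and> [xs ! 0, xs ! 1] \<in> S}"
  have LD: "L \<in> D ?C 3" unfolding L_def using S AB by (intro D_conj D_coord D_pair C) simp_all
  have L_iff: "[x, y, z] \<in> L \<longleftrightarrow> [x] \<in> A \<and> [y] \<in> B \<and> [z] \<in> B \<and> [x, z] \<in> S \<and> [x, y] \<in> S" for x y z
    using D_sing[OF C AB(1)] D_sing[OF C AB(2)] by (auto simp: L_def cart_pow_def)
  have L_pos: "\<mu> 3 L > 0"
  \<comment> \<open>If these triples were null, some a would have a neighbourhood \<open>Ba\<close>
    of positive density with a null square. A point b of \<open>Ba\<close> then has a null fibre in
    that square, but this fibre is \<open>Ba\<close> itself.\<close>
  proof (rule ccontr)
    assume "\<not> \<mu> 3 L > 0"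
    then have L0: "\<mu> 3 L = 0" using mu_ge0[OF Dint[OF LD]] by simp
    note edD = edges_D[OF C AB S]
    \<comment> \<open>Fibres are taken over the last coordinates, so the coordinates are rearranged
      to put the common point a last.\<close>
    define E where "E = {xs \<in> cart_pow G 2. [xs ! 1, xs ! 0] \<in> edges S A B}"
    define L' where "L' = {xs \<in> cart_pow G 3. [xs ! 2, xs ! 0, xs ! 1] \<in> L}"
    have ED: "E \<in> D ?C 2" unfolding E_def using edD by (intro D_pair C) simp_all
    have L'D: "L' \<in> D ?C 3" unfolding L'_def using LD by (intro D_triple C) simp_all
    have "set [1, 0] = {..<2::nat}" by auto
    from mu_reindex[OF Dint[OF edD] _ this] have E_pos: "\<mu> 2 E > 0" using pos by (simp add: E_def)
    have "set [2, 0, 1] = {..<3::nat}" by auto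
    from mu_reindex[OF Dint[OF LD] _ this] have L'0: "\<mu> 3 L' = 0" using L0 by (simp add: L'_def)
    obtain c where c: "c \<in> cart_pow G 1" "\<mu> 1 (fibre G 1 E c) \<ge> \<mu> 2 E" "\<mu> 2 (fibre G 2 L' c) = 0"
      using fubini_choice[OF Dint[OF ED] Dint[OF L'D] L'0, of 1 1 2] by auto
    then obtain a where a: "c = [a]" "a \<in> carrier G" unfolding cart1_iff by blast
    define Ba where "Ba = fibre G 1 E [a]"
    define La where "La = fibre G 2 L' [a]"
    have Ba_pos: "\<mu> 1 Ba > 0" using c(2) E_pos a(1) by (simp add: Ba_def)
    have La0: "\<mu> 2 La = 0" using c(3) a(1) by (simp add: La_def)
    have iB: "internal U Gs 1 Ba" unfolding Ba_def
      using c(1) a(1) by (intro internal_fibre[OF Dint[OF ED]]) simp_all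
    have iL: "internal U Gs 2 La" unfolding La_def
      using c(1) a(1) by (intro internal_fibre[OF Dint[OF L'D]]) simp_all
    obtain e where e: "e \<in> cart_pow G 1" "\<mu> 0 (fibre G 0 Ba e) \<ge> \<mu> 1 Ba" "\<mu> 1 (fibre G 1 La e) = 0"
      using fubini_choice[OF iB iL La0, of 0 1 1] by auto
    then obtain b where b: "e = [b]" "b \<in> carrier G" unfolding cart1_iff by blast
    have Ba_iff: "[y] \<in> Ba \<longleftrightarrow> [a] \<in> A \<and> [y] \<in> B \<and> [a, y] \<in> S" for y
      using a(2) D_sing[OF C AB(2)] by (auto simp: Ba_def E_def fibre_def edges_def cart_pow_def)
    have La_iff: "[x, y] \<in> La \<longleftrightarrow> [a] \<in> A \<and> [x] \<in> B \<and> [y] \<in> B \<and> [a, y] \<in> S \<and> [a, x] \<in> S" for x y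
      using a(2) D_sing[OF C AB(2)] by (auto simp: La_def L'_def fibre_def L_iff cart_pow_def)
    obtain u where "u \<in> fibre G 0 Ba [b]" using mu_pos_ne[of 0 "fibre G 0 Ba [b]"] e(2) Ba_pos b(1) by auto
    then have bB: "[b] \<in> Ba" by (auto simp: fibre_def cart_pow_def)
    have "fibre G 1 La [b] = Ba"
    proof (rule cart1_eqI)
      show "fibre G 1 La [b] \<subseteq> cart_pow G 1" by (rule fibre_sub)
      show "Ba \<subseteq> cart_pow G 1" unfolding Ba_def by (rule fibre_sub)
    qed (use bB b(2) in \<open>simp add: fibre_def La_iff Ba_iff cart_pow_def\<close>)
    then show False using e(3) b(1) Ba_pos by simp
  qed
  define q where "q = \<mu> 3 L"
  have q: "q > 0" using L_pos by (simp add: q_def)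
  \<comment> \<open>The typical point b: its neighbourhood spans edges of density at least q, and
    almost no configuration in \<open>N\<close> uses it.\<close>
  obtain c where c: "c \<in> cart_pow G 1" "\<mu> 2 (fibre G 2 L c) \<ge> q" "\<mu> 3 (fibre G 3 N c) = 0"
    using fubini_choice[OF Dint[OF LD] Dint[OF ND] null, of 2 1 3] by (auto simp: q_def)
  then obtain b where b: "c = [b]" "b \<in> carrier G" unfolding cart1_iff by blast
  define Lb where "Lb = fibre G 2 L [b]"
  define Nb where "Nb = fibre G 3 N [b]"
  have Lb_ge: "\<mu> 2 Lb \<ge> q" using c(2) b(1) by (simp add: Lb_def)
  have Nb0: "\<mu> 3 Nb = 0" using c(3) b(1) by (simp add: Nb_def)
  have iLb: "internal U Gs 2 Lb" unfolding Lb_def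
    using c(1) b(1) by (intro internal_fibre[OF Dint[OF LD]]) simp_all
  have iNb: "internal U Gs 3 Nb" unfolding Nb_def
    using c(1) b(1) by (intro internal_fibre[OF Dint[OF ND]]) simp_all
  have Lb_iff: "[x, y] \<in> Lb \<longleftrightarrow> [x] \<in> A \<and> [y] \<in> B \<and> [b] \<in> B \<and> [x, b] \<in> S \<and> [x, y] \<in> S" for x y
    using D_sing[OF C AB(1)] D_sing[OF C AB(2)] by (auto simp: Lb_def fibre_def L_iff cart_pow_def)
  have Nb_iff: "[x, b', a] \<in> Nb \<longleftrightarrow> [x] \<in> A \<and> [b'] \<in> B \<and> [a] \<in> A \<and> [b] \<in> B \<and>
      [a, b] \<in> S \<and> [x, b] \<in> S \<and> [a, b'] \<notin> S \<and> [x, b'] \<in> S" for x b' a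
    using D_sing[OF C AB(1)] D_sing[OF C AB(2)] by (auto simp: Nb_def fibre_def N_iff cart_pow_def)
  have bB: "[b] \<in> B"
  proof -
    obtain u where u: "u \<in> Lb" using mu_pos_ne[of 2 Lb] Lb_ge q by auto
    with internal_sub[OF iLb] have "u \<in> cart_pow G 2" by (rule subsetD)
    then obtain x y where "u = [x, y]" unfolding cart2_iff by blast
    then show ?thesis using u Lb_iff by simp
  qed
  define A' where "A' = {[x] | x. [x] \<in> A \<and> [x, b] \<in> S}"
  have AD: "A' \<in> D ?C 1" unfolding A'_def by (rule D_section(1)[OF S AB(1) b(2)])
  have A_iff: "[x] \<in> A' \<longleftrightarrow> [x] \<in> A \<and> [x, b] \<in> S" for x by (simp add: A'_def)
  define Z where "Z = {xs \<in> cart_pow G (1 + 1). [xs ! 0] \<in> A' \<and> [xs ! 0, xs ! 1] \<in> S}"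
  have ZD: "Z \<in> D ?C (1 + 1)" unfolding Z_def using S AD by (intro D_conj D_coord D_pair C) simp_all
  have Z_fib: "[x] \<in> fibre G 1 Z [y] \<longleftrightarrow> [x] \<in> A' \<and> [x, y] \<in> S" if "y \<in> carrier G" for x y
    using that D_sing[OF C AD] by (auto simp: fibre_def Z_def cart_pow_def)
  have "q / 2 < q" using q by simp
  \<comment> \<open>The right side of the rectangle consists of the points of B whose neighbourhood
    meets that of b in positive density; by nullity of \<open>Nb\<close> such neighbourhoods contain
    almost all of \<open>A'\<close>.\<close>
  from D_threshold[OF C ZD this] obtain Y where Y: "Y \<in> D ?C 1"
    "\<And>y. y \<in> cart_pow G 1 \<Longrightarrow> \<mu> 1 (fibre G 1 Z y) \<ge> q \<Longrightarrow> y \<in> Y"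
    "\<And>y. y \<in> Y \<Longrightarrow> y \<in> cart_pow G 1 \<and> \<mu> 1 (fibre G 1 Z y) \<ge> q / 2" by metis
  define B' where "B' = Y \<inter> B"
  have BD: "B' \<in> D ?C 1" unfolding B'_def using Y(1) AB(2) by (intro D_Int C)
  have B_pos: "\<mu> 1 B' > 0"
  proof (rule ccontr)
    assume "\<not> \<mu> 1 B' > 0"
    then have B0: "\<mu> 1 B' = 0" using mu_ge0[OF Dint[OF BD]] by simp
    \<comment> \<open>If \<open>B'\<close> were null, some b' outside it would have a fibre in
      \<open>Lb\<close> of density at least q. This fibre is the common neighbourhood of b and b',
      which puts b' into \<open>B'\<close>.\<close>
    obtain e where e: "e \<in> cart_pow G 1" "\<mu> 1 (fibre G 1 Lb e) \<ge> \<mu> 2 Lb" "\<mu> 0 (fibre G 0 B' e) = 0"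
      using fubini_choice[OF iLb Dint[OF BD] B0, of 1 1 0] by auto
    then obtain b' where b': "e = [b']" "b' \<in> carrier G" unfolding cart1_iff by blast
    have big: "\<mu> 1 (fibre G 1 Lb [b']) \<ge> q" using e(2) Lb_ge b'(1) by simp
    then obtain u where u: "u \<in> fibre G 1 Lb [b']" using mu_pos_ne[of 1 "fibre G 1 Lb [b']"] q by auto
    with fibre_sub have "u \<in> cart_pow G 1" by (rule subsetD)
    then obtain x where "u = [x]" unfolding cart1_iff by blast
    then have b'B: "[b'] \<in> B" using u by (simp add: fibre_def Lb_iff)
    have "fibre G 1 Lb [b'] = fibre G 1 Z [b']"
    proof (rule cart1_eqI[OF fibre_sub fibre_sub])
      fix x assume "x \<in> carrier G"
      then show "[x] \<in> fibre G 1 Lb [b'] \<longleftrightarrow> [x] \<in> fibre G 1 Z [b']"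
        unfolding Z_fib[OF b'(2)] A_iff using bB b'B by (simp add: fibre_def Lb_iff cart_pow_def)
    qed
    then have "[b'] \<in> B'" using Y(2)[of "[b']"] big b'B e(1) b'(1) by (simp add: B'_def)
    then have "fibre G 0 B' [b'] = cart_pow G 0" by (auto simp: fibre_def cart_pow_def)
    then show False using e(3) b'(1) mu_cart[of 0] by simp
  qed
  have A_pos: "\<mu> 1 A' > 0"
  proof -
    obtain y where y: "y \<in> B'" using mu_pos_ne[OF B_pos] by blast
    then have y': "y \<in> cart_pow G 1" "\<mu> 1 (fibre G 1 Z y) \<ge> q / 2" using Y(3) by (simp_all add: B'_def)
    have "fibre G 1 Z y \<subseteq> A'"
    proof
      fix u assume u: "u \<in> fibre G 1 Z y"
      then obtain x where "u = [x]" unfolding fibre_def cart1_iff by blast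
      then show "u \<in> A'" using u by (simp add: fibre_def Z_def)
    qed
    from mu_mono[OF internal_fibre[OF Dint[OF ZD] y'(1) refl] Dint[OF AD] this] show ?thesis using y'(2) q by linarith
  qed
  have "\<mu> 2 (missing S A' B') = 0"
  proof (rule ccontr)
    assume n0: "\<mu> 2 (missing S A' B') \<noteq> 0"
    have RD: "missing S A' B' \<in> D ?C 2" by (rule missing_D[OF C AD BD S])
    have R_pos: "\<mu> 2 (missing S A' B') > 0" using n0 mu_ge0[OF Dint[OF RD]] by simp
    \<comment> \<open>A positive set of missing pairs contains a pair over which \<open>Nb\<close>
      is null, yet that fibre is the common neighbourhood of b and b' within A, of density at least
      q/2.\<close>
    obtain e where e: "e \<in> cart_pow G 2" "\<mu> 0 (fibre G 0 (missing S A' B') e) \<ge> \<mu> 2 (missing S A' B')"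
      "\<mu> 1 (fibre G 1 Nb e) = 0"
      using fubini_choice[OF Dint[OF RD] iNb Nb0, of 0 2 1] by auto
    obtain u where "u \<in> fibre G 0 (missing S A' B') e"
      using mu_pos_ne[of 0 "fibre G 0 (missing S A' B') e"] e(2) R_pos by auto
    then have "e \<in> missing S A' B'" by (auto simp: fibre_def cart_pow_def)
    then obtain a b' where ab: "e = [b', a]" "[a] \<in> A'" "[b'] \<in> B'" "[a, b'] \<notin> S" unfolding missing_def by blast
    have ca: "b' \<in> carrier G" using D_sing[OF C BD ab(3)] .
    have "fibre G 1 Nb [b', a] = fibre G 1 Z [b']"
    proof (rule cart1_eqI[OF fibre_sub fibre_sub])
      fix x assume "x \<in> carrier G"
      then show "[x] \<in> fibre G 1 Nb [b', a] \<longleftrightarrow> [x] \<in> fibre G 1 Z [b']"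
        unfolding Z_fib[OF ca] using ab(2-4) bB by (auto simp add: fibre_def Nb_iff A_iff B'_def cart_pow_def)
    qed
    then have "\<mu> 1 (fibre G 1 Z [b']) = 0" using e(3) ab(1) by simp
    then show False using Y(3)[of "[b']"] ab(3) q by (simp add: B'_def)
  qed
  then show ?thesis using AD BD A_pos B_pos by blast
qed

text \<open>Without rectangles, \<open>rectangle_of_null\<close> makes the configurations in
  \<open>N\<close> positive whenever the edges are. Over the pair (a, b) such configurations are
  edges between the neighbours of b and the non-neighbours of a, exactly the sides on which the next
  step of the induction runs.\<close>

lemma half_graphs_positive:
  assumes S: "S \<in> D (carrier G) 2"
    and no_rect: "\<And>A B. A \<in> D (carrier G) 1 \<Longrightarrow> B \<in> D (carrier G) 1 \<Longrightarrow> \<mu> 1 A > 0 \<Longrightarrow> \<mu> 1 B > 0 \<Longrightarrow>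
      \<mu> 2 (missing S A B) \<noteq> 0"
    and AB: "A \<in> D (carrier G) 1" "B \<in> D (carrier G) 1" and pos: "\<mu> 2 (edges S A B) > 0"
  shows "\<mu> (2 * k) (half_graphs_in S A B k) > 0"
  using AB pos
proof (induction k arbitrary: A B)
  case 0
  have "half_graphs_in S A B 0 = cart_pow G 0" by (auto simp: half_graphs_in_def half_graphs_def)
  then show ?case using mu_cart[of 0] by simp
next
  case (Suc k)
  let ?C = "carrier G"
  note C = order_refl[of ?C]
  note Dint = D_internal[OF C]
  note AB = Suc.prems(1,2)
  define N where "N = {xs \<in> cart_pow G 4. [xs ! 0] \<in> A \<and> [xs ! 1] \<in> B \<and> [xs ! 2] \<in> A \<and> [xs ! 3] \<in> B \<and>
      [xs ! 2, xs ! 3] \<in> S \<and> [xs ! 0, xs ! 3] \<in> S \<and> \<not> [xs ! 2, xs ! 1] \<in> S \<and> [xs ! 0, xs ! 1] \<in> S}"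
  have ND: "N \<in> D ?C 4" unfolding N_def using S AB by (intro D_conj D_neg D_coord D_pair C) simp_all
  have "\<mu> 4 N \<noteq> 0"
  proof
    assume "\<mu> 4 N = 0"
    from rectangle_of_null[OF S AB Suc.prems(3) N_def this] no_rect show False by metis
  qed
  then have N_pos: "\<mu> 4 N > 0" using mu_ge0[OF Dint[OF ND]] by simp
  have HD: "half_graphs_in S A B (Suc k) \<in> D ?C (2 * Suc k)" by (rule half_graphs_in_D[OF C S AB])
  show ?case
  proof (rule ccontr)
    assume "\<not> ?case"
    then have H0: "\<mu> (2 * Suc k) (half_graphs_in S A B (Suc k)) = 0" using mu_ge0[OF Dint[OF HD]] by simp
    \<comment> \<open>If the half-graphs of height k + 1 were null, the pair (a, b) could be taken
      with positive fibre in \<open>N\<close> and null fibre among these half-graphs. The induction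
      hypothesis makes the latter fibre positive.\<close>
    obtain c where c: "c \<in> cart_pow G 2" "\<mu> 2 (fibre G 2 N c) \<ge> \<mu> 4 N"
      "\<mu> (2 * k) (fibre G (2 * k) (half_graphs_in S A B (Suc k)) c) = 0"
      using fubini_choice[OF Dint[OF ND] Dint[OF HD] H0, of 2 2 "2 * k"] by auto
    obtain a b where ab: "c = [a, b]" "a \<in> carrier G" "b \<in> carrier G" using c(1) unfolding cart2_iff by blast
    have Nc: "\<mu> 2 (fibre G 2 N [a, b]) > 0" using c(2) N_pos ab(1) by simp
    from mu_pos_ne[OF Nc] have abN: "[a] \<in> A" "[b] \<in> B" "[a, b] \<in> S"
      by (auto simp: fibre_def N_def cart2_iff)
    let ?A = "{[x] | x. [x] \<in> A \<and> [x, b] \<in> S}" and ?B = "{[y] | y. [y] \<in> B \<and> [a, y] \<notin> S}"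
    have AD: "?A \<in> D ?C 1" by (rule D_section(1)[OF S AB(1) ab(3)])
    have BD: "?B \<in> D ?C 1" by (rule D_section(2)[OF S AB(2) ab(2)])
    have "fibre G 2 N [a, b] \<subseteq> edges S ?A ?B"
      by (auto simp: fibre_def N_def edges_def cart2_iff)
    from mu_mono[OF internal_fibre[OF Dint[OF ND]] Dint[OF edges_D[OF C AD BD S]] this]
    have "\<mu> 2 (edges S ?A ?B) > 0" using Nc c(1) ab(1) by simp
    from Suc.IH[OF AD BD this] have "\<mu> (2 * k) (half_graphs_in S ?A ?B k) > 0" .
    moreover have "half_graphs_in S ?A ?B k \<subseteq> fibre G (2 * k) (half_graphs_in S A B (Suc k)) [a, b]"
    proof
      fix xs assume xs: "xs \<in> half_graphs_in S ?A ?B k"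
      have "xs @ [a, b] \<in> half_graphs_in S A B (Suc k)" by (rule half_graph_extend[OF xs abN ab(2,3)])
      moreover have "xs \<in> cart_pow G (2 * k)" using xs by (simp add: half_graphs_in_def half_graphs_def)
      ultimately show "xs \<in> fibre G (2 * k) (half_graphs_in S A B (Suc k)) [a, b]" by (simp add: fibre_def)
    qed
    then have "\<mu> (2 * k) (half_graphs_in S ?A ?B k) \<le> \<mu> (2 * k) (fibre G (2 * k) (half_graphs_in S A B (Suc k)) [a, b])"
      using c(1) ab(1) by (intro mu_mono Dint[OF half_graphs_in_D[OF C S AD BD]] internal_fibre[OF Dint[OF HD]]) simp_all
    ultimately show False using c(3) ab(1) by simp
  qed
qed

lemma stable_rectangle:
  assumes S: "S \<in> D (carrier G) 2" "\<mu> 2 S > 0" and stable: "almost_surely_stable U Gs k S"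
  obtains A B where "A \<in> D (carrier G) 1" "B \<in> D (carrier G) 1" "\<mu> 1 A > 0" "\<mu> 1 B > 0" "\<mu> 2 (missing S A B) = 0"
proof (rule ccontr)
  let ?C = "carrier G"
  note C = order_refl[of ?C]
  assume neg: "\<not> thesis"
  have no_rect: "\<mu> 2 (missing S A B) \<noteq> 0"
    if "A \<in> D ?C 1" "B \<in> D ?C 1" "\<mu> 1 A > 0" "\<mu> 1 B > 0" for A B
    using neg \<open>\<And>A B. A \<in> D (carrier G) 1 \<Longrightarrow> B \<in> D (carrier G) 1 \<Longrightarrow> \<mu> 1 A > 0 \<Longrightarrow> \<mu> 1 B > 0 \<Longrightarrow> \<mu> 2 (missing S A B) = 0 \<Longrightarrow> thesis\<close>[OF that] by blast
  let ?G = "cart_pow G 1"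
  have "edges S ?G ?G = S"
  proof (intro Set.equalityI subsetI)
    fix u assume u: "u \<in> S"
    with D_sub[OF C S(1)] have "u \<in> cart_pow G 2" by (rule subsetD)
    then obtain x y where "u = [x, y]" "x \<in> carrier G" "y \<in> carrier G" unfolding cart2_iff by blast
    then show "u \<in> edges S ?G ?G" using u by (simp add: edges_def cart_pow_def)
  qed (auto simp: edges_def)
  then have "\<mu> 2 (edges S ?G ?G) > 0" using S(2) by simp
  from half_graphs_positive[OF S(1) no_rect D_cart D_cart this]
  have "\<mu> (2 * k) (half_graphs_in S ?G ?G k) > 0" .
  moreover have "\<mu> (2 * k) (half_graphs_in S ?G ?G k) \<le> \<mu> (2 * k) (half_graphs G k S)"
    by (intro mu_mono D_internal[OF C] half_graphs_in_D half_graphs_D C S(1) D_cart) (auto simp: half_graphs_in_def)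
  ultimately show False using stable by (simp add: almost_surely_stable_def)
qed

text \<open>The parameters of the rectangle are moved into \<open>M\<close> by richness, at the cost of an
  arbitrarily small error.\<close>

lemma rich_rectangle:
  assumes M: "rich G F M" and S: "S \<in> D M 2" "\<mu> 2 S > 0" and stable: "almost_surely_stable U Gs k S"
  obtains A B where "A \<in> D M 1" "B \<in> D M 1" "4 * \<mu> 2 (missing S A B) < (\<mu> 1 A)\<^sup>2 * (\<mu> 1 B)\<^sup>2"
proof -
  let ?C = "carrier G"
  note C = order_refl[of ?C]
  have MC: "M \<subseteq> ?C" using M by (simp add: rich_def)
  have SC: "S \<in> D ?C 2" using S(1) defined_over_mono[OF MC, of G F 2] by blast
  obtain A0 B0 where AB0: "A0 \<in> D ?C 1" "B0 \<in> D ?C 1" "\<mu> 1 A0 > 0" "\<mu> 1 B0 > 0" "\<mu> 2 (missing S A0 B0) = 0"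
    using stable_rectangle[OF SC S(2) stable] by metis
  obtain V a where V: "A0 = fibre G 1 V a" "a \<in> cart_pow G (length a)" "V \<in> F (1 + length a)"
    using D_E[OF AB0(1) C] by metis
  obtain W b where W: "B0 = fibre G 1 W b" "b \<in> cart_pow G (length b)" "W \<in> F (1 + length b)"
    using D_E[OF AB0(2) C] by metis
  define m where "m = length a"
  define l where "l = length b"
  have VD: "V \<in> D M (1 + m)" and WD: "W \<in> D M (1 + l)" using V W F_D by (simp_all add: m_def l_def)
  have ab: "a \<in> cart_pow G m" "b \<in> cart_pow G l" using V W by (simp_all add: m_def l_def)
  have lab: "length a = m" "length b = l" by (simp_all add: m_def l_def)
  have half: "\<mu> 1 A0 / 2 < \<mu> 1 A0" "\<mu> 1 B0 / 2 < \<mu> 1 B0" using AB0 by simp_all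
  from D_threshold[OF MC VD half(1)] obtain DA where DA: "DA \<in> D M m" "\<And>y. y \<in> cart_pow G m \<Longrightarrow> \<mu> 1 (fibre G 1 V y) \<ge> \<mu> 1 A0 \<Longrightarrow> y \<in> DA"
      "\<And>y. y \<in> DA \<Longrightarrow> y \<in> cart_pow G m \<and> \<mu> 1 (fibre G 1 V y) \<ge> \<mu> 1 A0 / 2" by metis
  from D_threshold[OF MC WD half(2)] obtain DB where DB: "DB \<in> D M l" "\<And>y. y \<in> cart_pow G l \<Longrightarrow> \<mu> 1 (fibre G 1 W y) \<ge> \<mu> 1 B0 \<Longrightarrow> y \<in> DB"
      "\<And>y. y \<in> DB \<Longrightarrow> y \<in> cart_pow G l \<and> \<mu> 1 (fibre G 1 W y) \<ge> \<mu> 1 B0 / 2" by metis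
  \<comment> \<open>Chosen so that \<open>8 * \<epsilon>\<close> is the product of squares
    guaranteed when both densities drop to half; four times the missing part then stays below
    it.\<close>
  define \<epsilon> where "\<epsilon> = (\<mu> 1 A0 / 2)\<^sup>2 * (\<mu> 1 B0 / 2)\<^sup>2 / 8"
  have eps: "\<epsilon> > 0" using AB0 by (simp add: \<epsilon>_def)
  \<comment> \<open>The missing pairs as a family in the parameters: coordinate 0 is y, coordinate 1
    is x, followed by the m parameters of V and the l parameters of W.\<close>
  define Z where "Z = {xs \<in> cart_pow G (2 + (m + l)). map ((!) xs) (1 # [2..<2 + m]) \<in> V \<and>
    map ((!) xs) (0 # [2 + m..<2 + m + l]) \<in> W \<and> \<not> [xs ! 1, xs ! 0] \<in> S}"
  have "length (1 # [2..<2 + m]) = 1 + m" "length (0 # [2 + m..<2 + m + l]) = 1 + l"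
    by (simp_all only: length_Cons length_upt)
  then have VWD: "V \<in> D M (length (1 # [2..<2 + m]))" "W \<in> D M (length (0 # [2 + m..<2 + m + l]))"
    using VD WD by (simp_all only:)
  have ZD: "Z \<in> D M (2 + (m + l))" unfolding Z_def
  proof (intro D_conj D_neg MC)
    show "{xs \<in> cart_pow G (2 + (m + l)). map ((!) xs) (1 # [2..<2 + m]) \<in> V} \<in> D M (2 + (m + l))"
      by (rule D_index[OF MC VWD(1)]) auto
    show "{xs \<in> cart_pow G (2 + (m + l)). map ((!) xs) (0 # [2 + m..<2 + m + l]) \<in> W} \<in> D M (2 + (m + l))"
      by (rule D_index[OF MC VWD(2)]) auto
    show "{xs \<in> cart_pow G (2 + (m + l)). [xs ! 1, xs ! 0] \<in> S} \<in> D M (2 + (m + l))"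
      by (intro D_pair MC S(1)) simp_all
  qed
  have Z_fib: "fibre G 2 Z (u @ v) = missing S (fibre G 1 V u) (fibre G 1 W v)"
    if u: "u \<in> cart_pow G m" and v: "v \<in> cart_pow G l" for u v
  proof -
    have len: "length u = m" "length v = l" using u v by (simp_all add: cart_pow_def)
    have nth: "map ((!) ([y, x] @ u @ v)) (1 # [2..<2 + m]) = [x] @ u"
      "map ((!) ([y, x] @ u @ v)) (0 # [2 + m..<2 + m + l]) = [y] @ v" for x y
    proof -
      have "map ((!) ([y, x] @ u @ v)) [2..<2 + m] = u" "map ((!) ([y, x] @ u @ v)) [2 + m..<2 + m + l] = v"
        by (rule nth_equalityI; use len in \<open>simp add: nth_append del: upt_Suc\<close>)+
      then show "map ((!) ([y, x] @ u @ v)) (1 # [2..<2 + m]) = [x] @ u"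
        "map ((!) ([y, x] @ u @ v)) (0 # [2 + m..<2 + m + l]) = [y] @ v" by (simp_all only: list.map) simp_all
    qed
    have "[y, x] \<in> fibre G 2 Z (u @ v) \<longleftrightarrow> [y, x] \<in> missing S (fibre G 1 V u) (fibre G 1 W v)"
      if "x \<in> carrier G" "y \<in> carrier G" for x y
    proof -
      have "[y, x] @ u @ v \<in> cart_pow G (2 + (m + l))" using that u v by (simp add: cart_pow_def)
      then have "[y, x] \<in> fibre G 2 Z (u @ v) \<longleftrightarrow> [x] @ u \<in> V \<and> [y] @ v \<in> W \<and> [x, y] \<notin> S"
        using that by (simp add: fibre_def Z_def nth[simplified] cart_pow_def)
      then show ?thesis using that by (simp add: missing_def fibre_def cart_pow_def)
    qed
    moreover have "missing S (fibre G 1 V u) (fibre G 1 W v) \<subseteq> cart_pow G 2"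
      by (auto simp: missing_def fibre_def cart_pow_def)
    ultimately show ?thesis by (intro cart2_eqI fibre_sub)
  qed
  from D_threshold_le[OF MC ZD eps] obtain DZ where DZ: "DZ \<in> D M (m + l)"
      "\<And>y. y \<in> cart_pow G (m + l) \<Longrightarrow> \<mu> 2 (fibre G 2 Z y) \<le> 0 \<Longrightarrow> y \<in> DZ"
      "\<And>y. y \<in> DZ \<Longrightarrow> y \<in> cart_pow G (m + l) \<and> \<mu> 2 (fibre G 2 Z y) \<le> \<epsilon>" by metis
  \<comment> \<open>All parameter tuples that are good enough. The set is defined over
    \<open>M\<close> and contains the original parameters, so richness supplies a tuple from
    \<open>M\<close>.\<close>
  define Q where "Q = {xs \<in> cart_pow G (m + l). map ((!) xs) [0..<m] \<in> DA \<and> map ((!) xs) [m..<m + l] \<in> DB} \<inter> DZ"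
  have "Q \<in> D M (m + l)" unfolding Q_def
  proof (intro D_Int D_conj MC DZ(1))
    show "{xs \<in> cart_pow G (m + l). map ((!) xs) [0..<m] \<in> DA} \<in> D M (m + l)"
      using DA(1) by (intro D_index MC) auto
    show "{xs \<in> cart_pow G (m + l). map ((!) xs) [m..<m + l] \<in> DB} \<in> D M (m + l)"
      using DB(1) by (intro D_index MC) auto
  qed
  moreover have split: "map ((!) (u @ v)) [0..<m] = u" "map ((!) (u @ v)) [m..<m + l] = v"
    if "u \<in> cart_pow G m" "v \<in> cart_pow G l" for u v
    using that by (auto intro!: nth_equalityI simp: nth_append cart_pow_def)
  have "a @ b \<in> Q"
    unfolding Q_def using split[OF ab] DA(2)[OF ab(1)] DB(2)[OF ab(2)] DZ(2)[OF cart_append[OF ab]] Z_fib[OF ab]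
      AB0(5) V(1) W(1) cart_append[OF ab] by simp
  ultimately obtain c where c: "c \<in> Q" "set c \<subseteq> M" using M unfolding rich_def by blast
  define u v where "u = take m c" and "v = drop m c"
  have cc: "c \<in> cart_pow G (m + l)" using c(1) by (simp add: Q_def)
  have uv: "u \<in> cart_pow G m" "v \<in> cart_pow G l" "c = u @ v" "set u \<subseteq> M" "set v \<subseteq> M"
    using cart_take_drop[OF cc] c(2) by (auto simp: u_def v_def dest: in_set_takeD in_set_dropD)
  let ?A = "fibre G 1 V u" and ?B = "fibre G 1 W v"
  have in_D: "u \<in> DA" "v \<in> DB" "c \<in> DZ" using c(1) split[OF uv(1,2)] unfolding Q_def uv(3) by simp_all
  have d: "\<mu> 1 ?A \<ge> \<mu> 1 A0 / 2" "\<mu> 1 ?B \<ge> \<mu> 1 B0 / 2" "\<mu> 2 (missing S ?A ?B) \<le> \<epsilon>"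
    using DA(3)[OF in_D(1)] DB(3)[OF in_D(2)] DZ(3)[OF in_D(3)] unfolding uv(3) Z_fib[OF uv(1,2)]
    by (simp_all only:)
  have "4 * \<mu> 2 (missing S ?A ?B) < 8 * \<epsilon>" using d(3) eps by simp
  also have "\<dots> \<le> (\<mu> 1 ?A)\<^sup>2 * (\<mu> 1 ?B)\<^sup>2"
    unfolding \<epsilon>_def using d(1,2) AB0(3,4) by (simp del: power_divide) (intro mult_mono power_mono; simp)
  finally have "4 * \<mu> 2 (missing S ?A ?B) < (\<mu> 1 ?A)\<^sup>2 * (\<mu> 1 ?B)\<^sup>2" .
  then show thesis using that D_fibre[OF MC VD uv(1,4)] D_fibre[OF MC WD uv(2,5)] by blast
qed

text \<open>Proved at each index and passed to the limit: if x, xg lie in A and y, yg in B, then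
  either the square lies in S or one of its four corners is missing.\<close>

lemma squares_lower_bound:
  assumes A: "internal U Gs 1 A" and B: "internal U Gs 1 B" and S: "internal U Gs 2 S" and g: "g \<in> carrier G"
    and mis: "internal U Gs 2 (missing S A B)"
  shows "internal U Gs 2 (squares G S g)"
    and "\<mu> 1 (recur A g) * \<mu> 1 (recur B g) - 4 * \<mu> 2 (missing S A B) \<le> \<mu> 2 (squares G S g)"
proof -
  obtain As Bs Ss where R: "reps 1 A As" "reps 1 B Bs" "reps 2 S Ss"
    using A B S unfolding internal_reps by (elim exE)
  obtain s where s: "s \<in> g" using rep_ex[OF g] by (elim exE)
  have sc: "s n \<in> carrier (Gs n)" for n using rep_in[OF g s] .
  have sing: "[x] \<in> A \<Longrightarrow> x \<in> carrier G" "[x] \<in> B \<Longrightarrow> x \<in> carrier G" for x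
    using internal_sub[OF A] internal_sub[OF B] by (auto simp: cart_pow_def)
  let ?sq = "\<lambda>n x y. [x, y] \<in> Ss n \<and> [x \<star>\<^sub>n s n, y] \<in> Ss n \<and> [x, y \<star>\<^sub>n s n] \<in> Ss n \<and>
    [x \<star>\<^sub>n s n, y \<star>\<^sub>n s n] \<in> Ss n"
  have sq: "reps 2 (squares G S g) (\<lambda>n. tuples2 (Gs n) (\<lambda>x y. ?sq n x y))"
    unfolding squares_def
  proof (rule reps2)
    fix x y a b assume c: "x \<in> carrier G" "y \<in> carrier G" and r: "a \<in> x" "b \<in> y"
    have xg: "x \<cdot> g \<in> carrier G" "y \<cdot> g \<in> carrier G" using c g by simp_all
    show "([x, y] \<in> S \<and> [x \<cdot> g, y] \<in> S \<and> [x, y \<cdot> g] \<in> S \<and> [x \<cdot> g, y \<cdot> g] \<in> S) \<longleftrightarrow>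
        eventually (\<lambda>n. ?sq n (a n) (b n)) U"
      unfolding eventually_conj_iff
      by (simp only: reps_mem2[OF R(3) c r] reps_mem2[OF R(3) xg(1) c(2) rep_mult[OF c(1) g r(1) s] r(2)]
        reps_mem2[OF R(3) c(1) xg(2) r(1) rep_mult[OF c(2) g r(2) s]]
        reps_mem2[OF R(3) xg rep_mult[OF c(1) g r(1) s] rep_mult[OF c(2) g r(2) s]])
  qed
  then show "internal U Gs 2 (squares G S g)" unfolding internal_reps by blast
  let ?e = "\<lambda>n x y. of_bool ([x] \<in> As n \<and> [y] \<in> Bs n \<and> [x, y] \<notin> Ss n) :: real"
  have ms: "reps 2 (tuples2 G (\<lambda>y x. [x] \<in> A \<and> [y] \<in> B \<and> [x, y] \<notin> S))
    (\<lambda>n. tuples2 (Gs n) (\<lambda>y x. [x] \<in> As n \<and> [y] \<in> Bs n \<and> [x, y] \<notin> Ss n))"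
  proof (rule reps2)
    fix y x b a assume c: "y \<in> carrier G" "x \<in> carrier G" and r: "b \<in> y" "a \<in> x"
    show "([x] \<in> A \<and> [y] \<in> B \<and> [x, y] \<notin> S) \<longleftrightarrow>
        eventually (\<lambda>n. [a n] \<in> As n \<and> [b n] \<in> Bs n \<and> [a n, b n] \<notin> Ss n) U"
      unfolding eventually_conj_iff ev_not
      by (simp only: reps_mem2[OF R(3) c(2,1) r(2,1)] reps_mem1[OF R(1) c(2) r(2)] reps_mem1[OF R(2) c(1) r(1)])
  qed
  have rc: "reps 1 (recur X g) (\<lambda>n. tuples1 (Gs n) (\<lambda>x. [x] \<in> Xs n \<and> [x \<star>\<^sub>n s n] \<in> Xs n))"
    if X: "reps 1 X Xs" for X Xs
    unfolding recur_def
  proof (rule reps1)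
    fix x a assume c: "x \<in> carrier G" "a \<in> x"
    show "([x] \<in> X \<and> [x \<cdot> g] \<in> X) \<longleftrightarrow> eventually (\<lambda>n. [a n] \<in> Xs n \<and> [a n \<star>\<^sub>n s n] \<in> Xs n) U"
      unfolding eventually_conj_iff
      by (simp only: reps_mem1[OF X c] reps_mem1[OF X m_closed[OF c(1) g] rep_mult[OF c(1) g c(2) s]])
  qed
  have miss: "missing S A B = tuples2 G (\<lambda>y x. [x] \<in> A \<and> [y] \<in> B \<and> [x, y] \<notin> S)"
    unfolding missing_def using sing by blast
  have d2: "dens n 2 (tuples2 (Gs n) Q) =
      avg n (\<lambda>x. avg n (\<lambda>y. of_bool (Q x y)))" for n Q
    unfolding dens_def card_pairs[OF fin] avg_def by (simp add: sum_divide_distrib[symmetric] power2_eq_square)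
  have d1: "dens n 1 (tuples1 (Gs n) Q) = avg n (\<lambda>x. of_bool (Q x))" for n Q
    unfolding dens_def card_singletons avg_def by (simp add: sum_of_bool_eq Int_def)
  have fin_ineq: "avg n (\<lambda>x. of_bool ([x] \<in> As n \<and> [x \<star>\<^sub>n s n] \<in> As n)) *
      avg n (\<lambda>y. of_bool ([y] \<in> Bs n \<and> [y \<star>\<^sub>n s n] \<in> Bs n)) -
      4 * avg n (\<lambda>y. avg n (\<lambda>x. ?e n x y)) \<le> avg n (\<lambda>x. avg n (\<lambda>y. of_bool (?sq n x y)))" for n
  proof -
    let ?p = "\<lambda>x. of_bool ([x] \<in> As n \<and> [x \<star>\<^sub>n s n] \<in> As n) :: real"
    let ?q = "\<lambda>y. of_bool ([y] \<in> Bs n \<and> [y \<star>\<^sub>n s n] \<in> Bs n) :: real"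
    let ?s = "\<lambda>x. x \<star>\<^sub>n s n"
    have "avg n ?p * avg n ?q = avg n (\<lambda>x. avg n (\<lambda>y. ?p x * ?q y))"
      unfolding avg_cmult by (simp only: mult.commute[of "_ :: real" "avg n ?q"] avg_cmult)
    also have "\<dots> \<le> avg n (\<lambda>x. avg n (\<lambda>y. of_bool (?sq n x y) + (?e n x y + ?e n (?s x) y + ?e n x (?s y) + ?e n (?s x) (?s y))))"
      by (intro avg_mono) auto
    also have "\<dots> = avg n (\<lambda>x. avg n (\<lambda>y. of_bool (?sq n x y))) + (avg n (\<lambda>x. avg n (?e n x)) +
        avg n (\<lambda>x. avg n (?e n (?s x))) + avg n (\<lambda>x. avg n (\<lambda>y. ?e n x (?s y))) +
        avg n (\<lambda>x. avg n (\<lambda>y. ?e n (?s x) (?s y))))"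
      by (simp only: avg_add)
    finally have le: "avg n ?p * avg n ?q \<le> avg n (\<lambda>x. avg n (\<lambda>y. of_bool (?sq n x y))) + (avg n (\<lambda>x. avg n (?e n x)) +
        avg n (\<lambda>x. avg n (?e n (?s x))) + avg n (\<lambda>x. avg n (\<lambda>y. ?e n x (?s y))) +
        avg n (\<lambda>x. avg n (\<lambda>y. ?e n (?s x) (?s y))))" .
    \<comment> \<open>Right translation in either variable preserves averages, so all four corners
      contribute the same amount.\<close>
    have "(\<lambda>x. avg n (\<lambda>y. ?e n x (?s y))) = (\<lambda>x. avg n (?e n x))"
      "(\<lambda>x. avg n (\<lambda>y. ?e n (?s x) (?s y))) = (\<lambda>x. avg n (?e n (?s x)))"
      by (rule ext, rule avg_translate[OF sc])+
    note le = le[unfolded this]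
    have tr: "avg n (\<lambda>x. avg n (?e n (?s x))) = avg n (\<lambda>x. avg n (?e n x))"
      by (rule avg_translate[OF sc])
    have "avg n (\<lambda>x. avg n (?e n x)) = avg n (\<lambda>y. avg n (\<lambda>x. ?e n x y))"
      unfolding avg_def sum_divide_distrib[symmetric] by (subst sum.swap) (rule refl)
    with le tr show ?thesis by linarith
  qed
  show "\<mu> 1 (recur A g) * \<mu> 1 (recur B g) - 4 * \<mu> 2 (missing S A B) \<le> \<mu> 2 (squares G S g)"
    unfolding miss
    using fin_ineq
    by (intro tendsto_le[OF U_props(1) reps_lim[OF sq] tendsto_diff[OF tendsto_mult[OF reps_lim[OF rc[OF R(1)]] reps_lim[OF rc[OF R(2)]]]
      tendsto_mult[OF tendsto_const reps_lim[OF ms]]]] always_eventually allI)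
     (simp only: d1 d2)
qed

end

theorem theorem5p2:
  fixes U :: "nat filter"
    and Gs :: "nat \<Rightarrow> ('a, 'b) monoid_scheme"
    and F :: "nat \<Rightarrow> (nat \<Rightarrow> 'a) set list set set"
    and M :: "(nat \<Rightarrow> 'a) set set"
    and S :: "(nat \<Rightarrow> 'a) set list set"
    and g :: "(nat \<Rightarrow> 'a) set"
    and k :: nat
  assumes "nonstandard_finite_group U Gs"
    and "tame_family U Gs F"
    and "countable (\<Union>n. F n)"
    and "countable M"
    and "rich (ultraproduct U Gs) F M"
    and "S \<in> defined_over (ultraproduct U Gs) F M 2"
    and "dense U Gs F 2 S"
    and "k \<ge> 1"
    and "almost_surely_stable U Gs k S"
    and "g \<in> component_over (ultraproduct U Gs) F M"
    and "dense_over U Gs F [g] M"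
  shows "internal U Gs 2 (squares (ultraproduct U Gs) S g) \<and>
    loeb_density U Gs 2 (squares (ultraproduct U Gs) S g) > 0"
proof -
  interpret tame U Gs F
    by (intro tame.intro ultra.intro tame_axioms.intro assms(1,2))
  have M: "M \<subseteq> carrier G" using assms(5) by (simp add: rich_def)
  have "S \<in> D (carrier G) 2" using assms(6) defined_over_mono[OF M, of G F 2] by blast
  then have "\<mu> 2 S \<noteq> 0" using assms(7) by (auto simp: dense_def Let_def)
  then have S: "\<mu> 2 S > 0" using mu_ge0[OF D_internal[OF M assms(6)]] by simp
  obtain A B where AB: "A \<in> D M 1" "B \<in> D M 1" "4 * \<mu> 2 (missing S A B) < (\<mu> 1 A)\<^sup>2 * (\<mu> 1 B)\<^sup>2"
    using rich_rectangle[OF assms(5,6) S assms(9)] by metis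
  have "subgroup (component_over G F M) G"
    using component_is_least(1)[OF M assms(4,3)] unfolding component_candidate_def by (rule conjunct1)
  then have g: "g \<in> carrier G" using assms(10) by (rule subgroup.mem_carrier)
  note rec = component_recurrence[OF M assms(4,3,10,11)]
  note sq = squares_lower_bound[OF D_internal[OF M AB(1)] D_internal[OF M AB(2)] D_internal[OF M assms(6)] g
    D_internal[OF M missing_D[OF M AB(1,2) assms(6)]]]
  have "(\<mu> 1 A)\<^sup>2 * (\<mu> 1 B)\<^sup>2 \<le> \<mu> 1 (recur A g) * \<mu> 1 (recur B g)"
    using rec[OF AB(1)] rec[OF AB(2)] by (intro mult_mono) (auto intro: order_trans[OF zero_le_power2])
  then show ?thesis using sq AB(3) by linarith
qed

end
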